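(* Assume that $b:[0,T]\times\mathbb{R}^d\to\mathbb{R}^d$ is a bounded measurable vector field satisfying condition (H) with some $g\in L^1([0,T],L^1_{loc}(\mathbb{R}^d))$. Moreover, assume that the distributional divergence $\mathrm{div}(b)$ of $b$ (in the space variable) exists and that its negative part satisfies $[\mathrm{div}(b)]^-\in L^1([0,T],L^\infty(\mathbb{R}^d))$. Then there exists a unique regular Lagrangian flow generated by (i.e. associated to) $b$.
   Context: Notation: $T>0$; $\mathcal{L}^d$ is Lebesgue measure on $\mathbb{R}^d$. Fix a function $\rho\in C(\mathbb{R}_+,\mathbb{R}_+)$ which is strictly increasing, with $\rho(0)=0$ and $\int_{0+}\frac{\mathrm{d} s}{\rho(s)}=\infty$. Condition (H): a measurable vector field $b:[0,T]\times\mathbb{R}^d\to\mathbb{R}^d$ satisfies (H) with the function $g$ if $g\in L^1([0,T],L^1_{loc}(\mathbb{R}^d))$ is nonnegative and there are Lebesgue negligible subsets $N_t\subset\mathbb{R}^d$ such that for all $t\in[0,T]$ and all $x,y\notin N_t$, $|b_t(x)-b_t(y)|\le (g_t(x)+g_t(y))\,\rho(|x-y|)$. Regular Lagrangian flow: a map $X:[0,T]\times\mathbb{R}^d\to\mathbb{R}^d$ is a regular Lagrangian flow associated to $b\in L^1_{loc}([0,T]\times\mathbb{R}^d,\mathbb{R}^d)$ if (i) for a.e. $x\in\mathbb{R}^d$, the function $t\mapsto X_t(x)$ is absolutely continuous and satisfies $X_t(x)=x+\int_0^t b_s(X_s(x))\,\mathrm{d} s$ for all $t\in[0,T]$; (ii)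 there is a constant $L>0$ independent of $t\in[0,T]$ such that $(X_t)_\#\mathcal{L}^d\le L\mathcal{L}^d$ for all $t\in[0,T]$, where $(X_t)_\#\mathcal{L}^d$ is the push-forward measure. Uniqueness is understood in the almost everywhere sense: any two regular Lagrangian flows $X,\hat X$ associated to $b$ satisfy, for $\mathcal{L}^d$-a.e. $x\in\mathbb{R}^d$, $X_t(x)=\hat X_t(x)$ for all $t\in[0,T]$. *)

theory Defs
  imports "HOL-Probability.Essential_Supremum"
begin

text \<open>
  Time-dependent functions are curried and total; only their values at times in \<open>{0..T}\<close>
  matter. Measurability always refers to the completed (Lebesgue) \<open>\<sigma>\<close>-algebra.
\<close>

definition measurable_on_strip :: "real \<Rightarrow> (real \<Rightarrow> 'a::euclidean_space \<Rightarrow> 'b::euclidean_space) \<Rightarrow> bool" where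
  "measurable_on_strip T f \<longleftrightarrow>
     (\<lambda>(t, x). f t x) \<in> borel_measurable (lebesgue_on ({0..T} \<times> UNIV))"

definition locally_integrable_on :: "('a::euclidean_space \<Rightarrow> 'b::euclidean_space) \<Rightarrow> 'a set \<Rightarrow> bool"
    (infixr "locally'_integrable'_on" 46) where
  "f locally_integrable_on S \<longleftrightarrow>
     (\<forall>K. compact K \<and> K \<subseteq> S \<longrightarrow> set_integrable lebesgue K f)"

text \<open>
  The spaces $L^1([0,T], L^1_{loc})$ and $L^1([0,T], L^\infty)$ consist of jointly measurable
  functions; null sets of times at which the slice fails to be measurable do not affect the
  integrals below.
\<close>

definition L1_L1loc :: "real \<Rightarrow> (real \<Rightarrow> 'a::euclidean_space \<Rightarrow> real) \<Rightarrow> bool" where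
  "L1_L1loc T g \<longleftrightarrow> measurable_on_strip T g \<and>
     (\<forall>K. compact K \<longrightarrow>
       (\<integral>\<^sup>+ t\<in>{0..T}. (\<integral>\<^sup>+ x\<in>K. ennreal \<bar>g t x\<bar> \<partial>lebesgue) \<partial>lebesgue) < \<infinity>)"

definition L1_Linf :: "real \<Rightarrow> (real \<Rightarrow> 'a::euclidean_space \<Rightarrow> real) \<Rightarrow> bool" where
  "L1_Linf T h \<longleftrightarrow> measurable_on_strip T h \<and>
     (\<integral>\<^sup>+ t\<in>{0..T}. esssup lebesgue (\<lambda>x. ennreal \<bar>h t x\<bar>) \<partial>lebesgue) < \<infinity>"

definition osgood_modulus :: "(real \<Rightarrow> real) \<Rightarrow> bool" where
  "osgood_modulus \<rho> \<longleftrightarrow>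
     continuous_on {0..} \<rho> \<and> \<rho> ` {0..} \<subseteq> {0..} \<and> strict_mono_on {0..} \<rho> \<and> \<rho> 0 = 0 \<and>
     (\<forall>\<epsilon>>0. (\<integral>\<^sup>+ s\<in>{0<..\<epsilon>}. ennreal (1 / \<rho> s) \<partial>lebesgue) = \<infinity>)"

definition condition_H ::
    "(real \<Rightarrow> real) \<Rightarrow> real \<Rightarrow> (real \<Rightarrow> 'a::euclidean_space \<Rightarrow> 'a) \<Rightarrow> (real \<Rightarrow> 'a \<Rightarrow> real) \<Rightarrow> bool" where
  "condition_H \<rho> T b g \<longleftrightarrow>
     L1_L1loc T g \<and> (\<forall>t\<in>{0..T}. \<forall>x. 0 \<le> g t x) \<and>
     (\<exists>N. \<forall>t\<in>{0..T}. N t \<in> null_sets lebesgue \<and>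
        (\<forall>x y. x \<notin> N t \<and> y \<notin> N t \<longrightarrow>
           norm (b t x - b t y) \<le> (g t x + g t y) * \<rho> (norm (x - y))))"

primrec C_k :: "nat \<Rightarrow> ('a::euclidean_space \<Rightarrow> real) \<Rightarrow> bool" where
  "C_k 0 f \<longleftrightarrow> continuous_on UNIV f"
| "C_k (Suc k) f \<longleftrightarrow> (\<forall>x. f differentiable (at x)) \<and>
     (\<forall>i\<in>Basis. C_k k (\<lambda>x. frechet_derivative f (at x) i))"

definition test_function :: "('a::euclidean_space \<Rightarrow> real) \<Rightarrow> bool" where
  "test_function \<phi> \<longleftrightarrow> (\<forall>k. C_k k \<phi>) \<and> compact (closure {x. \<phi> x \<noteq> 0})"

text \<open>
  The distributional divergence of \<open>u\<close> exists as the locally integrable function \<open>D\<close>. The term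
  \<open>frechet_derivative \<phi> (at x) (u x)\<close> is $u(x) \cdot \nabla\phi(x)$.
\<close>

definition has_distributional_divergence ::
    "('a::euclidean_space \<Rightarrow> 'a) \<Rightarrow> ('a \<Rightarrow> real) \<Rightarrow> bool" where
  "has_distributional_divergence u D \<longleftrightarrow>
     u locally_integrable_on UNIV \<and> D locally_integrable_on UNIV \<and>
     (\<forall>\<phi>. test_function \<phi> \<longrightarrow>
       (LINT x|lebesgue. frechet_derivative \<phi> (at x) (u x)) = - (LINT x|lebesgue. \<phi> x * D x))"

definition has_spatial_divergence ::
    "real \<Rightarrow> (real \<Rightarrow> 'a::euclidean_space \<Rightarrow> 'a) \<Rightarrow> (real \<Rightarrow> 'a \<Rightarrow> real) \<Rightarrow> bool" where
  "has_spatial_divergence T b D \<longleftrightarrow> measurable_on_strip T D \<and>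
     (AE t in lebesgue_on {0..T}. has_distributional_divergence (b t) (D t))"

text \<open>
  Absolute continuity of a curve on a compact interval. Members of a division are nonempty
  compact intervals with pairwise disjoint interiors, so \<open>Inf K\<close> and \<open>Sup K\<close> are the endpoints.
\<close>

definition absolutely_continuous_curve :: "real \<Rightarrow> real \<Rightarrow> (real \<Rightarrow> 'a::real_normed_vector) \<Rightarrow> bool" where
  "absolutely_continuous_curve a b f \<longleftrightarrow>
     (\<forall>\<epsilon>>0. \<exists>\<delta>>0. \<forall>\<D> S. \<D> division_of S \<and> S \<subseteq> {a..b} \<and> (\<Sum>K\<in>\<D>. Sup K - Inf K) < \<delta> \<longrightarrow>
        (\<Sum>K\<in>\<D>. norm (f (Sup K) - f (Inf K))) < \<epsilon>)"

text \<open>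
  Integrability of \<open>s \<mapsto> b s (X s x)\<close> is required explicitly, since the integral of a
  non-integrable function is \<open>0\<close> by convention.
\<close>

definition regular_lagrangian_flow ::
    "real \<Rightarrow> (real \<Rightarrow> 'a::euclidean_space \<Rightarrow> 'a) \<Rightarrow> (real \<Rightarrow> 'a \<Rightarrow> 'a) \<Rightarrow> bool" where
  "regular_lagrangian_flow T b X \<longleftrightarrow>
     (\<lambda>(t, x). b t x) locally_integrable_on ({0..T} \<times> UNIV) \<and>
     (AE x in lebesgue.
        absolutely_continuous_curve 0 T (\<lambda>t. X t x) \<and>
        set_integrable lebesgue {0..T} (\<lambda>s. b s (X s x)) \<and>
        (\<forall>t\<in>{0..T}. X t x = x + (LINT s:{0..t}|lebesgue. b s (X s x)))) \<and>
     (\<exists>L>0. \<forall>t\<in>{0..T}. X t \<in> borel_measurable lebesgue \<and>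
        distr lebesgue lborel (X t) \<le> scale_measure (ennreal L) lborel)"

end

theory Submission
  imports Defs
begin

text \<open>
  For two curves with velocities $\beta$ and $\gamma$ close to $b$ along the curves, condition (H)
  bounds the derivative of $\psi_\delta(|X - Y|)$, where $\psi_\delta' = 1 / (\rho + \delta)$, by
  $g(X) + g(Y)$ plus the defects divided by $\delta$. Integrated over a ball this is bounded, since
  the push-forwards are dominated by Lebesgue measure, whereas $\psi_\delta(\eta) \to \infty$ as
  $\delta \to 0$ by the Osgood condition. Without defects this gives uniqueness. If the defects tend
  to $0$, then it shows that the approximations are Cauchy in measure, uniformly in time.

  Condition (H) also yields the rate $\rho(\epsilon)$ for the convergence of the mollified fields in
  $L^1$. The approximate flows are polygonal compositions of maps $x \mapsto x + w(x)$ with a small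
  smooth $w$ with ${\rm div}\, w \ge - \int [{\rm div}\, b]^-$; since $\det (I + Dw)$ is
  $1 + {\rm div}\, w$ up to a quadratic error, their push-forwards are bounded uniformly.
\<close>

section \<open>Mollifiers\<close>

text \<open>(H) is the only regularity of \<open>b\<close> in space, and it may fail on null sets
  that a single curve could follow. The bound on the push-forwards excludes this: almost every
  trajectory avoids these sets at almost every time. Estimates along curves thus hold for almost
  every trajectory only. The Lipschitz constants of the mollified fields are not controlled as
  \<epsilon> tends to 0, so two approximations are never compared through them: both velocities are
  compared with \<open>b\<close> at their own positions, and (H) is applied between these positions.
  The Lipschitz constant enters only through the time step, which is chosen after \<epsilon>. A
  bound on the negative part of the divergence bounds Jacobians from below, which is the direction
  that bounds push-forwards from above. The limit is identified by (H) once more, because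
  \<open>b\<close> is not continuous. Compositions of Lebesgue measurable maps need not be
  measurable; hence the argument runs for Borel representatives, and only the end returns to the
  given field and its flows.\<close>

definition flat :: "nat \<Rightarrow> real \<Rightarrow> real" where
  "flat m s = (if s > 0 then (1 / s) ^ m * exp (- (1 / s)) else 0)"

lemma flat_nonneg: "0 \<le> flat m s"
  by (simp add: flat_def)

lemma power_div_fact_le_exp:
  fixes x :: real assumes "0 \<le> x" shows "x ^ n / fact n \<le> exp x"
  using sum_le_suminf[OF summable_exp_generic[of x], of "{n}"] assms
  by (simp add: exp_def divide_inverse mult.commute scaleR_conv_of_real)

text \<open>A single term of the exponential series at \<open>1 / s\<close> dominates
  \<open>(1 / s) ^ (m + k)\<close>. The spare factor \<open>s ^ k\<close> is the order of vanishing
  at 0, and \<open>k\<close> is arbitrary.\<close>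

lemma flat_le_power: assumes s: "s > 0" shows "flat m s \<le> fact (m + k) * s ^ k"
proof -
  have "(1 / s) ^ (m + k) / fact (m + k) \<le> exp (1 / s)"
    by (rule power_div_fact_le_exp) (use s in auto)
  then show ?thesis using s
    by (simp add: flat_def field_simps exp_minus power_add)
qed

lemma flat_le_fact: "flat m s \<le> fact m"
  using flat_le_power[of s m 0] by (cases "s > 0") (auto simp: flat_def)

text \<open>The powers of \<open>1 / s\<close> belong to the family so that it is closed under
  differentiation up to linear combinations: the exponential contributes
  \<open>flat (m + 2)\<close>, the power contributes \<open>flat (m + 1)\<close>. At 0 the
  difference quotient is O(h) by \<open>flat_le_power\<close> with \<open>k = 2\<close>.\<close>

lemma flat_has_real_derivative:
  "(flat m has_real_derivative (flat (m + 2) s - m * flat (m + 1) s)) (at s)"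
proof -
  consider "s > 0" | "s < 0" | "s = 0" by linarith
  then show ?thesis
  proof cases
    case 1
    have d: "((\<lambda>s. 1 / s) has_real_derivative - ((1 / s)\<^sup>2)) (at s)"
      using 1 by (auto intro!: derivative_eq_intros simp: power2_eq_square)
    have e: "((\<lambda>s. exp (- (1 / s))) has_real_derivative exp (- (1 / s)) * (1 / s)\<^sup>2) (at s)"
      using DERIV_fun_exp[OF DERIV_minus[OF d]] by simp
    have "(1 / s) ^ m * (exp (- (1 / s)) * (1 / s)\<^sup>2) + real m * (- ((1 / s)\<^sup>2) * (1 / s) ^ (m - Suc 0)) * exp (- (1 / s))
        = flat (m + 2) s - m * flat (m + 1) s"
    \<comment> \<open>The power rule yields the truncated exponent \<open>m - Suc 0\<close>; for
      \<open>m = 0\<close> the factor \<open>real m\<close> removes that term.\<close>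
    proof (cases m)
      case (Suc k)
      define u where "u = 1 / s"
      have "s > 0" by (rule 1)
      then show ?thesis unfolding flat_def Suc u_def[symmetric]
        by (simp add: power2_eq_square algebra_simps)
    qed (use 1 in \<open>simp add: flat_def power2_eq_square\<close>)
    with DERIV_mult[OF DERIV_power[OF d, of m] e]
    have "((\<lambda>s. (1 / s) ^ m * exp (- (1 / s))) has_real_derivative (flat (m + 2) s - m * flat (m + 1) s)) (at s)"
      by (simp add: ac_simps)
    then show ?thesis
      by (rule has_field_derivative_transform_within_open[where S="{0<..}"]) (use 1 in \<open>auto simp: flat_def\<close>)
  next
    case 2
    have "((\<lambda>s. 0) has_real_derivative (flat (m + 2) s - m * flat (m + 1) s)) (at s)"
      using 2 by (simp add: flat_def)
    then show ?thesis
      by (rule has_field_derivative_transform_within_open[where S="{..<0}"]) (use 2 in \<open>auto simp: flat_def\<close>)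
  next
    case 3
    have "((\<lambda>h. (flat m h) / h) \<longlongrightarrow> 0) (at 0)"
    proof (rule tendsto_0_le[where f="\<lambda>h. h" and K="fact (m + 2)"])
      show "\<forall>\<^sub>F h in at 0. norm (flat m h / h) \<le> norm h * fact (m + 2)"
      proof (intro always_eventually allI)
        fix h :: real show "norm (flat m h / h) \<le> norm h * fact (m + 2)"
        proof (cases "h > 0")
          case True
          then show ?thesis using flat_le_power[of h m 2] flat_nonneg[of m h]
            by (simp add: divide_simps power2_eq_square ac_simps)
        next
          case False
          then have "flat m h = 0" by (simp add: flat_def)
          then show ?thesis unfolding real_norm_def by simp
        qed
      qed
    qed (rule tendsto_ident_at)
    then show ?thesis unfolding DERIV_def using 3 by (simp add: flat_def)
  qed
qed

lemma continuous_on_flat[continuous_intros]: "continuous_on S f \<Longrightarrow> continuous_on S (\<lambda>x. flat m (f x))"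
proof -
  have "continuous_on UNIV (flat m)"
    using flat_has_real_derivative DERIV_isCont by (intro continuous_at_imp_continuous_on) blast
  then show "continuous_on S f \<Longrightarrow> continuous_on S (\<lambda>x. flat m (f x))"
    by (rule continuous_on_compose2) auto
qed

lemma flat_has_derivative[derivative_intros]:
  "(f has_derivative f') (at x) \<Longrightarrow>
    ((\<lambda>x. flat m (f x)) has_derivative (\<lambda>h. (flat (m + 2) (f x) - m * flat (m + 1) (f x)) * f' h)) (at x)"
  using has_derivative_compose[OF _ flat_has_real_derivative[THEN has_field_derivative_imp_has_derivative], of f f' x UNIV m]
  by (simp add: o_def)

text \<open>
  Closure under partial derivatives makes every member smooth in the sense of \<^const>\<open>C_k\<close>; the case
  \<open>m = 0\<close>, \<open>a > 0\<close> of \<open>flat\<close> is a bump function.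
\<close>

inductive bump_algebra :: "('a::euclidean_space \<Rightarrow> real) \<Rightarrow> bool" where
  const: "bump_algebra (\<lambda>x. c)"
| inner: "bump_algebra (\<lambda>x. x \<bullet> v)"
| flat: "bump_algebra (\<lambda>x. flat m (a - (x - y) \<bullet> (x - y)))"
| add: "bump_algebra f \<Longrightarrow> bump_algebra g \<Longrightarrow> bump_algebra (\<lambda>x. f x + g x)"
| mult: "bump_algebra f \<Longrightarrow> bump_algebra g \<Longrightarrow> bump_algebra (\<lambda>x. f x * g x)"

lemma bump_algebra_derivative:
  "bump_algebra f \<Longrightarrow> \<exists>D. (\<forall>x. (f has_derivative D x) (at x)) \<and> (\<forall>i. bump_algebra (\<lambda>x. D x i))"
proof (induction rule: bump_algebra.induct)
  case (const c)
  show ?case by (intro exI[of _ "\<lambda>x h. 0"]) (auto intro: bump_algebra.const)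
next
  case (inner v)
  show ?case by (intro exI[of _ "\<lambda>x h. h \<bullet> v"]) (auto intro!: bump_algebra.const derivative_eq_intros)
next
  case (flat m a y)
  let ?r = "\<lambda>x. a - (x - y) \<bullet> (x - y)"
  have "bump_algebra (\<lambda>x. (flat (m + 2) (?r x) + (- real m) * flat (m + 1) (?r x)) * ((-2) * (x \<bullet> i + (- (y \<bullet> i)))))" for i
    by (intro bump_algebra.intros)
  moreover have "((\<lambda>x. flat m (?r x)) has_derivative
     (\<lambda>i. (flat (m + 2) (?r x) + (- real m) * flat (m + 1) (?r x)) * ((-2) * (x \<bullet> i + (- (y \<bullet> i)))))) (at x)" for x
    by (rule derivative_eq_intros refl)+ (auto simp: inner_diff_left inner_diff_right inner_commute algebra_simps fun_eq_iff)
  ultimately show ?case by (intro exI[of _ "\<lambda>x i. (flat (m + 2) (?r x) + (- real m) * flat (m + 1) (?r x)) * ((-2) * (x \<bullet> i + (- (y \<bullet> i))))"]) blast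
next
  case (add f g)
  then obtain D E where "\<And>x. (f has_derivative D x) (at x)" "\<And>i. bump_algebra (\<lambda>x. D x i)"
    "\<And>x. (g has_derivative E x) (at x)" "\<And>i. bump_algebra (\<lambda>x. E x i)" by metis
  then show ?case by (intro exI[of _ "\<lambda>x i. D x i + E x i"]) (auto intro!: derivative_intros bump_algebra.add)
next
  case (mult f g)
  then obtain D E where "\<And>x. (f has_derivative D x) (at x)" "\<And>i. bump_algebra (\<lambda>x. D x i)"
    "\<And>x. (g has_derivative E x) (at x)" "\<And>i. bump_algebra (\<lambda>x. E x i)" by metis
  with mult.hyps show ?case
    by (intro exI[of _ "\<lambda>x i. f x * E x i + D x i * g x"]) (auto intro!: has_derivative_mult bump_algebra.add bump_algebra.mult)
qed

lemma bump_algebra_C_k: "bump_algebra f \<Longrightarrow> C_k k f"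
proof (induction k arbitrary: f)
  case 0
  then obtain D where "\<And>x. (f has_derivative D x) (at x)" using bump_algebra_derivative by metis
  then show ?case by (auto intro!: continuous_at_imp_continuous_on has_derivative_continuous)
next
  case (Suc k)
  then obtain D where D: "\<And>x. (f has_derivative D x) (at x)" "\<And>i. bump_algebra (\<lambda>x. D x i)"
    using bump_algebra_derivative by metis
  have "frechet_derivative f (at x) = D x" for x
    using frechet_derivative_at[OF D(1)] by simp
  with D Suc.IH show ?case by (auto simp: differentiable_def)
qed


section \<open>The normalised kernel, its gradient and its regularity\<close>

definition kernel_mass :: "'a::euclidean_space itself \<Rightarrow> real \<Rightarrow> real" where
  "kernel_mass _ \<epsilon> = (LINT y::'a|lborel. flat 0 (\<epsilon>\<^sup>2 - y \<bullet> y))"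

definition mollifier :: "real \<Rightarrow> 'a::euclidean_space \<Rightarrow> real" where
  "mollifier \<epsilon> z = flat 0 (\<epsilon>\<^sup>2 - z \<bullet> z) / kernel_mass TYPE('a) \<epsilon>"

text \<open>The derivative of \<open>flat 0\<close> is \<open>flat 2\<close> alone, since the term
  with \<open>flat 1\<close> carries the factor \<open>m = 0\<close>; the chain rule for
  \<open>\<epsilon>\<close> squared minus \<open>z \<bullet> z\<close> contributes
  \<open>- 2\<close> times \<open>z\<close>.\<close>

definition mollifier_grad :: "real \<Rightarrow> 'a::euclidean_space \<Rightarrow> 'a" where
  "mollifier_grad \<epsilon> z = (- 2 / kernel_mass TYPE('a) \<epsilon> * flat 2 (\<epsilon>\<^sup>2 - z \<bullet> z)) *\<^sub>R z"

lemma flat_eq_0_outside: "0 < \<epsilon> \<Longrightarrow> \<epsilon> \<le> norm z \<Longrightarrow> flat m (\<epsilon>\<^sup>2 - z \<bullet> z) = 0"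
proof -
  assume "0 < \<epsilon>" "\<epsilon> \<le> norm z"
  then have "\<epsilon>\<^sup>2 \<le> (norm z)\<^sup>2" by (intro power_mono) auto
  then show ?thesis by (simp add: flat_def dot_square_norm)
qed

lemma integrable_bounded_cball:
  fixes f :: "'a::euclidean_space \<Rightarrow> 'b::{banach, second_countable_topology}"
  assumes "f \<in> borel_measurable borel" "\<And>z. norm (f z) \<le> B" "\<And>z. z \<notin> cball x r \<Longrightarrow> f z = 0"
  shows "integrable lborel f"
proof (rule Bochner_Integration.integrable_bound)
  show "integrable lborel (\<lambda>z. B * indicator (cball x r) z :: real)"
    by (intro integrable_mult_right integrable_real_indicator) (auto simp: emeasure_lborel_cball_finite[unfolded infinity_ennreal_def])
  show "AE z in lborel. norm (f z) \<le> norm (B * indicator (cball x r) z)"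
  proof (rule AE_I2)
    fix z show "norm (f z) \<le> norm (B * indicator (cball x r) z)"
      using assms(2)[of z] assms(3)[of z] by (cases "z \<in> cball x r") (auto simp: indicator_def)
  qed
qed (use assms in simp)

lemma flat_inner_measurable[measurable]: "(\<lambda>z::'a::euclidean_space. flat m (c - z \<bullet> z)) \<in> borel_measurable borel"
  by (intro borel_measurable_continuous_onI continuous_intros)

lemma kernel_integrable: "0 < \<epsilon> \<Longrightarrow> integrable lborel (\<lambda>z::'a::euclidean_space. flat 0 (\<epsilon>\<^sup>2 - z \<bullet> z))"
  by (rule integrable_bounded_cball[where x=0 and r=\<epsilon> and B="fact 0"])
    (auto simp: flat_nonneg flat_eq_0_outside flat_le_fact[of 0, simplified])

lemma kernel_mass_pos: assumes "0 < \<epsilon>" shows "0 < kernel_mass TYPE('a::euclidean_space) \<epsilon>"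
proof -
  let ?f = "\<lambda>z::'a. flat 0 (\<epsilon>\<^sup>2 - z \<bullet> z)"
  have "kernel_mass TYPE('a) \<epsilon> \<noteq> 0"
  proof
    assume "kernel_mass TYPE('a) \<epsilon> = 0"
    then have "AE z in lborel. ?f z = 0"
      unfolding kernel_mass_def
      by (subst (asm) integral_nonneg_eq_0_iff_AE) (auto simp: kernel_integrable assms flat_nonneg)
    moreover have "?f z \<noteq> 0" if "z \<in> ball 0 \<epsilon>" for z
    proof -
      have "norm z < \<epsilon>" using that by simp
      then have "norm z ^ 2 < \<epsilon> ^ 2" by (intro power_strict_mono) auto
      then show ?thesis by (auto simp: flat_def dot_square_norm)
    qed
    ultimately have "AE z in lborel. z \<notin> ball (0::'a) \<epsilon>" by (auto elim!: eventually_mono)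
    then have "ball (0::'a) \<epsilon> \<in> null_sets lborel" by (subst AE_iff_null_sets) auto
    then have "emeasure lborel (ball (0::'a) \<epsilon>) = 0" by auto
    moreover have "emeasure lborel (ball (0::'a) \<epsilon>) \<noteq> 0"
      using assms unit_ball_vol_pos[of "real DIM('a)"] by (simp add: emeasure_ball order_less_le)
    ultimately show False by simp
  qed
  moreover have "0 \<le> kernel_mass TYPE('a) \<epsilon>" unfolding kernel_mass_def by (intro Bochner_Integration.integral_nonneg) (simp add: flat_nonneg)
  ultimately show ?thesis by simp
qed

lemma mollifier_nonneg: "0 \<le> mollifier \<epsilon> (z::'a::euclidean_space)"
proof -
  have "0 \<le> kernel_mass TYPE('a) \<epsilon>" unfolding kernel_mass_def by (intro Bochner_Integration.integral_nonneg) (simp add: flat_nonneg)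
  then show ?thesis by (simp add: mollifier_def flat_nonneg)
qed

lemma mollifier_eq_0: "0 < \<epsilon> \<Longrightarrow> \<epsilon> \<le> norm z \<Longrightarrow> mollifier \<epsilon> z = 0"
  by (simp add: mollifier_def flat_eq_0_outside)

lemma mollifier_grad_eq_0: "0 < \<epsilon> \<Longrightarrow> \<epsilon> \<le> norm z \<Longrightarrow> mollifier_grad \<epsilon> z = 0"
  by (simp add: mollifier_grad_def flat_eq_0_outside)

lemma mollifier_measurable[measurable]: "mollifier \<epsilon> \<in> borel_measurable borel"
  unfolding mollifier_def by measurable

lemma mollifier_grad_measurable[measurable]: "mollifier_grad \<epsilon> \<in> borel_measurable borel"
  unfolding mollifier_grad_def by measurable

lemma mollifier_minus: "mollifier \<epsilon> (- z) = mollifier \<epsilon> z"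
  by (simp add: mollifier_def)

lemma mollifier_commute: "mollifier \<epsilon> (x - y) = mollifier \<epsilon> (y - x)"
  using mollifier_minus[of \<epsilon> "x - y"] by simp

lemma nn_integral_mollifier:
  assumes "0 < \<epsilon>" shows "(\<integral>\<^sup>+ y. ennreal (mollifier \<epsilon> (x - y)) \<partial>lborel) = 1"
proof -
  have "(\<integral>\<^sup>+ y. ennreal (mollifier \<epsilon> (x - y)) \<partial>lborel) = (\<integral>\<^sup>+ y. ennreal (mollifier \<epsilon> (- x + y)) \<partial>lborel)"
    by (simp add: mollifier_commute[of _ x])
  also have "\<dots> = (\<integral>\<^sup>+ y. ennreal (mollifier \<epsilon> y) \<partial>distr lborel borel ((+) (- x)))"
    by (subst nn_integral_distr) auto
  also have "\<dots> = (\<integral>\<^sup>+ y. ennreal (mollifier \<epsilon> (y::'a)) \<partial>lborel)"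
    by (simp add: lborel_distr_plus)
  also have "\<dots> = ennreal (LINT y::'a|lborel. mollifier \<epsilon> y)"
    unfolding mollifier_def
    by (intro nn_integral_eq_integral integrable_divide kernel_integrable assms)
      (use kernel_mass_pos[OF assms, where 'a='a] in \<open>auto simp: flat_nonneg\<close>)
  also have "(LINT y::'a|lborel. mollifier \<epsilon> y) = 1"
    unfolding mollifier_def
    using kernel_mass_pos[OF assms, where 'a='a] by (simp add: kernel_mass_def)
  finally show ?thesis by simp
qed

lemma mollifier_has_derivative:
  "(mollifier \<epsilon> has_derivative (\<lambda>h. mollifier_grad \<epsilon> z \<bullet> h)) (at z)"
proof -
  have "mollifier \<epsilon> = (\<lambda>z::'a. (1 / kernel_mass TYPE('a) \<epsilon>) * flat 0 (\<epsilon>\<^sup>2 - z \<bullet> z))"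
    by (simp add: mollifier_def fun_eq_iff)
  moreover have "((\<lambda>z::'a. (1 / kernel_mass TYPE('a) \<epsilon>) * flat 0 (\<epsilon>\<^sup>2 - z \<bullet> z)) has_derivative (\<lambda>h. mollifier_grad \<epsilon> z \<bullet> h)) (at z)"
    unfolding mollifier_grad_def
    by (rule derivative_eq_intros refl)+ (auto simp: inner_commute fun_eq_iff numeral_2_eq_2)
  ultimately show ?thesis by simp
qed

lemma mollifier_bounded: assumes "0 < \<epsilon>"
  shows "norm (mollifier \<epsilon> (z::'a::euclidean_space)) \<le> 1 / kernel_mass TYPE('a) \<epsilon>"
  using kernel_mass_pos[OF assms, where 'a='a] flat_le_fact[of 0]
  by (simp add: mollifier_def flat_nonneg divide_simps)

lemma mollifier_grad_bounded: assumes "0 < \<epsilon>"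
  shows "\<exists>B>0. \<forall>z::'a::euclidean_space. norm (mollifier_grad \<epsilon> z) \<le> B"
proof (intro exI conjI allI)
  let ?I = "kernel_mass TYPE('a) \<epsilon>"
  have I: "?I > 0" using kernel_mass_pos[OF assms] .
  show "0 < 4 / ?I * \<epsilon> + 1" using I assms by (intro add_nonneg_pos) auto
  fix z :: 'a
  show "norm (mollifier_grad \<epsilon> z) \<le> 4 / ?I * \<epsilon> + 1"
  proof (cases "\<epsilon> \<le> norm z")
    case True then show ?thesis using mollifier_grad_eq_0[OF assms True] I assms by simp
  next
    case False
    have "norm (mollifier_grad \<epsilon> z) = 2 / ?I * (flat 2 (\<epsilon>\<^sup>2 - z \<bullet> z) * norm z)"
      using I by (simp add: mollifier_grad_def flat_nonneg abs_mult)
    also have "\<dots> \<le> 2 / ?I * (2 * \<epsilon>)"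
      using I False flat_le_fact[of 2 "\<epsilon>\<^sup>2 - z \<bullet> z"]
      by (intro mult_left_mono mult_mono) (auto simp: flat_nonneg fact_numeral)
    finally show ?thesis by simp
  qed
qed

lemma mollifier_grad_lipschitz: assumes "0 < \<epsilon>"
  shows "\<exists>B>0. \<forall>z w::'a::euclidean_space. norm (mollifier_grad \<epsilon> z - mollifier_grad \<epsilon> w) \<le> B * norm (z - w)"
proof -
  let ?I = "kernel_mass TYPE('a) \<epsilon>"
  let ?s = "\<lambda>z::'a. \<epsilon>\<^sup>2 - z \<bullet> z"
  define D :: "'a \<Rightarrow> 'a \<Rightarrow> 'a" where "D z h = (- 2 / ?I * ((flat 4 (?s z) - 2 * flat 3 (?s z)) * (- 2 * (z \<bullet> h)))) *\<^sub>R z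
      + (- 2 / ?I * flat 2 (?s z)) *\<^sub>R h" for z h
  \<comment> \<open>\<open>D z\<close> is the derivative of the gradient. The numbers 24, 6 and the
    last factor 2 are \<open>fact 4\<close>, \<open>fact 3\<close> and \<open>fact 2\<close> from
    \<open>flat_le_fact\<close>; the two factors \<epsilon> bound \<open>norm z\<close>, which
    occurs twice, inside the support. The summand 1 makes the constant visibly positive.\<close>
  define B where "B = 2 / ?I * (24 + 2 * 6) * 2 * \<epsilon> * \<epsilon> + 2 / ?I * 2 + 1"
  have I: "?I > 0" using kernel_mass_pos[OF assms] .
  then have B: "B > 0" unfolding B_def using assms by (intro add_nonneg_pos add_nonneg_nonneg mult_nonneg_nonneg) auto
  have der: "(mollifier_grad \<epsilon> has_derivative D z) (at z within UNIV)" for z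
    unfolding mollifier_grad_def D_def
    by (rule derivative_eq_intros refl)+ (auto simp: inner_commute fun_eq_iff algebra_simps numeral_eq_Suc)
  have "onorm (D z) \<le> B" for z
  proof (rule onorm_le)
    fix h
    show "norm (D z h) \<le> B * norm h"
    proof (cases "\<epsilon> \<le> norm z")
      case True then have "D z h = 0" unfolding D_def using flat_eq_0_outside[OF assms True] by simp
      then show ?thesis using B by simp
    next
      case False
      have f: "\<bar>flat 4 (?s z) - 2 * flat 3 (?s z)\<bar> \<le> 24 + 2 * 6"
        using flat_le_fact[of 4 "?s z"] flat_le_fact[of 3 "?s z"] flat_nonneg[of 4 "?s z"] flat_nonneg[of 3 "?s z"]
        by (simp add: fact_numeral)
      have g: "flat 2 (?s z) \<le> 2" using flat_le_fact[of 2 "?s z"] by (simp add: fact_numeral)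
      have "norm (D z h) \<le> norm ((- 2 / ?I * ((flat 4 (?s z) - 2 * flat 3 (?s z)) * (- 2 * (z \<bullet> h)))) *\<^sub>R z)
          + norm ((- 2 / ?I * flat 2 (?s z)) *\<^sub>R h)" unfolding D_def by (rule norm_triangle_ineq)
      also have "\<dots> = (2 / ?I * \<bar>flat 4 (?s z) - 2 * flat 3 (?s z)\<bar>) * 2 * \<bar>z \<bullet> h\<bar> * norm z + 2 / ?I * flat 2 (?s z) * norm h"
        using I by (simp add: abs_mult flat_nonneg)
      also have "\<dots> \<le> (2 / ?I * (24 + 2 * 6)) * 2 * (\<epsilon> * norm h) * \<epsilon> + 2 / ?I * 2 * norm h"
        using I False f g assms Cauchy_Schwarz_ineq2[of z h]
        by (intro add_mono mult_mono order.refl order.trans[OF Cauchy_Schwarz_ineq2 mult_mono]) (auto intro!: mult_nonneg_nonneg flat_nonneg)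
      also have "\<dots> \<le> B * norm h" unfolding B_def by (simp add: algebra_simps)
      finally show ?thesis .
    qed
  qed
  then show ?thesis
    using differentiable_bound[OF convex_UNIV der, where B=B] B by blast
qed

lemma mollifier_lipschitz: assumes "0 < \<epsilon>"
  shows "\<exists>B>0. \<forall>z w::'a::euclidean_space. \<bar>mollifier \<epsilon> z - mollifier \<epsilon> w\<bar> \<le> B * norm (z - w)"
proof -
  obtain B where B: "B > 0" "\<And>z::'a. norm (mollifier_grad \<epsilon> z) \<le> B" using mollifier_grad_bounded[OF assms] by blast
  have "onorm (\<lambda>h. mollifier_grad \<epsilon> z \<bullet> h) \<le> B" for z :: 'a
    by (rule onorm_le) (metis B(2) Cauchy_Schwarz_ineq2 mult_right_mono norm_ge_zero order.trans real_norm_def)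
  then show ?thesis
    using differentiable_bound[OF convex_UNIV mollifier_has_derivative, where B=B] B(1) unfolding real_norm_def by blast
qed

text \<open>The linear part is subtracted before the mean value inequality is applied along the
  segment, so that only a difference of two gradients remains, to which the Lipschitz bound applies.
  Uniformity of the remainder in \<open>z\<close> is what allows differentiation under the
  convolution integral.\<close>

lemma mollifier_taylor: assumes "0 < \<epsilon>"
  shows "\<exists>B>0. \<forall>z h::'a::euclidean_space. \<bar>mollifier \<epsilon> (z + h) - mollifier \<epsilon> z - mollifier_grad \<epsilon> z \<bullet> h\<bar> \<le> B * (norm h)\<^sup>2"
proof -
  obtain B where B: "B > 0" "\<And>z w::'a. norm (mollifier_grad \<epsilon> z - mollifier_grad \<epsilon> w) \<le> B * norm (z - w)"
    using mollifier_grad_lipschitz[OF assms] by blast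
  have "\<bar>mollifier \<epsilon> (z + h) - mollifier \<epsilon> z - mollifier_grad \<epsilon> z \<bullet> h\<bar> \<le> B * (norm h)\<^sup>2" for z h :: 'a
  proof -
    have "\<exists>t\<in>{0<..<1}. norm ((\<lambda>t. mollifier \<epsilon> (z + t *\<^sub>R h) - t * (mollifier_grad \<epsilon> z \<bullet> h)) 1
        - (\<lambda>t. mollifier \<epsilon> (z + t *\<^sub>R h) - t * (mollifier_grad \<epsilon> z \<bullet> h)) 0)
      \<le> norm ((\<lambda>s. mollifier_grad \<epsilon> (z + t *\<^sub>R h) \<bullet> (s *\<^sub>R h) - s * (mollifier_grad \<epsilon> z \<bullet> h)) (1 - 0))"
    proof (rule mvt_general[where f'="\<lambda>t s. mollifier_grad \<epsilon> (z + t *\<^sub>R h) \<bullet> (s *\<^sub>R h) - s * (mollifier_grad \<epsilon> z \<bullet> h)"])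
      have d: "((\<lambda>t. mollifier \<epsilon> (z + t *\<^sub>R h) - t * (mollifier_grad \<epsilon> z \<bullet> h)) has_derivative
          (\<lambda>s. mollifier_grad \<epsilon> (z + t *\<^sub>R h) \<bullet> (s *\<^sub>R h) - s * (mollifier_grad \<epsilon> z \<bullet> h))) (at t)" for t
      proof (rule has_derivative_diff)
        show "((\<lambda>t. mollifier \<epsilon> (z + t *\<^sub>R h)) has_derivative (\<lambda>s. mollifier_grad \<epsilon> (z + t *\<^sub>R h) \<bullet> (s *\<^sub>R h))) (at t)"
          by (rule has_derivative_compose[OF _ mollifier_has_derivative]) (auto intro!: derivative_eq_intros)
      qed (auto intro!: derivative_eq_intros)
      show "((\<lambda>t. mollifier \<epsilon> (z + t *\<^sub>R h) - t * (mollifier_grad \<epsilon> z \<bullet> h)) has_derivative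
          (\<lambda>s. mollifier_grad \<epsilon> (z + t *\<^sub>R h) \<bullet> (s *\<^sub>R h) - s * (mollifier_grad \<epsilon> z \<bullet> h))) (at t)" for t by (rule d)
      show "continuous_on {0..1} (\<lambda>t. mollifier \<epsilon> (z + t *\<^sub>R h) - t * (mollifier_grad \<epsilon> z \<bullet> h))"
        using d by (intro continuous_at_imp_continuous_on ballI has_derivative_continuous)
    qed simp
    then obtain t where t: "t \<in> {0<..<1}"
      "\<bar>mollifier \<epsilon> (z + h) - mollifier \<epsilon> z - mollifier_grad \<epsilon> z \<bullet> h\<bar> \<le> \<bar>(mollifier_grad \<epsilon> (z + t *\<^sub>R h) - mollifier_grad \<epsilon> z) \<bullet> h\<bar>"
      by (auto simp: inner_diff_left algebra_simps)
    note t(2)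
    also have "\<bar>(mollifier_grad \<epsilon> (z + t *\<^sub>R h) - mollifier_grad \<epsilon> z) \<bullet> h\<bar> \<le> norm (mollifier_grad \<epsilon> (z + t *\<^sub>R h) - mollifier_grad \<epsilon> z) * norm h"
      by (rule Cauchy_Schwarz_ineq2)
    also have "\<dots> \<le> (B * norm (t *\<^sub>R h)) * norm h"
      using B(2)[of "z + t *\<^sub>R h" z] by (intro mult_right_mono) auto
    also have "\<dots> \<le> (B * (1 * norm h)) * norm h"
      using t(1) B(1) unfolding norm_scaleR by (intro mult_right_mono mult_left_mono) auto
    finally show ?thesis by (simp add: power2_eq_square mult.assoc)
  qed
  with B(1) show ?thesis by blast
qed

text \<open>Makes the reflected and translated kernel admissible in the definition of the
  distributional divergence.\<close>

lemma mollifier_test_function: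
  assumes "0 < \<epsilon>" shows "test_function (\<lambda>y::'a::euclidean_space. mollifier \<epsilon> (x - y))"
proof -
  have "bump_algebra (\<lambda>y::'a. (1 / kernel_mass TYPE('a) \<epsilon>) * flat 0 (\<epsilon>\<^sup>2 - (y - x) \<bullet> (y - x)))"
    by (intro bump_algebra.intros)
  moreover have "(\<lambda>y::'a. mollifier \<epsilon> (x - y)) = (\<lambda>y. (1 / kernel_mass TYPE('a) \<epsilon>) * flat 0 (\<epsilon>\<^sup>2 - (y - x) \<bullet> (y - x)))"
    unfolding mollifier_commute[of _ x] by (simp add: mollifier_def)
  ultimately have "\<forall>k. C_k k (\<lambda>y::'a. mollifier \<epsilon> (x - y))" by (simp add: bump_algebra_C_k)
  moreover have "closure {y. mollifier \<epsilon> (x - y) \<noteq> 0} \<subseteq> cball x \<epsilon>"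
    using mollifier_eq_0[OF assms] by (intro closure_minimal) (force simp: dist_norm)+
  then have "bounded (closure {y. mollifier \<epsilon> (x - y) \<noteq> 0})"
    using bounded_cball bounded_subset by blast
  then have "compact (closure {y. mollifier \<epsilon> (x - y) \<noteq> 0})" by (simp add: compact_eq_bounded_closed)
  ultimately show ?thesis by (simp add: test_function_def)
qed

text \<open>The minus sign comes from the reflection \<open>x - y\<close>; it later cancels the one
  in the definition of the distributional divergence.\<close>

lemma mollifier_shift_derivative:
  "frechet_derivative (\<lambda>y. mollifier \<epsilon> (x - y)) (at y) v = - (mollifier_grad \<epsilon> (x - y) \<bullet> v)"
proof -
  have "((\<lambda>y. mollifier \<epsilon> (x - y)) has_derivative (\<lambda>v. mollifier_grad \<epsilon> (x - y) \<bullet> (0 - v))) (at y)"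
    by (rule has_derivative_compose[OF _ mollifier_has_derivative]) (rule derivative_intros)+
  then have "((\<lambda>y. mollifier \<epsilon> (x - y)) has_derivative (\<lambda>v. - (mollifier_grad \<epsilon> (x - y) \<bullet> v))) (at y)" by simp
  from frechet_derivative_at[OF this] show ?thesis by metis
qed

section \<open>Push-forward under perturbations of the identity\<close>

text \<open>The three bounds are proved by one induction because each feeds the next: the second
  order error of a longer product needs the first order error of the shorter one, and that needs its
  size.\<close>

lemma prod_one_plus_expansion:
  fixes x :: "'i \<Rightarrow> real" and a :: real
  assumes "finite S" "\<And>i. i \<in> S \<Longrightarrow> \<bar>x i\<bar> \<le> a" "0 \<le> a" "a \<le> 1"
  shows "\<bar>\<Prod>i\<in>S. 1 + x i\<bar> \<le> 2 ^ card S \<and> \<bar>(\<Prod>i\<in>S. 1 + x i) - 1\<bar> \<le> 2 ^ card S * a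
    \<and> \<bar>(\<Prod>i\<in>S. 1 + x i) - 1 - (\<Sum>i\<in>S. x i)\<bar> \<le> card S * 2 ^ card S * a\<^sup>2"
  using assms(1,2)
proof (induction S rule: finite_induct)
  case (insert j S)
  define P where "P = (\<Prod>i\<in>S. 1 + x i)"
  define s where "s = (\<Sum>i\<in>S. x i)"
  define K :: real where "K = 2 ^ card S"
  have K: "K \<ge> 1" by (simp add: K_def)
  have x: "\<bar>x j\<bar> \<le> a" using insert by simp
  have IH: "\<bar>P\<bar> \<le> K" "\<bar>P - 1\<bar> \<le> K * a" "\<bar>P - 1 - s\<bar> \<le> card S * K * a\<^sup>2"
    using insert unfolding P_def s_def K_def by auto
  have "\<bar>(1 + x j) * P\<bar> \<le> 2 * K"
    unfolding abs_mult using x assms(4) IH(1) by (intro mult_mono) auto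
  moreover have "\<bar>(1 + x j) * P - 1\<bar> \<le> 2 * K * a"
  proof -
    have "\<bar>(1 + x j) * P - 1\<bar> \<le> \<bar>P - 1\<bar> + \<bar>x j\<bar> * \<bar>P\<bar>" by (simp add: abs_mult[symmetric] algebra_simps)
    also have "\<dots> \<le> K * a + a * K" using IH x assms(3) by (intro add_mono mult_mono) auto
    finally show ?thesis by simp
  qed
  moreover have "\<bar>(1 + x j) * P - 1 - (x j + s)\<bar> \<le> (card S + 1) * (2 * K) * a\<^sup>2"
  proof -
    have "\<bar>(1 + x j) * P - 1 - (x j + s)\<bar> \<le> \<bar>P - 1 - s\<bar> + \<bar>x j\<bar> * \<bar>P - 1\<bar>" by (simp add: abs_mult[symmetric] algebra_simps)
    also have "\<dots> \<le> card S * K * a\<^sup>2 + a * (K * a)" using IH x assms(3) by (intro add_mono mult_mono) auto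
    also have "\<dots> = (card S + 1) * K * a\<^sup>2" by (simp add: power2_eq_square algebra_simps)
    also have "\<dots> \<le> (card S + 1) * (2 * K) * a\<^sup>2" using K by (intro mult_right_mono mult_left_mono) auto
    finally show ?thesis .
  qed
  ultimately show ?case using insert(1,2) by (simp add: P_def s_def K_def algebra_simps)
qed (use assms(3) in simp)

text \<open>In the Leibniz formula the identity permutation gives the product of the diagonal, hence
  one plus the trace up to a quadratic error. Any other permutation \<open>p\<close> moves some
  \<open>i\<close>, and by injectivity also \<open>p i\<close>, so its term has two off-diagonal
  factors of size \<open>a\<close>; the other factors are at most 2. The factorial counts the
  permutations.\<close>

lemma det_near_identity:
  fixes A :: "real^'n^'n"
  assumes A: "\<And>i j. \<bar>A $ i $ j\<bar> \<le> a" and a: "0 \<le> a" "a \<le> 1"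
  shows "det (mat 1 + A) \<ge> 1 + (\<Sum>i\<in>UNIV. A $ i $ i) - (real CARD('n) + fact CARD('n)) * 2 ^ CARD('n) * a\<^sup>2"
proof -
  let ?U = "UNIV :: 'n set"
  let ?P = "{p. p permutes ?U}"
  let ?t = "\<lambda>p. of_int (sign p) * (\<Prod>i\<in>?U. (mat 1 + A) $ i $ p i)"
  let ?K = "2 ^ CARD('n) :: real"
  have fin: "finite ?P" by (rule finite_permutations) simp
  have id: "id \<in> ?P" by (simp add: permutes_id)
  have "det (mat 1 + A) = ?t id + (\<Sum>p\<in>?P - {id}. ?t p)"
    unfolding det_def by (rule sum.remove[OF fin id])
  moreover have "\<bar>?t id - 1 - (\<Sum>i\<in>?U. A $ i $ i)\<bar> \<le> CARD('n) * ?K * a\<^sup>2"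
    using prod_one_plus_expansion[of ?U "\<lambda>i. A $ i $ i" a] A a by (simp add: mat_def)
  moreover have "\<bar>\<Sum>p\<in>?P - {id}. ?t p\<bar> \<le> fact CARD('n) * (?K * a\<^sup>2)"
  proof -
    have "\<bar>?t p\<bar> \<le> ?K * a\<^sup>2" if p: "p \<in> ?P - {id}" for p
    proof -
      obtain i where i: "p i \<noteq> i" using p by (auto simp: fun_eq_iff)
      have inj: "inj p" using p permutes_inj by blast
      then have j: "p (p i) \<noteq> p i" using i by (simp add: inj_eq)
      define f where "f k = \<bar>(mat 1 + A) $ k $ p k\<bar>" for k
      have f0: "0 \<le> f k" for k by (simp add: f_def)
      have fa: "f k \<le> a" if "p k \<noteq> k" for k using A[of k "p k"] that by (simp add: f_def mat_def)
      have f2: "f k \<le> 2" for k using A[of k "p k"] a by (auto simp: f_def mat_def)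
      have "\<bar>?t p\<bar> = (\<Prod>k\<in>?U. f k)"
        by (simp add: abs_mult abs_prod f_def sign_def)
      also have "\<dots> = f i * (f (p i) * (\<Prod>k\<in>?U - {i} - {p i}. f k))"
        using i prod.remove[of ?U i f] prod.remove[of "?U - {i}" "p i" f] by simp
      also have "\<dots> \<le> a * (a * (\<Prod>k\<in>?U - {i} - {p i}. 2))"
        using a i j by (intro mult_mono fa prod_mono mult_nonneg_nonneg prod_nonneg conjI f0 f2) auto
      also have "\<dots> \<le> a * (a * ?K)"
        unfolding prod_constant using a by (intro mult_left_mono power_increasing card_mono) auto
      finally show ?thesis by (simp add: power2_eq_square ac_simps)
    qed
    then have "\<bar>\<Sum>p\<in>?P - {id}. ?t p\<bar> \<le> (\<Sum>p\<in>?P - {id}. ?K * a\<^sup>2)"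
      by (intro order.trans[OF sum_abs] sum_mono)
    also have "\<dots> \<le> (\<Sum>p\<in>?P. ?K * a\<^sup>2)" by (intro sum_mono2 fin) auto
    also have "\<dots> = fact CARD('n) * (?K * a\<^sup>2)" by (simp add: card_permutations)
    finally show ?thesis .
  qed
  ultimately show ?thesis by (simp add: algebra_simps)
qed

lemma emeasure_vimage_le_of_det_ge:
  fixes F :: "real^'m::{finite,wellorder} \<Rightarrow> real^'m::_"
  assumes der: "\<And>x. (F has_derivative F' x) (at x)" and inj: "inj F"
    and det: "\<And>x. c \<le> det (matrix (F' x))" and c: "0 < c" and A: "A \<in> sets borel"
  shows "emeasure lborel (F -` A) \<le> ennreal (1 / c) * emeasure lborel A"
proof (cases "emeasure lborel A = \<infinity>")
  case True
  then show ?thesis using c by (simp add: ennreal_mult_top)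
next
  case False
  have cont: "continuous_on UNIV F"
    using der by (intro continuous_at_imp_continuous_on ballI has_derivative_continuous)
  have meas: "F -` A \<in> sets borel"
    using measurable_sets[OF borel_measurable_continuous_onI[OF cont] A] by simp
  define S where "S n = F -` A \<inter> cball 0 (real n)" for n
  have S: "S n \<in> sets borel" for n unfolding S_def using meas by simp
  have bound: "emeasure lborel (S n) \<le> ennreal (1 / c) * emeasure lborel A" for n
  proof -
    have Sl: "S n \<in> sets lebesgue" using S[of n] by simp
    have fS: "emeasure lborel (S n) < \<infinity>"
      by (rule emeasure_bounded_finite) (auto simp: S_def)
    have Sm: "S n \<in> lmeasurable" using S[of n] fS by (auto simp: fmeasurable_def)
    have derS: "(F has_derivative F' x) (at x within S n)" for x
      using der has_derivative_at_withinI by blast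
    have "F differentiable_on S n" using derS by (auto simp: differentiable_on_def differentiable_def)
    then have im: "F ` S n \<in> sets lebesgue" using Sl by (intro differentiable_image_in_sets_lebesgue) auto
    have sub: "F ` S n \<subseteq> A" by (auto simp: S_def)
    have Am: "A \<in> lmeasurable" using False A by (auto simp: fmeasurable_def less_top)
    have imm: "F ` S n \<in> lmeasurable" using fmeasurableI2[OF Am sub im] .
    have injS: "inj_on F (S n)" using inj inj_on_subset by blast
    have int: "(\<lambda>x. \<bar>det (matrix (F' x))\<bar>) integrable_on S n"
      using measurable_differentiable_image_eq[OF Sl derS injS] imm by blast
    have "c * measure lebesgue (S n) = integral (S n) (\<lambda>x. c)"
      using Sm integral_mult_right[of "S n" c "\<lambda>x. 1"] by (simp add: lmeasure_integral)
    also have "\<dots> \<le> integral (S n) (\<lambda>x. \<bar>det (matrix (F' x))\<bar>)"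
      using det Sm by (intro integral_le int integrable_on_const) (auto intro: order.trans abs_ge_self)
    also have "\<dots> = measure lebesgue (F ` S n)"
      using measure_differentiable_image_eq[OF Sl derS injS int] by simp
    also have "\<dots> \<le> measure lebesgue A" using sub im Am by (intro measure_mono_fmeasurable) auto
    finally have "measure lebesgue (S n) \<le> (1 / c) * measure lebesgue A" using c by (simp add: field_simps)
    then have "ennreal (measure lebesgue (S n)) \<le> ennreal (1 / c) * ennreal (measure lebesgue A)"
      using c by (simp add: ennreal_mult'[symmetric] ennreal_leI)
    moreover have "emeasure lborel (S n) = ennreal (measure lebesgue (S n))"
      using emeasure_eq_measure2[OF Sm] S[of n] by simp
    moreover have "emeasure lborel A = ennreal (measure lebesgue A)"
      using emeasure_eq_measure2[OF Am] A by simp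
    ultimately show ?thesis by simp
  qed
  have "(SUP n. emeasure lborel (S n)) = emeasure lborel (\<Union>n. S n)"
    using S by (intro SUP_emeasure_incseq) (auto simp: incseq_def S_def)
  moreover have "(\<Union>n. S n) = F -` A"
    unfolding S_def by (auto intro: real_arch_simple)
  ultimately have "emeasure lborel (F -` A) = (SUP n. emeasure lborel (S n))" by simp
  also have "\<dots> \<le> ennreal (1 / c) * emeasure lborel A" by (intro SUP_least bound)
  finally show ?thesis .
qed

text \<open>
  The change of variables formula of the library requires a well-ordered index type. Every finite
  type is in bijection with the following one.
\<close>

typedef ('n::finite) idx = "{..<CARD('n)}"
  by (auto intro: exI[of _ 0])

instantiation idx :: (finite) linorder
begin
definition less_eq_idx :: "'a idx \<Rightarrow> 'a idx \<Rightarrow> bool" where "less_eq_idx x y \<longleftrightarrow> Rep_idx x \<le> Rep_idx y"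
definition less_idx :: "'a idx \<Rightarrow> 'a idx \<Rightarrow> bool" where "less_idx x y \<longleftrightarrow> Rep_idx x < Rep_idx y"
instance by intro_classes (auto simp: less_eq_idx_def less_idx_def Rep_idx_inject)
end

instance idx :: (finite) finite
proof
  have "finite (Rep_idx ` (UNIV :: 'a idx set))"
    by (simp add: type_definition.Rep_range[OF type_definition_idx])
  then show "finite (UNIV :: 'a idx set)" by (rule finite_imageD) (simp add: inj_on_def Rep_idx_inject)
qed

instance idx :: (finite) wellorder
proof -
  have "wf {(x :: 'a idx, y). x < y}"
    by (rule wf_subset[OF wf_measure[of Rep_idx]]) (auto simp: less_idx_def)
  then show "OFCLASS('a idx, wellorder_class)" by (rule wf_wellorderI) intro_classes
qed

lemma ex_idx_bij: "\<exists>e :: 'n::finite idx \<Rightarrow> 'n. bij e"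
proof -
  have "CARD('n idx) = card {..<CARD('n)}" by (rule type_definition.card[OF type_definition_idx])
  then show ?thesis using finite_same_card_bij[of "UNIV :: 'n idx set" "UNIV :: 'n set"] by simp
qed

lemma prod_Basis_vec: "(\<Prod>b\<in>(Basis :: (real^'n) set). f b) = (\<Prod>i\<in>UNIV. f (axis i 1))"
proof -
  have *: "(Basis :: (real^'n) set) = (\<lambda>i. axis i 1) ` UNIV" by (auto simp: Basis_vec_def)
  have "inj (\<lambda>i::'n. axis i (1::real))" by (auto simp: inj_on_def axis_eq_axis)
  then show ?thesis unfolding * by (subst prod.reindex) (auto simp: o_def)
qed

text \<open>Lebesgue measure is determined by boxes, and relabelling coordinates maps a box to a box
  with the same side lengths.\<close>

lemma lborel_distr_reindex:
  fixes e :: "'m::finite \<Rightarrow> 'n::finite"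
  assumes "bij e"
  shows "distr lborel borel (\<lambda>x::real^'n. (\<chi> i. x $ e i)) = (lborel :: (real^'m) measure)"
proof (rule lborel_eqI[symmetric])
  let ?f = "\<lambda>x::real^'n. (\<chi> i. x $ e i) :: real^'m"
  have f: "?f \<in> borel_measurable borel"
    by (intro borel_measurable_continuous_onI continuous_intros)
  fix l u :: "real^'m"
  assume le: "\<And>b. b \<in> Basis \<Longrightarrow> l \<bullet> b \<le> u \<bullet> b"
  have le': "l $ i \<le> u $ i" for i using le[of "axis i 1"] by (simp add: inner_axis)
  define l' u' :: "real^'n" where "l' = (\<chi> j. l $ inv e j)" and "u' = (\<chi> j. u $ inv e j)"
  have ei: "inv e (e i) = i" "e (inv e j) = j" for i j using assms by (simp_all add: bij_is_inj bij_is_surj surj_f_inv_f)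
  have "?f -` box l u = box l' u'"
    unfolding l'_def u'_def by (auto simp: mem_box_cart) (metis ei)+
  then have "emeasure (distr lborel borel ?f) (box l u) = emeasure lborel (box l' u')"
    using f by (simp add: emeasure_distr)
  also have "\<dots> = (\<Prod>b\<in>Basis. (u' - l') \<bullet> b)"
    using le' by (intro emeasure_lborel_box) (auto simp: Basis_vec_def inner_axis l'_def u'_def)
  also have "(\<Prod>b\<in>Basis. (u' - l') \<bullet> b) = (\<Prod>j\<in>UNIV. (u' - l') $ j)" by (simp add: prod_Basis_vec inner_axis)
  also have "\<dots> = (\<Prod>i\<in>UNIV. (u' - l') $ e i)"
    by (rule prod.reindex_bij_betw[OF assms, symmetric])
  also have "\<dots> = (\<Prod>b\<in>Basis. (u - l) \<bullet> b)" by (simp add: prod_Basis_vec inner_axis l'_def u'_def ei)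
  finally show "emeasure (distr lborel borel ?f) (box l u) = (\<Prod>b\<in>Basis. (u - l) \<bullet> b)" .
qed simp


text \<open>Converts the reciprocal of a Jacobian bound \<open>1 - u\<close> into an exponential, so
  that the factors of successive time steps combine by adding exponents. This is the origin of the
  factor 2 in all later exponents.\<close>

lemma exp_double_ge: fixes u :: real assumes "0 \<le> u" "u \<le> 1 / 2" shows "1 \<le> (1 - u) * exp (2 * u)"
proof -
  have "0 \<le> u * (1 - 2 * u)" using assms by (intro mult_nonneg_nonneg) auto
  then have "1 \<le> (1 - u) * (1 + 2 * u)" by (simp add: algebra_simps)
  also have "\<dots> \<le> (1 - u) * exp (2 * u)" using assms by (intro mult_left_mono exp_ge_add_one_self) auto
  finally show ?thesis .
qed

text \<open>The constant of the quadratic error in \<open>det_near_identity\<close>.\<close>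

definition det_const :: "'n::finite itself \<Rightarrow> real" where
  "det_const _ = (real CARD('n) + fact CARD('n)) * 2 ^ CARD('n)"

text \<open>Conjugation with a relabelling of the coordinates reduces to the well-ordered index
  type. In the exponent the entries enter only quadratically: over O(1/h) steps with
  \<open>a\<close> of order h these terms sum to O(h), whereas the bounds \<tau> on the divergence
  add up to a time integral.\<close>

lemma emeasure_vimage_perturbed_identity:
  fixes w :: "real^'n \<Rightarrow> real^'n" and a :: real
  assumes der: "\<And>x. (w has_derivative w' x) (at x)"
    and entries: "\<And>x i j. \<bar>w' x (axis j 1) $ i\<bar> \<le> a"
    and trace: "\<And>x. - \<tau> \<le> (\<Sum>i\<in>UNIV. w' x (axis i 1) $ i)" and \<tau>: "0 \<le> \<tau>"
    and a: "0 \<le> a" "a \<le> 1" "CARD('n) * a + det_const TYPE('n) * a\<^sup>2 \<le> 1 / 2"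
    and inj: "inj (\<lambda>x. x + w x)" and A: "A \<in> sets borel"
  shows "emeasure lborel ((\<lambda>x. x + w x) -` A) \<le> ennreal (exp (2 * (\<tau> + det_const TYPE('n) * a\<^sup>2))) * emeasure lborel A"
proof -
  obtain e :: "'n idx \<Rightarrow> 'n" where e: "bij e" using ex_idx_bij by blast
  have ei: "inv e (e i) = i" "e (inv e j) = j" for i j using e by (simp_all add: bij_is_inj bij_is_surj surj_f_inv_f)
  define \<Phi> where "\<Phi> x = (\<chi> i. x $ e i)" for x :: "real^'n"
  define \<Psi> where "\<Psi> y = (\<chi> j. y $ inv e j)" for y :: "real^'n idx"
  have inv: "\<Psi> (\<Phi> x) = x" "\<Phi> (\<Psi> y) = y" for x y by (simp_all add: \<Phi>_def \<Psi>_def ei vec_eq_iff)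
  have lin: "bounded_linear \<Phi>" "bounded_linear \<Psi>"
    unfolding \<Phi>_def \<Psi>_def by (auto intro!: linear_conv_bounded_linear[THEN iffD1] linearI simp: vec_eq_iff)
  have meas: "\<Phi> \<in> borel_measurable borel" "\<Psi> \<in> borel_measurable borel"
    using lin by (auto intro!: borel_measurable_continuous_onI linear_continuous_on)
  have distr: "distr lborel borel \<Phi> = lborel" "distr lborel borel \<Psi> = lborel"
    unfolding \<Phi>_def \<Psi>_def using lborel_distr_reindex[OF e] lborel_distr_reindex[OF bij_imp_bij_inv[OF e]] by auto
  have em: "emeasure lborel (\<Phi> -` B) = emeasure lborel B" if "B \<in> sets borel" for B
    using emeasure_distr[of \<Phi> lborel borel B] that meas distr by simp
  have em': "emeasure lborel (\<Psi> -` B) = emeasure lborel B" if "B \<in> sets borel" for B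
    using emeasure_distr[of \<Psi> lborel borel B] that meas distr by simp
  have tre: "(\<Sum>i\<in>UNIV. f (e i)) = (\<Sum>i\<in>UNIV. f i)" for f :: "'n \<Rightarrow> real"
    by (rule sum.reindex_bij_betw[OF e])
  have card: "CARD('n idx) = CARD('n)" by (rule bij_betw_same_card[OF e])
  define F where "F y = y + \<Phi> (w (\<Psi> y))" for y
  define F' where "F' y h = h + \<Phi> (w' (\<Psi> y) (\<Psi> h))" for y h
  \<comment> \<open>The trace is bounded below both by \<open>- \<tau>\<close> and by minus the sum
    of the entry bounds. The minimum keeps \<open>u\<close> below 1/2 however large \<tau> is, as
    \<open>exp_double_ge\<close> demands; the final estimate then retains only \<tau>.\<close>
  define u where "u = min \<tau> (CARD('n) * a) + det_const TYPE('n) * a\<^sup>2"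
  have u0: "0 \<le> u" using \<tau> a by (auto simp: u_def det_const_def)
  have u1: "u \<le> 1 / 2" using a by (auto simp: u_def)
  have derF: "(F has_derivative F' y) (at y)" for y
    unfolding F_def F'_def
    by (intro derivative_intros bounded_linear.has_derivative[OF lin(1)]
        has_derivative_compose[OF bounded_linear.has_derivative[OF lin(2) has_derivative_ident] der])
  have "1 - u \<le> det (matrix (F' y))" for y
  proof -
    define W where "W = (\<chi> i j. w' (\<Psi> y) (axis (e j) 1) $ e i)"
    have \<Psi>a: "\<Psi> (axis j 1) = axis (e j) 1" for j
      using ei by (auto simp: \<Psi>_def axis_def vec_eq_iff)
    have "axis j 1 $ i = (mat 1 :: real^'n idx^'n idx) $ i $ j" for i j
      by (simp add: axis_def mat_def)
    then have "matrix (F' y) = mat 1 + W"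
      by (simp add: matrix_def F'_def W_def vec_eq_iff \<Phi>_def \<Psi>a)
    moreover have "1 + (\<Sum>i\<in>UNIV. W $ i $ i) - (real CARD('n idx) + fact CARD('n idx)) * 2 ^ CARD('n idx) * a\<^sup>2 \<le> det (mat 1 + W)"
      using entries a by (intro det_near_identity) (auto simp: W_def)
    moreover have tr: "(\<Sum>i\<in>UNIV. W $ i $ i) = (\<Sum>i\<in>UNIV. w' (\<Psi> y) (axis i 1) $ i)"
      unfolding W_def by (simp add: tre[of "\<lambda>i. w' (\<Psi> y) (axis i 1) $ i"])
    moreover have "- (CARD('n) * a) \<le> (\<Sum>i\<in>UNIV. w' (\<Psi> y) (axis i 1) $ i)"
    proof -
      have "(\<Sum>i\<in>(UNIV::'n set). - a) \<le> (\<Sum>i\<in>UNIV. w' (\<Psi> y) (axis i 1) $ i)"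
        by (intro sum_mono) (metis entries abs_le_iff minus_le_iff)
      then show ?thesis by simp
    qed
    ultimately show ?thesis using trace[of "\<Psi> y"] by (simp add: u_def det_const_def card)
  qed
  moreover have injF: "inj F"
  proof (rule injI)
    fix x y assume "F x = F y"
    then have "\<Psi> (F x) = \<Psi> (F y)" by simp
    then have "\<Psi> x + w (\<Psi> x) = \<Psi> y + w (\<Psi> y)"
      unfolding F_def using linear_add[OF bounded_linear.linear[OF lin(2)]] by (simp add: inv)
    then show "x = y" using inj inv by (metis injD)
  qed
  moreover have B: "\<Psi> -` A \<in> sets borel" using measurable_sets[OF meas(2) A] by simp
  ultimately have 1: "emeasure lborel (F -` (\<Psi> -` A)) \<le> ennreal (1 / (1 - u)) * emeasure lborel (\<Psi> -` A)"
    using u1 by (intro emeasure_vimage_le_of_det_ge[OF derF]) auto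
  have "continuous_on UNIV F"
    using derF by (intro continuous_at_imp_continuous_on ballI has_derivative_continuous)
  then have "F -` (\<Psi> -` A) \<in> sets borel"
    using measurable_sets[OF borel_measurable_continuous_onI B] by simp
  then have "emeasure lborel (F -` (\<Psi> -` A)) = emeasure lborel (\<Phi> -` (F -` (\<Psi> -` A)))" by (simp add: em)
  also have "\<Phi> -` (F -` (\<Psi> -` A)) = (\<lambda>x. x + w x) -` A"
    unfolding F_def using linear_add[OF bounded_linear.linear[OF lin(2)]] by (auto simp: inv)
  finally have "emeasure lborel ((\<lambda>x. x + w x) -` A) \<le> ennreal (1 / (1 - u)) * emeasure lborel A"
    using 1 em'[OF A] by simp
  also have "\<dots> \<le> ennreal (exp (2 * (\<tau> + det_const TYPE('n) * a\<^sup>2))) * emeasure lborel A"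
  proof (intro mult_right_mono ennreal_leI)
    have "1 / (1 - u) \<le> exp (2 * u)" using exp_double_ge[OF u0 u1] u1 by (simp add: field_simps)
    also have "\<dots> \<le> exp (2 * (\<tau> + det_const TYPE('n) * a\<^sup>2))" by (simp add: u_def)
    finally show "1 / (1 - u) \<le> exp (2 * (\<tau> + det_const TYPE('n) * a\<^sup>2))" .
  qed simp
  finally show ?thesis .
qed

section \<open>Convolution of bounded Borel fields with the kernel\<close>

definition mollify :: "real \<Rightarrow> ('a::euclidean_space \<Rightarrow> 'b::euclidean_space) \<Rightarrow> 'a \<Rightarrow> 'b" where
  "mollify \<epsilon> u x = (LINT y|lborel. mollifier \<epsilon> (x - y) *\<^sub>R u y)"

context
  fixes \<epsilon> M :: real and u :: "'a::euclidean_space \<Rightarrow> 'b::euclidean_space"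
  assumes \<epsilon>: "0 < \<epsilon>" and u[measurable]: "u \<in> borel_measurable borel" and uM: "\<And>y. norm (u y) \<le> M"
begin

lemma bound_nonneg: "0 \<le> M"
  using uM[of undefined] norm_ge_zero order_trans by blast

lemma integrable_mollify: "integrable lborel (\<lambda>y. mollifier \<epsilon> (x - y) *\<^sub>R u y)"
proof (rule integrable_bounded_cball)
  show "norm (mollifier \<epsilon> (x - y) *\<^sub>R u y) \<le> 1 / kernel_mass TYPE('a) \<epsilon> * M" for y
    unfolding norm_scaleR using mollifier_bounded[OF \<epsilon>, of "x - y"] uM[of y] kernel_mass_pos[OF \<epsilon>, where 'a='a]
    by (intro mult_mono) auto
  show "mollifier \<epsilon> (x - y) *\<^sub>R u y = 0" if "y \<notin> cball x \<epsilon>" for y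
    using that mollifier_eq_0[OF \<epsilon>, of "x - y"] by (simp add: dist_norm)
qed measurable

lemma norm_mollify_le: "norm (mollify \<epsilon> u x) \<le> M"
proof -
  have i1: "integrable lborel (\<lambda>y. mollifier \<epsilon> (x - y))" and i2: "(LINT y|lborel. mollifier \<epsilon> (x - y)) = 1"
  proof -
    show "integrable lborel (\<lambda>y. mollifier \<epsilon> (x - y))"
      by (rule integrableI_nonneg) (simp_all add: mollifier_nonneg nn_integral_mollifier[OF \<epsilon>])
    show "(LINT y|lborel. mollifier \<epsilon> (x - y)) = 1"
      by (subst integral_eq_nn_integral) (simp_all add: mollifier_nonneg nn_integral_mollifier[OF \<epsilon>])
  qed
  have "norm (mollify \<epsilon> u x) \<le> (LINT y|lborel. norm (mollifier \<epsilon> (x - y) *\<^sub>R u y))"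
    unfolding mollify_def by (rule integral_norm_bound)
  also have "\<dots> \<le> (LINT y|lborel. mollifier \<epsilon> (x - y) * M)"
    using i1
    by (intro integral_mono integrable_norm integrable_mollify) (auto simp: mollifier_nonneg intro!: mult_left_mono uM)
  also have "\<dots> = M" using i2 by simp
  finally show ?thesis .
qed

lemma integrable_mollifier_grad: "integrable lborel (\<lambda>y. (mollifier_grad \<epsilon> (x - y) \<bullet> h) *\<^sub>R u y)"
proof -
  obtain B where B: "B > 0" "\<And>z::'a. norm (mollifier_grad \<epsilon> z) \<le> B" using mollifier_grad_bounded[OF \<epsilon>] by blast
  show ?thesis
  proof (rule integrable_bounded_cball)
    show "norm ((mollifier_grad \<epsilon> (x - y) \<bullet> h) *\<^sub>R u y) \<le> (B * norm h) * M" for y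
      unfolding norm_scaleR real_norm_def using B bound_nonneg
      by (intro mult_mono uM order.trans[OF Cauchy_Schwarz_ineq2] mult_right_mono) auto
    show "(mollifier_grad \<epsilon> (x - y) \<bullet> h) *\<^sub>R u y = 0" if "y \<notin> cball x \<epsilon>" for y
      using that mollifier_grad_eq_0[OF \<epsilon>, of "x - y"] by (simp add: dist_norm)
  qed measurable
qed

text \<open>The quadratic Taylor remainder of the kernel is integrated against \<open>u\<close>. For
  \<open>x'\<close> within distance 1 of \<open>x\<close> all integrands live in the ball of radius
  \<open>\<epsilon> + 1\<close> around \<open>x\<close>, so the remainder stays quadratic after
  integration.\<close>

lemma mollify_has_derivative:
  "(mollify \<epsilon> u has_derivative (\<lambda>h. LINT y|lborel. (mollifier_grad \<epsilon> (x - y) \<bullet> h) *\<^sub>R u y)) (at x)"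
proof -
  let ?D = "\<lambda>h. LINT y|lborel. (mollifier_grad \<epsilon> (x - y) \<bullet> h) *\<^sub>R u y"
  obtain B where B: "B > 0"
    "\<And>z h::'a. \<bar>mollifier \<epsilon> (z + h) - mollifier \<epsilon> z - mollifier_grad \<epsilon> z \<bullet> h\<bar> \<le> B * (norm h)\<^sup>2"
    using mollifier_taylor[OF \<epsilon>] by blast
  let ?V = "measure lborel (cball x (\<epsilon> + 1))"
  have est: "norm (mollify \<epsilon> u x' - mollify \<epsilon> u x - ?D (x' - x)) \<le> (B * M * ?V) * (norm (x' - x))\<^sup>2" if d: "dist x' x < 1" for x'
  proof -
    let ?r = "\<lambda>y. (mollifier \<epsilon> (x' - y) - mollifier \<epsilon> (x - y) - mollifier_grad \<epsilon> (x - y) \<bullet> (x' - x)) *\<^sub>R u y"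
    have "mollify \<epsilon> u x' - mollify \<epsilon> u x - ?D (x' - x) = (LINT y|lborel. ?r y)"
      unfolding mollify_def scaleR_left_diff_distrib
      by (simp add: integrable_mollify integrable_mollifier_grad)
    also have "norm \<dots> \<le> (LINT y|lborel. norm (?r y))" by (rule integral_norm_bound)
    also have "\<dots> \<le> (LINT y|lborel. (B * (norm (x' - x))\<^sup>2 * M) * indicator (cball x (\<epsilon> + 1)) y)"
    proof (rule integral_mono)
      show "integrable lborel (\<lambda>y. norm (?r y))"
        unfolding scaleR_left_diff_distrib
        by (intro integrable_norm Bochner_Integration.integrable_diff integrable_mollify integrable_mollifier_grad)
      show "integrable lborel (\<lambda>y. (B * (norm (x' - x))\<^sup>2 * M) * indicator (cball x (\<epsilon> + 1)) y :: real)"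
        by (intro integrable_mult_right integrable_real_indicator) (auto simp: emeasure_lborel_cball_finite[unfolded infinity_ennreal_def])
      show "norm (?r y) \<le> (B * (norm (x' - x))\<^sup>2 * M) * indicator (cball x (\<epsilon> + 1)) y" for y
      proof (cases "y \<in> cball x (\<epsilon> + 1)")
        case True
        have "\<bar>mollifier \<epsilon> (x' - y) - mollifier \<epsilon> (x - y) - mollifier_grad \<epsilon> (x - y) \<bullet> (x' - x)\<bar> \<le> B * (norm (x' - x))\<^sup>2"
          using B(2)[of "x - y" "x' - x"] by simp
        then show ?thesis using True B(1) uM[of y] unfolding norm_scaleR by (auto intro!: mult_mono)
      next
        case False
        then have "\<epsilon> \<le> norm (x - y)" by (simp add: dist_norm)
        moreover have "\<epsilon> \<le> norm (x' - y)"
          using False d norm_triangle_ineq[of "x - x'" "x' - y"] by (simp add: dist_norm norm_minus_commute)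
        ultimately show ?thesis using False by (simp add: mollifier_eq_0[OF \<epsilon>] mollifier_grad_eq_0[OF \<epsilon>])
      qed
    qed
    also have "\<dots> = (B * M * ?V) * (norm (x' - x))\<^sup>2" by (simp add: ac_simps)
    finally show ?thesis .
  qed
  have "linear ?D"
    by (rule linearI)
      (simp_all add: inner_add_right scaleR_add_left integrable_mollifier_grad flip: integral_scaleR_right)
  then have bl: "bounded_linear ?D" by (rule linear_conv_bounded_linear[THEN iffD1])
  show ?thesis
  proof (rule has_derivativeI_sandwich[where e=1 and H="\<lambda>x'. (B * M * ?V) * norm (x' - x)"])
    show "norm (mollify \<epsilon> u x' - mollify \<epsilon> u x - ?D (x' - x)) / norm (x' - x) \<le> (B * M * ?V) * norm (x' - x)"
      if "x' \<noteq> x" "dist x' x < 1" for x'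
      using est[OF that(2)] that(1) by (simp add: divide_simps power2_eq_square mult.assoc)
    have "((\<lambda>x'. (B * M * ?V) * norm (x' - x)) \<longlongrightarrow> (B * M * ?V) * norm (x - x)) (at x)"
      by (intro tendsto_intros)
    then show "((\<lambda>x'. (B * M * ?V) * norm (x' - x)) \<longlongrightarrow> 0) (at x)" by simp
  qed (auto intro: bl)
qed

text \<open>The difference of the two translated kernels is supported in the union of two balls of
  radius \<epsilon>; hence the factor 2 and the volume.\<close>

lemma mollify_lipschitz:
  assumes L: "0 \<le> L" "\<And>z w::'a. \<bar>mollifier \<epsilon> z - mollifier \<epsilon> w\<bar> \<le> L * norm (z - w)"
  shows "norm (mollify \<epsilon> u x - mollify \<epsilon> u x') \<le> 2 * L * M * measure lborel (cball (0::'a) \<epsilon>) * norm (x - x')"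
proof -
  let ?r = "\<lambda>y. (mollifier \<epsilon> (x - y) - mollifier \<epsilon> (x' - y)) *\<^sub>R u y"
  let ?I = "\<lambda>y. indicator (cball x \<epsilon>) y + indicator (cball x' \<epsilon>) y :: real"
  have int: "integrable lborel (indicator (cball z \<epsilon>) :: 'a \<Rightarrow> real)" for z :: 'a
    by (intro integrable_real_indicator) (auto simp: emeasure_lborel_cball_finite[unfolded infinity_ennreal_def])
  have V: "measure lborel (cball z \<epsilon>) = measure lborel (cball (0::'a) \<epsilon>)" for z :: 'a
    using \<epsilon> by (simp add: measure_def emeasure_cball)
  have "mollify \<epsilon> u x - mollify \<epsilon> u x' = (LINT y|lborel. ?r y)"
    unfolding mollify_def scaleR_left_diff_distrib by (simp add: integrable_mollify)
  also have "norm \<dots> \<le> (LINT y|lborel. norm (?r y))" by (rule integral_norm_bound)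
  also have "\<dots> \<le> (LINT y|lborel. (L * norm (x - x') * M) * ?I y)"
  proof (rule integral_mono)
    show "integrable lborel (\<lambda>y. norm (?r y))"
      unfolding scaleR_left_diff_distrib by (intro integrable_norm Bochner_Integration.integrable_diff integrable_mollify)
    show "integrable lborel (\<lambda>y. (L * norm (x - x') * M) * ?I y)" by (intro integrable_mult_right Bochner_Integration.integrable_add int)
    show "norm (?r y) \<le> (L * norm (x - x') * M) * ?I y" for y
    proof (cases "y \<in> cball x \<epsilon> \<or> y \<in> cball x' \<epsilon>")
      case True
      have "norm (?r y) \<le> (L * norm (x - x')) * M"
        unfolding norm_scaleR real_norm_def using L(2)[of "x - y" "x' - y"] L(1) uM by (intro mult_mono) auto
      also have "\<dots> = (L * norm (x - x') * M) * 1" by simp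
      also have "\<dots> \<le> (L * norm (x - x') * M) * ?I y"
        using True L(1) bound_nonneg by (intro mult_left_mono) (auto simp: indicator_def)
      finally show ?thesis .
    next
      case False
      then show ?thesis using mollifier_eq_0[OF \<epsilon>, of "x - y"] mollifier_eq_0[OF \<epsilon>, of "x' - y"]
        by (simp add: dist_norm)
    qed
  qed
  also have "\<dots> = (L * norm (x - x') * M) * (measure lborel (cball x \<epsilon>) + measure lborel (cball x' \<epsilon>))"
    by (subst integral_mult_right_zero, subst Bochner_Integration.integral_add) (auto simp: int)
  also have "\<dots> = 2 * L * M * measure lborel (cball (0::'a) \<epsilon>) * norm (x - x')"
    unfolding V[of x] V[of x'] by simp
  finally show ?thesis .
qed

end

section \<open>Osgood moduli\<close>

text \<open>
  \<open>potential \<delta>\<close> is the primitive of $1 / (\rho + \delta)$, regularised by \<open>\<delta>\<close> so that it is finite. The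
  absolute values only extend \<open>\<rho>\<close> continuously to negative arguments.
\<close>

locale osgood =
  fixes \<rho> :: "real \<Rightarrow> real"
  assumes modulus: "osgood_modulus \<rho>"
begin

definition slope :: "real \<Rightarrow> real \<Rightarrow> real" where
  "slope \<delta> r = 1 / (\<rho> \<bar>r\<bar> + \<delta>)"

definition potential :: "real \<Rightarrow> real \<Rightarrow> real" where
  "potential \<delta> r = integral {0..r} (slope \<delta>)"

lemma rho_0 [simp]: "\<rho> 0 = 0"
  using modulus by (simp add: osgood_modulus_def)

lemma rho_strict_mono: "0 \<le> r \<Longrightarrow> r < s \<Longrightarrow> \<rho> r < \<rho> s"
  using modulus strict_mono_onD[of "{0..}" \<rho> r s] by (simp add: osgood_modulus_def)

lemma rho_mono: "0 \<le> r \<Longrightarrow> r \<le> s \<Longrightarrow> \<rho> r \<le> \<rho> s"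
  using rho_strict_mono[of r s] by (cases "r = s") auto

lemma rho_nonneg: "0 \<le> r \<Longrightarrow> 0 \<le> \<rho> r"
  using rho_mono[of 0 r] by simp

lemma rho_pos: "0 < r \<Longrightarrow> 0 < \<rho> r"
  using rho_strict_mono[of 0 r] by simp

lemma continuous_rho_abs: "continuous_on S (\<lambda>r. \<rho> \<bar>r\<bar>)"
proof -
  have "continuous_on {0..} \<rho>" using modulus by (simp add: osgood_modulus_def)
  then show ?thesis by (rule continuous_on_compose2) (auto intro: continuous_intros)
qed

lemma rho_tendsto_0: "((\<lambda>r. \<rho> \<bar>r\<bar>) \<longlongrightarrow> 0) (at 0)"
proof -
  have "((\<lambda>r. \<rho> \<bar>r\<bar>) \<longlongrightarrow> \<rho> \<bar>0\<bar>) (at 0)"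
    using continuous_rho_abs[of UNIV] unfolding continuous_on_def by blast
  then show ?thesis by simp
qed

lemma rho_abs_measurable[measurable]: "(\<lambda>r. \<rho> \<bar>r\<bar>) \<in> borel_measurable borel"
  by (intro borel_measurable_continuous_onI continuous_rho_abs)

lemma rho_norm_measurable[measurable (raw)]:
  "f \<in> borel_measurable M \<Longrightarrow> (\<lambda>x. \<rho> (norm (f x))) \<in> borel_measurable M"
  using measurable_compose[OF _ rho_abs_measurable, of "\<lambda>x. norm (f x)" M] by simp

lemma slope_pos: "0 < \<delta> \<Longrightarrow> 0 < slope \<delta> r"
  using rho_nonneg[of "\<bar>r\<bar>"] by (simp add: slope_def)

lemma slope_nonneg: "0 < \<delta> \<Longrightarrow> 0 \<le> slope \<delta> r"
  using slope_pos less_imp_le by blast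

lemma slope_antimono: assumes "0 < \<delta>" "0 \<le> r" "r \<le> s" shows "slope \<delta> s \<le> slope \<delta> r"
proof -
  have "0 < \<rho> r + \<delta>" "\<rho> r + \<delta> \<le> \<rho> s + \<delta>" using rho_mono[of r s] rho_nonneg[of r] assms by auto
  then show ?thesis using assms by (simp add: slope_def divide_left_mono)
qed

lemma slope_le: assumes "0 < \<delta>" shows "slope \<delta> r \<le> 1 / \<delta>"
  using slope_antimono[OF assms, of 0 "\<bar>r\<bar>"] by (simp add: slope_def)

text \<open>The cancellation behind the choice of the potential: the weight absorbs the modulus in
  (H), leaving a bound by \<open>g\<close> alone that does not depend on \<delta>.\<close>

lemma rho_mult_slope_le: assumes "0 < \<delta>" "0 \<le> r" shows "\<rho> r * slope \<delta> r \<le> 1"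
  using rho_nonneg[of r] assms by (simp add: slope_def divide_le_eq)

lemma continuous_slope: assumes "0 < \<delta>" shows "continuous_on S (slope \<delta>)"
proof -
  have "\<rho> \<bar>r\<bar> + \<delta> \<noteq> 0" for r using rho_nonneg[of "\<bar>r\<bar>"] assms by simp
  then show ?thesis unfolding slope_def by (intro continuous_intros continuous_rho_abs) auto
qed

lemma slope_measurable: "0 < \<delta> \<Longrightarrow> slope \<delta> \<in> borel_measurable borel"
  by (intro borel_measurable_continuous_onI continuous_slope)

lemma slope_integrable: "0 < \<delta> \<Longrightarrow> slope \<delta> integrable_on {a..b}"
  by (intro integrable_continuous_real continuous_slope)

lemma potential_0 [simp]: "potential \<delta> 0 = 0"
  by (simp add: potential_def)

lemma potential_diff:
  assumes "0 < \<delta>" "0 \<le> r" "r \<le> s"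
  shows "potential \<delta> s = potential \<delta> r + integral {r..s} (slope \<delta>)"
  unfolding potential_def using assms
  by (subst Henstock_Kurzweil_Integration.integral_combine[of 0 r s]) (auto intro: slope_integrable)

lemma potential_mono: assumes "0 < \<delta>" "0 \<le> r" "r \<le> s" shows "potential \<delta> r \<le> potential \<delta> s"
proof -
  have "0 \<le> integral {r..s} (slope \<delta>)"
    using assms by (intro Henstock_Kurzweil_Integration.integral_nonneg slope_integrable slope_nonneg)
  then show ?thesis using potential_diff[OF assms] by simp
qed

text \<open>The tangent line bound for a concave function: the slope decreases on the half-line. The
  maximum with 0 also covers a decrease of the argument, where monotonicity suffices.\<close>

lemma potential_step:
  assumes "0 < \<delta>" "0 \<le> r" "0 \<le> s"
  shows "potential \<delta> s \<le> potential \<delta> r + slope \<delta> r * max 0 (s - r)"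
proof (cases "r \<le> s")
  case True
  have "integral {r..s} (slope \<delta>) \<le> integral {r..s} (\<lambda>_. slope \<delta> r)"
    using assms by (intro integral_le slope_integrable) (auto intro: slope_antimono)
  then show ?thesis using True potential_diff[OF assms(1,2) True] by (simp add: mult.commute)
next
  case False
  then show ?thesis using potential_mono[of \<delta> s r] assms by simp
qed

lemma potential_pos: assumes \<delta>: "0 < \<delta>" and r: "0 < r" shows "0 < potential \<delta> r"
proof -
  have "integral {0..r} (\<lambda>_. slope \<delta> r) \<le> integral {0..r} (slope \<delta>)"
    by (intro integral_le slope_integrable[OF \<delta>]) (auto intro: slope_antimono[OF \<delta>])
  then have "slope \<delta> r * r \<le> potential \<delta> r" using r by (simp add: potential_def mult.commute)
  moreover have "0 < slope \<delta> r * r" using slope_pos[OF \<delta>] r by simp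
  ultimately show ?thesis by linarith
qed

text \<open>As \<delta> runs through \<open>1 / real (Suc n)\<close>, the slopes increase to
  \<open>1 / \<rho> s\<close> for positive \<open>s\<close>, so the potentials converge by monotone
  convergence to the integral that the Osgood condition declares infinite.\<close>

lemma potential_unbounded:
  assumes "0 < \<eta>" shows "\<exists>\<delta>>0. C \<le> potential \<delta> \<eta>"
proof -
  define f where "f n s = ennreal (slope (1 / real (Suc n)) s) * indicator {0<..\<eta>} s" for n s
  have fm[measurable]: "f n \<in> borel_measurable lborel" for n
    unfolding f_def using slope_measurable[of "1 / real (Suc n)"] by simp
  have inc: "incseq f"
  proof (intro incseq_SucI le_funI)
    fix n s
    have "slope (1 / real (Suc n)) s \<le> slope (1 / real (Suc (Suc n))) s"
    proof -
      have "0 < \<rho> \<bar>s\<bar> + 1 / real (Suc (Suc n))" using rho_nonneg[of "\<bar>s\<bar>"] by (intro add_nonneg_pos) auto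
      moreover have "\<rho> \<bar>s\<bar> + 1 / real (Suc (Suc n)) \<le> \<rho> \<bar>s\<bar> + 1 / real (Suc n)"
        by (intro add_left_mono divide_left_mono) auto
      ultimately show ?thesis unfolding slope_def by (intro divide_left_mono) auto
    qed
    then show "f n s \<le> f (Suc n) s" unfolding f_def by (intro mult_right_mono ennreal_leI) auto
  qed
  have lim: "(SUP n. f n s) = ennreal (1 / \<rho> s) * indicator {0<..\<eta>} s" for s
  proof (cases "s \<in> {0<..\<eta>}")
    case True
    then have \<rho>: "0 < \<rho> s" by (simp add: rho_pos)
    have "(\<lambda>n. slope (1 / real (Suc n)) s) \<longlonglongrightarrow> 1 / (\<rho> s + 0)"
      unfolding slope_def using True \<rho> by (intro tendsto_intros LIMSEQ_Suc[OF lim_1_over_n]) auto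
    then have "(\<lambda>n. f n s) \<longlonglongrightarrow> ennreal (1 / \<rho> s)"
      unfolding f_def using True by (auto intro!: tendsto_ennrealI)
    moreover have "(\<lambda>n. f n s) \<longlonglongrightarrow> (SUP n. f n s)"
      using inc by (intro LIMSEQ_SUP) (auto simp: incseq_def le_fun_def)
    ultimately show ?thesis using True LIMSEQ_unique by auto
  qed (auto simp: f_def)
  have "(SUP n. \<integral>\<^sup>+ s. f n s \<partial>lborel) = (\<integral>\<^sup>+ s. (SUP n. f n s) \<partial>lborel)"
    by (intro nn_integral_monotone_convergence_SUP[symmetric] inc fm)
  also have "\<dots> = \<infinity>"
    unfolding lim using modulus assms by (simp add: osgood_modulus_def nn_integral_completion)
  finally have sup: "(SUP n. \<integral>\<^sup>+ s. f n s \<partial>lborel) = \<infinity>" .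
  have "ennreal C < (SUP n. \<integral>\<^sup>+ s. f n s \<partial>lborel)" unfolding sup by simp
  then obtain n where n: "ennreal C < (\<integral>\<^sup>+ s. f n s \<partial>lborel)" by (auto simp: less_SUP_iff)
  let ?d = "1 / real (Suc n)"
  have "(\<integral>\<^sup>+ s. f n s \<partial>lborel) \<le> (\<integral>\<^sup>+ s. ennreal (slope ?d s) * indicator {0..\<eta>} s \<partial>lborel)"
    unfolding f_def by (intro nn_integral_mono) (auto simp: indicator_def)
  also have "\<dots> = ennreal (potential ?d \<eta>)"
    unfolding potential_def
    by (intro nn_integral_has_integral_lebesgue' integrable_integral slope_integrable slope_nonneg) auto
  finally have "ennreal C \<le> ennreal (potential ?d \<eta>)" using n by simp
  moreover have "0 \<le> potential ?d \<eta>" using potential_mono[of ?d 0 \<eta>] assms by simp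
  ultimately have "C \<le> potential ?d \<eta>" by (simp add: ennreal_le_iff)
  then show ?thesis by (intro exI[of _ ?d]) simp
qed

end

section \<open>Integrals of bounded curves over intervals\<close>

lemma set_integrable_bounded_interval:
  fixes f :: "real \<Rightarrow> 'b::euclidean_space"
  assumes "f \<in> borel_measurable borel" "\<And>s. norm (f s) \<le> K" "bounded S" "S \<in> sets borel"
  shows "set_integrable lborel S f"
  unfolding set_integrable_def
proof (rule Bochner_Integration.integrable_bound)
  show "integrable lborel (\<lambda>s. K * indicator S s :: real)"
    using assms(4) emeasure_bounded_finite[OF assms(3)] by (intro integrable_mult_right integrable_real_indicator) auto
  show "AE s in lborel. norm (indicat_real S s *\<^sub>R f s) \<le> norm (K * indicator S s :: real)"
    using order_trans[OF assms(2) abs_ge_self[of K]] by (intro AE_I2) (auto simp: indicator_def)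
  show "(\<lambda>s. indicat_real S s *\<^sub>R f s) \<in> borel_measurable lborel" using assms by simp
qed

lemma set_integral_singleton:
  fixes f :: "real \<Rightarrow> 'b::euclidean_space"
  shows "(LINT s:{a}|lborel. f s) = 0"
  unfolding set_lebesgue_integral_def
  using AE_lborel_singleton[of a] by (intro integral_eq_zero_AE) (auto elim!: eventually_mono)

text \<open>Half-open pieces are disjoint, so additivity holds with no correction at the junction;
  the same convention is used for all time steps.\<close>

lemma interval_integral_split:
  fixes f :: "real \<Rightarrow> 'b::euclidean_space"
  assumes "f \<in> borel_measurable borel" "\<And>s. norm (f s) \<le> K" "0 \<le> s" "s \<le> t"
  shows "(LINT u:{0..t}|lborel. f u) = (LINT u:{0..s}|lborel. f u) + (LINT u:{s<..t}|lborel. f u)"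
proof -
  have "{0..t} = {0..s} \<union> {s<..t}" using assms by auto
  then show ?thesis
    by (simp, intro set_integral_Un set_integrable_bounded_interval[OF assms(1,2)]) auto
qed

lemma norm_interval_integral_le:
  fixes f :: "real \<Rightarrow> 'b::euclidean_space"
  assumes "f \<in> borel_measurable borel" "\<And>s. norm (f s) \<le> K" "s \<le> t"
  shows "norm (LINT u:{s<..t}|lborel. f u) \<le> K * (t - s)"
proof -
  have "norm (LINT u:{s<..t}|lborel. f u) \<le> (LINT u:{s<..t}|lborel. norm (f u))"
    by (intro set_integral_norm_bound set_integrable_bounded_interval[OF assms(1,2)]) auto
  also have "\<dots> \<le> (LINT u:{s<..t}|lborel. K)"
    using assms by (intro set_integral_mono set_integrable_bounded_interval[where K=K] set_integrable_bounded_interval[where K="\<bar>K\<bar>"]) auto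
  also have "\<dots> = K * (t - s)" using assms by (simp add: set_lebesgue_integral_def mult.commute)
  finally show ?thesis .
qed

text \<open>The integrated form of the chain rule inequality for the potential of
  \<open>norm (z t)\<close>, obtained without differentiating \<open>z\<close>. On time intervals
  shorter than \<open>d\<close> the slope along the curve varies by less than \<kappa>, so
  \<open>potential_step\<close> with the slope frozen at the left end is correct up to \<kappa>; the
  pieces add up and \<kappa> tends to 0.\<close>

lemma (in osgood) potential_le_integral:
  fixes \<zeta> :: "real \<Rightarrow> 'a::euclidean_space"
  assumes \<delta>: "0 < \<delta>" and \<zeta>[measurable]: "\<zeta> \<in> borel_measurable borel" and K: "\<And>s. norm (\<zeta> s) \<le> K"
    and z: "\<And>t. t \<in> {0..T} \<Longrightarrow> z t = (LINT s:{0..t}|lborel. \<zeta> s)"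
    and zm[measurable]: "z \<in> borel_measurable borel" and t: "t \<in> {0..T}"
  shows "potential \<delta> (norm (z t)) \<le> (LINT s:{0..t}|lborel. norm (\<zeta> s) * slope \<delta> (norm (z s)))"
proof -
  let ?r = "\<lambda>t. norm (z t)"
  let ?h = "\<lambda>s. slope \<delta> (norm (z s))"
  note [measurable] = slope_measurable[OF \<delta>]
  have K0: "0 \<le> K" using K[of 0] norm_ge_zero order_trans by blast
  have diff: "z t = z s + (LINT u:{s<..t}|lborel. \<zeta> u)" if "0 \<le> s" "s \<le> t" "t \<le> T" for s t
    using that z[of s] z[of t] interval_integral_split[OF \<zeta> K, of s t] by simp
  have lip: "norm (z t - z s) \<le> K * \<bar>t - s\<bar>" if st: "s \<in> {0..T}" "t \<in> {0..T}" for s t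
  proof -
    have *: "norm (z t - z s) \<le> K * (t - s)" if "0 \<le> s" "s \<le> t" "t \<le> T" for s t
      using diff[OF that] norm_interval_integral_le[OF \<zeta> K that(2)] by simp
    show ?thesis using *[of s t] *[of t s] st by (cases "s \<le> t") (auto simp: norm_minus_commute)
  qed
  have "continuous_on {0..T} z"
    by (rule lipschitz_on_continuous_on[where L=K]) (auto intro!: lipschitz_onI K0 simp: dist_norm lip abs_minus_commute)
  then have "continuous_on {0..T} ?h"
    by (intro continuous_on_compose2[OF continuous_slope[OF \<delta>, of UNIV]] continuous_intros) auto
  then have uc: "uniformly_continuous_on {0..T} ?h" by (intro compact_uniformly_continuous) auto
  have h: "0 \<le> ?h s" "?h s \<le> 1 / \<delta>" for s using slope_nonneg[OF \<delta>] slope_le[OF \<delta>] by auto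
  have main: "potential \<delta> (?r t) \<le> (LINT s:{0..t}|lborel. norm (\<zeta> s) * (?h s + \<kappa>))" if \<kappa>: "0 < \<kappa>" for \<kappa>
  proof -
    obtain d where d: "0 < d" "\<And>s u. s \<in> {0..T} \<Longrightarrow> u \<in> {0..T} \<Longrightarrow> dist s u < d \<Longrightarrow> dist (?h s) (?h u) < \<kappa>"
      using uc \<kappa> unfolding uniformly_continuous_on_def by metis
    define J where "J = (\<lambda>s. norm (\<zeta> s) * (?h s + \<kappa>))"
    have Jm: "J \<in> borel_measurable borel" unfolding J_def by measurable
    have Jb: "norm (J s) \<le> K * (1 / \<delta> + \<kappa>)" for s
      unfolding J_def norm_mult using K[of s] h[of s] \<kappa> K0 by (intro mult_mono) auto
    have step: "potential \<delta> (?r t) \<le> potential \<delta> (?r s) + (LINT u:{s<..t}|lborel. J u)"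
      if st: "0 \<le> s" "s \<le> t" "t \<le> T" "t - s < d" for s t
    proof -
      have "?r t - ?r s \<le> norm (LINT u:{s<..t}|lborel. \<zeta> u)"
        using diff[OF st(1-3)] norm_triangle_ineq2[of "z t" "z s"] by simp
      also have "\<dots> \<le> (LINT u:{s<..t}|lborel. norm (\<zeta> u))"
        by (intro set_integral_norm_bound set_integrable_bounded_interval[OF \<zeta> K]) auto
      finally have r: "max 0 (?r t - ?r s) \<le> (LINT u:{s<..t}|lborel. norm (\<zeta> u))"
        by (simp add: set_lebesgue_integral_def)
      have "?h s * max 0 (?r t - ?r s) \<le> ?h s * (LINT u:{s<..t}|lborel. norm (\<zeta> u))"
        by (intro mult_left_mono r h)
      also have "\<dots> = (LINT u:{s<..t}|lborel. ?h s * norm (\<zeta> u))" by simp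
      also have "\<dots> \<le> (LINT u:{s<..t}|lborel. J u)"
      proof (intro set_integral_mono)
        show "set_integrable lborel {s<..t} (\<lambda>u. ?h s * norm (\<zeta> u))"
        proof (rule set_integrable_bounded_interval)
          show "norm (?h s * norm (\<zeta> u)) \<le> 1 / \<delta> * K" for u
            using mult_mono[OF h(2)[of s] K[of u]] h(1)[of s] \<delta> by (simp add: abs_mult)
        qed auto
        show "set_integrable lborel {s<..t} J"
          by (intro set_integrable_bounded_interval[OF Jm Jb]) auto
        show "?h s * norm (\<zeta> u) \<le> J u" if "u \<in> {s<..t}" for u
        proof -
          have "dist (?h s) (?h u) < \<kappa>" using that st by (intro d) (auto simp: dist_real_def)
          then have "?h s \<le> ?h u + \<kappa>" by (simp add: dist_real_def)
          then have "norm (\<zeta> u) * ?h s \<le> norm (\<zeta> u) * (?h u + \<kappa>)" by (intro mult_left_mono) auto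
          then show ?thesis by (simp add: J_def mult.commute)
        qed
      qed
      finally show ?thesis using potential_step[OF \<delta>, of "?r s" "?r t"] by simp
    qed
    have "t \<in> {0..T} \<Longrightarrow> t \<le> real n * (d / 2) \<Longrightarrow> potential \<delta> (?r t) \<le> (LINT u:{0..t}|lborel. J u)" for n t
    proof (induction n arbitrary: t)
      case 0
      then have "t = 0" by simp
      then show ?case using z[of 0] 0 by (simp add: set_integral_singleton)
    next
      case (Suc n)
      \<comment> \<open>The induction goes back in time by \<open>d / 2\<close>, strictly below
        \<open>d\<close>; the maximum with 0 cuts off the piece that starts at time 0.\<close>
      define s where "s = max 0 (t - d / 2)"
      have s: "0 \<le> s" "s \<le> t" "t \<le> T" "t - s < d" using Suc.prems d(1) by (auto simp: s_def)
      have "0 \<le> real n * (d / 2)" using d(1) by simp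
      moreover have "t - d / 2 \<le> real n * (d / 2)" using Suc.prems by (simp add: algebra_simps)
      ultimately have "s \<le> real n * (d / 2)" unfolding s_def by (rule max.boundedI)
      then have "potential \<delta> (?r s) \<le> (LINT u:{0..s}|lborel. J u)"
        using s by (intro Suc.IH) auto
      with step[OF s] show ?case using interval_integral_split[OF Jm Jb s(1,2)] by simp
    qed
    moreover obtain n where "t \<le> real n * (d / 2)" using real_arch_simple[of "t / (d / 2)"] d(1) by (auto simp: field_simps)
    ultimately show ?thesis using t unfolding J_def by blast
  qed
  let ?A = "LINT s:{0..t}|lborel. norm (\<zeta> s) * ?h s" and ?B = "LINT s:{0..t}|lborel. norm (\<zeta> s)"
  have i1: "set_integrable lborel {0..t} (\<lambda>s. norm (\<zeta> s) * ?h s)"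
  proof (rule set_integrable_bounded_interval)
    show "norm (norm (\<zeta> s) * ?h s) \<le> K * (1 / \<delta>)" for s
      using mult_mono[OF K[of s] h(2)[of s] K0 h(1)] h(1)[of s] by (simp add: abs_mult)
  qed auto
  have i2: "set_integrable lborel {0..t} (\<lambda>s. norm (\<zeta> s))"
    using K by (intro set_integrable_bounded_interval[where K=K]) auto
  have B: "0 \<le> ?B" by (simp add: set_lebesgue_integral_def)
  show ?thesis
  proof (rule field_le_epsilon)
    fix e :: real assume e: "0 < e"
    \<comment> \<open>The summand 1 avoids a division by 0 when the velocity vanishes almost
      everywhere.\<close>
    define \<kappa> where "\<kappa> = e / (?B + 1)"
    have "0 < \<kappa>" using e B by (simp add: \<kappa>_def)
    from main[OF this] have "potential \<delta> (?r t) \<le> ?A + \<kappa> * ?B"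
      using i1 i2 by (simp add: distrib_left mult.commute[of _ \<kappa>])
    also have "\<kappa> * ?B \<le> e" using e B by (simp add: \<kappa>_def field_simps)
    finally show "potential \<delta> (?r t) \<le> ?A + e" by simp
  qed
qed

section \<open>Stability of approximate flows\<close>

text \<open>Domination of preimages of sets is all that is known about \<open>X\<close>; it extends
  to nonnegative functions by the standard induction through simple functions and monotone
  limits.\<close>

lemma nn_integral_comp_le:
  assumes X: "X \<in> measurable M N" and le: "\<And>A. A \<in> sets N \<Longrightarrow> emeasure M (X -` A \<inter> space M) \<le> L * emeasure N A"
    and f: "f \<in> borel_measurable N"
  shows "(\<integral>\<^sup>+ x. f (X x) \<partial>M) \<le> L * (\<integral>\<^sup>+ x. f x \<partial>N)"
  using f
proof (induction rule: borel_measurable_induct)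
  case (cong f g)
  have "(\<integral>\<^sup>+ x. f (X x) \<partial>M) = (\<integral>\<^sup>+ x. g (X x) \<partial>M)"
    using cong(3) measurable_space[OF X] by (intro nn_integral_cong) auto
  moreover have "(\<integral>\<^sup>+ x. f x \<partial>N) = (\<integral>\<^sup>+ x. g x \<partial>N)" using cong(3) by (intro nn_integral_cong) auto
  ultimately show ?case using cong by simp
next
  case (set A)
  have "(\<integral>\<^sup>+ x. indicator A (X x) \<partial>M) = (\<integral>\<^sup>+ x. indicator (X -` A \<inter> space M) x \<partial>M)"
    by (intro nn_integral_cong) (auto simp: indicator_def)
  then show ?case using le[OF set] measurable_sets[OF X set] set by simp
next
  case (mult u c)
  have "(\<lambda>x. u (X x)) \<in> borel_measurable M" using mult X by measurable
  moreover have "c * (\<integral>\<^sup>+ x. u (X x) \<partial>M) \<le> c * (L * integral\<^sup>N N u)" using mult by (intro mult_left_mono) auto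
  ultimately show ?case using mult by (simp add: nn_integral_cmult mult.left_commute)
next
  case (add u v)
  have "(\<lambda>x. u (X x)) \<in> borel_measurable M" "(\<lambda>x. v (X x)) \<in> borel_measurable M" using add X by measurable
  then show ?case using add by (simp add: nn_integral_add distrib_left add_mono)
next
  case (seq U)
  have m: "(\<lambda>x. U i (X x)) \<in> borel_measurable M" for i using seq(1)[of i] X by measurable
  have "(\<integral>\<^sup>+ x. (SUP i. U i (X x)) \<partial>M) = (SUP i. \<integral>\<^sup>+ x. U i (X x) \<partial>M)"
    using seq(3) m by (intro nn_integral_monotone_convergence_SUP) (auto simp: incseq_def le_fun_def)
  also have "\<dots> \<le> (SUP i. L * (\<integral>\<^sup>+ x. U i x \<partial>N))" using seq.IH by (intro SUP_mono bexI) auto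
  also have "\<dots> = L * (\<integral>\<^sup>+ x. (SUP i. U i x) \<partial>N)"
    using seq by (subst nn_integral_monotone_convergence_SUP) (auto simp: SUP_mult_left_ennreal)
  finally show ?case by (simp add: image_comp)
qed

lemma ennreal_affine:
  assumes "0 \<le> c" "0 \<le> p" "0 \<le> q" "0 \<le> r" "0 \<le> s"
  shows "ennreal (c * (p + q) + (r + s)) = ennreal c * (ennreal p + ennreal q) + (ennreal r + ennreal s)"
  using assms by (simp add: ennreal_mult)

lemma cball_in_borel[measurable]: "cball (a::'a::metric_space) r \<in> sets borel"
  by simp

text \<open>The null sets of (H) are given time by time, whereas the estimates run along single
  trajectories. This lemma exchanges the two quantifiers, at the price of joint measurability of the
  property.\<close>

lemma AE_lborel_commute:
  assumes "Measurable.pred (borel \<Otimes>\<^sub>M borel) (\<lambda>(s, x). P s x)"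
  shows "(AE s in (lborel :: 'a::euclidean_space measure). AE x in (lborel :: 'b::euclidean_space measure). P s x)
    \<longleftrightarrow> (AE x in lborel. AE s in lborel. P s x)"
proof (rule lborel_pair.AE_commute)
  show "{x \<in> space (lborel \<Otimes>\<^sub>M lborel). P (fst x) (snd x)} \<in> sets (lborel \<Otimes>\<^sub>M lborel)"
    using assms by (auto simp: pred_def case_prod_beta space_pair_measure cong: sets_pair_measure_cong)
qed

text \<open>The data are Borel on the whole of space-time and vanish outside the time interval, so
  that time integrals run over the full line and Tonelli applies without restricted measures. These
  are the properties that Borel representatives of the given field and of \<open>g\<close> are shown
  to have.\<close>

locale osgood_field = osgood \<rho> for \<rho> +
  fixes T M :: real and b :: "real \<Rightarrow> 'a::euclidean_space \<Rightarrow> 'a" and g :: "real \<Rightarrow> 'a \<Rightarrow> real"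
  assumes T_pos: "0 < T"
    and b_measurable[measurable]: "case_prod b \<in> borel_measurable (borel \<Otimes>\<^sub>M borel)"
    and b_bound: "\<And>t x. norm (b t x) \<le> M" and b_outside: "\<And>t x. t \<notin> {0..T} \<Longrightarrow> b t x = 0"
    and g_measurable[measurable]: "case_prod g \<in> borel_measurable (borel \<Otimes>\<^sub>M borel)"
    and g_nonneg: "\<And>t x. 0 \<le> g t x" and g_outside: "\<And>t x. t \<notin> {0..T} \<Longrightarrow> g t x = 0"
    and g_finite: "\<And>R. (\<integral>\<^sup>+ t. (\<integral>\<^sup>+ x\<in>cball 0 R. ennreal (g t x) \<partial>lborel) \<partial>lborel) < \<infinity>"
    and H: "AE t in lborel. \<exists>N\<in>null_sets lborel. \<forall>x y. x \<notin> N \<longrightarrow> y \<notin> N \<longrightarrow>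
              norm (b t x - b t y) \<le> (g t x + g t y) * \<rho> (norm (x - y))"
begin

definition mass :: "real \<Rightarrow> ennreal" where
  "mass R = (\<integral>\<^sup>+ t. (\<integral>\<^sup>+ x\<in>cball 0 R. ennreal (g t x) \<partial>lborel) \<partial>lborel)"

text \<open>
  A transport moves along an arbitrary bounded velocity \<open>\<beta>\<close>; its defect measures the distance of
  \<open>\<beta>\<close> from \<open>b\<close> along the curves. Regular Lagrangian flows are the transports without defect.
\<close>

definition transport :: "real \<Rightarrow> (real \<Rightarrow> 'a \<Rightarrow> 'a) \<Rightarrow> (real \<Rightarrow> 'a \<Rightarrow> 'a) \<Rightarrow> bool" where
  "transport L X \<beta> \<longleftrightarrow> 0 < L \<and>
     case_prod X \<in> borel_measurable (borel \<Otimes>\<^sub>M borel) \<and> case_prod \<beta> \<in> borel_measurable (borel \<Otimes>\<^sub>M borel) \<and>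
     (\<forall>s x. norm (\<beta> s x) \<le> M) \<and> (\<forall>s x. s \<notin> {0..T} \<longrightarrow> \<beta> s x = 0) \<and>
     (AE x in lborel. \<forall>t\<in>{0..T}. X t x = x + (LINT s:{0..t}|lborel. \<beta> s x)) \<and>
     (\<forall>t\<in>{0..T}. \<forall>A\<in>sets borel. emeasure lborel (X t -` A) \<le> ennreal L * emeasure lborel A)"

definition defect :: "real \<Rightarrow> (real \<Rightarrow> 'a \<Rightarrow> 'a) \<Rightarrow> (real \<Rightarrow> 'a \<Rightarrow> 'a) \<Rightarrow> ennreal" where
  "defect R X \<beta> = (\<integral>\<^sup>+ x\<in>cball 0 R. (\<integral>\<^sup>+ s. ennreal (norm (\<beta> s x - b s (X s x))) \<partial>lborel) \<partial>lborel)"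

lemma M_nonneg: "0 \<le> M"
  using b_bound[of 0 0] norm_ge_zero order_trans by blast

lemma mass_finite: "mass R < \<infinity>"
  using g_finite by (simp add: mass_def)

lemma transportD:
  assumes "transport L X \<beta>"
  shows "0 < L" "case_prod X \<in> borel_measurable (borel \<Otimes>\<^sub>M borel)" "case_prod \<beta> \<in> borel_measurable (borel \<Otimes>\<^sub>M borel)"
    "norm (\<beta> s x) \<le> M" "s \<notin> {0..T} \<Longrightarrow> \<beta> s x = 0"
    "AE x in lborel. \<forall>t\<in>{0..T}. X t x = x + (LINT s:{0..t}|lborel. \<beta> s x)"
    "t \<in> {0..T} \<Longrightarrow> A \<in> sets borel \<Longrightarrow> emeasure lborel (X t -` A) \<le> ennreal L * emeasure lborel A"
  using assms unfolding transport_def by auto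

lemma transport_slice:
  assumes "transport L X \<beta>"
  shows "X t \<in> borel_measurable borel" "(\<lambda>s. X s x) \<in> borel_measurable borel" "(\<lambda>s. \<beta> s x) \<in> borel_measurable borel"
proof -
  note [measurable] = transportD(2,3)[OF assms]
  show "X t \<in> borel_measurable borel" "(\<lambda>s. X s x) \<in> borel_measurable borel" "(\<lambda>s. \<beta> s x) \<in> borel_measurable borel"
    by measurable
qed

lemma norm_integral_le:
  assumes "\<zeta> \<in> borel_measurable borel" "\<And>s. norm (\<zeta> s) \<le> M" "0 \<le> s" "s \<le> t"
  shows "norm ((LINT u:{0..t}|lborel. \<zeta> u) - (LINT u:{0..s}|lborel. \<zeta> u :: 'a)) \<le> M * (t - s)"
  using interval_integral_split[OF assms] norm_interval_integral_le[OF assms(1,2,4)] by simp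

lemma transport_displacement:
  assumes "transport L X \<beta>" shows "AE x in lborel. \<forall>t\<in>{0..T}. norm (X t x) \<le> norm x + M * T"
  using transportD(6)[OF assms]
proof eventually_elim
  case (elim x)
  show ?case
  proof
    fix t assume t: "t \<in> {0..T}"
    have "norm (LINT s:{0..t}|lborel. \<beta> s x) \<le> M * t"
      using norm_integral_le[OF transport_slice(3)[OF assms] transportD(4)[OF assms], of 0 t x] t
      by (simp add: set_integral_singleton)
    also have "\<dots> \<le> M * T" using t M_nonneg by (intro mult_left_mono) auto
    finally show "norm (X t x) \<le> norm x + M * T"
      using elim t norm_triangle_ineq[of x "LINT s:{0..t}|lborel. \<beta> s x"] by auto
  qed
qed

text \<open>The part of \<open>transport\<close> that does not refer to a velocity. A limit of
  transports has these properties before it is known to solve the equation, and they already suffice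
  for using (H) along it.\<close>

definition spread :: "real \<Rightarrow> (real \<Rightarrow> 'a \<Rightarrow> 'a) \<Rightarrow> bool" where
  "spread L X \<longleftrightarrow> 0 < L \<and> case_prod X \<in> borel_measurable (borel \<Otimes>\<^sub>M borel) \<and>
     (AE x in lborel. \<forall>t\<in>{0..T}. norm (X t x) \<le> norm x + M * T) \<and>
     (\<forall>t\<in>{0..T}. \<forall>A\<in>sets borel. emeasure lborel (X t -` A) \<le> ennreal L * emeasure lborel A)"

lemma spreadD:
  assumes "spread L X"
  shows "0 < L" "case_prod X \<in> borel_measurable (borel \<Otimes>\<^sub>M borel)"
    "AE x in lborel. \<forall>t\<in>{0..T}. norm (X t x) \<le> norm x + M * T"
    "t \<in> {0..T} \<Longrightarrow> A \<in> sets borel \<Longrightarrow> emeasure lborel (X t -` A) \<le> ennreal L * emeasure lborel A"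
  using assms unfolding spread_def by auto

lemma transport_spread: "transport L X \<beta> \<Longrightarrow> spread L X"
  using transport_displacement[of L X \<beta>] unfolding spread_def transport_def by blast

lemma spread_slice:
  assumes "spread L X" shows "X t \<in> borel_measurable borel"
proof -
  note [measurable] = spreadD(2)[OF assms]
  show ?thesis by measurable
qed

lemma spread_nn_integral:
  assumes X: "spread L X" and t: "t \<in> {0..T}" and f: "f \<in> borel_measurable borel"
  shows "(\<integral>\<^sup>+ x. f (X t x) \<partial>lborel) \<le> ennreal L * (\<integral>\<^sup>+ x. f x \<partial>lborel)"
  using nn_integral_comp_le[of "X t" lborel lborel "ennreal L" f] spread_slice[OF X] spreadD(4)[OF X t] f by simp

text \<open>Finite speed: curves that start in the ball of radius \<open>R\<close> stay in the ball
  of radius \<open>R + M * T\<close>. Hence only the local integrability of \<open>g\<close>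
  matters.\<close>

lemma spread_nn_integral_cball:
  assumes X: "spread L X" and t: "t \<in> {0..T}" and f[measurable]: "f \<in> borel_measurable borel"
  shows "(\<integral>\<^sup>+ x\<in>cball 0 R. f (X t x) \<partial>lborel) \<le> ennreal L * (\<integral>\<^sup>+ x\<in>cball 0 (R + M * T). f x \<partial>lborel)"
proof -
  have "(\<integral>\<^sup>+ x\<in>cball 0 R. f (X t x) \<partial>lborel) \<le> (\<integral>\<^sup>+ x. (f (X t x) * indicator (cball 0 (R + M * T)) (X t x)) \<partial>lborel)"
  proof (rule nn_integral_mono_AE)
    show "AE x in lborel. f (X t x) * indicator (cball 0 R) x \<le> f (X t x) * indicator (cball 0 (R + M * T)) (X t x)"
      using spreadD(3)[OF X]
    proof eventually_elim
      case (elim x)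
      then have "norm (X t x) \<le> norm x + M * T" using t by blast
      then have "x \<in> cball 0 R \<Longrightarrow> X t x \<in> cball 0 (R + M * T)" by (simp add: order_trans[OF _ add_right_mono])
      then show ?case by (auto simp: indicator_def)
    qed
  qed
  also have "\<dots> \<le> ennreal L * (\<integral>\<^sup>+ x\<in>cball 0 (R + M * T). f x \<partial>lborel)"
    by (rule spread_nn_integral[OF X t]) measurable
  finally show ?thesis .
qed

lemma spread_AE:
  assumes X: "spread L X" and t: "t \<in> {0..T}" and N: "N \<in> null_sets lborel"
  shows "AE x in lborel. X t x \<notin> N"
proof -
  have "emeasure lborel (X t -` N) \<le> ennreal L * emeasure lborel N" using spreadD(4)[OF X t] N by auto
  then have "emeasure lborel (X t -` N) = 0" using N by (auto simp: null_sets_def)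
  moreover have "X t -` N \<in> sets lborel" using measurable_sets[OF spread_slice[OF X], of N] N by (auto simp: null_sets_def)
  ultimately have "X t -` N \<in> null_sets lborel" by (auto simp: null_sets_def)
  from AE_not_in[OF this] show ?thesis by simp
qed

lemma spread_space_time:
  assumes X: "spread L X" and f[measurable]: "case_prod f \<in> borel_measurable (borel \<Otimes>\<^sub>M borel)"
    and out: "\<And>s x. s \<notin> {0..T} \<Longrightarrow> f s x = 0"
  shows "(\<integral>\<^sup>+ x\<in>cball 0 R. (\<integral>\<^sup>+ s. f s (X s x) \<partial>lborel) \<partial>lborel)
    \<le> ennreal L * (\<integral>\<^sup>+ s. (\<integral>\<^sup>+ x\<in>cball 0 (R + M * T). f s x \<partial>lborel) \<partial>lborel)"
proof -
  note [measurable] = spreadD(2)[OF X]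
  have "(\<integral>\<^sup>+ x\<in>cball 0 R. (\<integral>\<^sup>+ s. f s (X s x) \<partial>lborel) \<partial>lborel)
      = (\<integral>\<^sup>+ x. (\<integral>\<^sup>+ s. f s (X s x) * indicator (cball 0 R) x \<partial>lborel) \<partial>lborel)"
    by (intro nn_integral_cong nn_integral_multc[symmetric]) measurable
  also have "\<dots> = (\<integral>\<^sup>+ s. (\<integral>\<^sup>+ x. f s (X s x) * indicator (cball 0 R) x \<partial>lborel) \<partial>lborel)"
    by (rule lborel_pair.Fubini') measurable
  also have "\<dots> \<le> (\<integral>\<^sup>+ s. ennreal L * (\<integral>\<^sup>+ x\<in>cball 0 (R + M * T). f s x \<partial>lborel) \<partial>lborel)"
  proof (rule nn_integral_mono)
    fix s
    show "(\<integral>\<^sup>+ x\<in>cball 0 R. f s (X s x) \<partial>lborel) \<le> ennreal L * (\<integral>\<^sup>+ x\<in>cball 0 (R + M * T). f s x \<partial>lborel)"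
      using out by (cases "s \<in> {0..T}") (auto intro!: spread_nn_integral_cball[OF X])
  qed
  also have "\<dots> = ennreal L * (\<integral>\<^sup>+ s. (\<integral>\<^sup>+ x\<in>cball 0 (R + M * T). f s x \<partial>lborel) \<partial>lborel)"
    by (rule nn_integral_cmult) measurable
  finally show ?thesis .
qed

lemma spread_mass:
  assumes X: "spread L X"
  shows "(\<integral>\<^sup>+ x\<in>cball 0 R. (\<integral>\<^sup>+ s. ennreal (g s (X s x)) \<partial>lborel) \<partial>lborel) \<le> ennreal L * mass (R + M * T)"
  unfolding mass_def by (rule spread_space_time[OF X]) (measurable, simp add: g_outside)

text \<open>At a fixed good time the exceptional set of (H) is null, so its preimages under both
  maps are null; then the order of the quantifiers is exchanged.\<close>

lemma spread_H:
  assumes X: "spread L X" and Y: "spread L Y"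
  shows "AE x in lborel. AE s in lborel.
    norm (b s (X s x) - b s (Y s x)) \<le> (g s (X s x) + g s (Y s x)) * \<rho> (norm (X s x - Y s x))"
proof -
  note [measurable] = spreadD(2)[OF X] spreadD(2)[OF Y]
  have "AE s in lborel. AE x in lborel.
      norm (b s (X s x) - b s (Y s x)) \<le> (g s (X s x) + g s (Y s x)) * \<rho> (norm (X s x - Y s x))"
    using H
  proof eventually_elim
    case (elim s)
    show ?case
    proof (cases "s \<in> {0..T}")
      case True
      obtain N where N: "N \<in> null_sets lborel" "\<And>x y. x \<notin> N \<Longrightarrow> y \<notin> N \<Longrightarrow>
          norm (b s x - b s y) \<le> (g s x + g s y) * \<rho> (norm (x - y))" using elim by blast
      show ?thesis using spread_AE[OF X True N(1)] spread_AE[OF Y True N(1)]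
        by eventually_elim (rule N(2))
    qed (simp add: b_outside g_outside)
  qed
  moreover have "Measurable.pred (borel \<Otimes>\<^sub>M borel) (\<lambda>(s, x).
      norm (b s (X s x) - b s (Y s x)) \<le> (g s (X s x) + g s (Y s x)) * \<rho> (norm (X s x - Y s x)))"
    by measurable
  ultimately show ?thesis by (rule AE_lborel_commute[THEN iffD1, rotated])
qed


text \<open>The majorant \<open>Z\<close> does not depend on \<open>t\<close>, because the integrand
  is nonnegative and the integral is taken over all times. Its size thus controls a whole trajectory
  at once, and no supremum over times has to be shown measurable. Each of the two flows contributes
  one term with \<open>mass\<close>.\<close>

lemma transport_stability:
  assumes X: "transport L X \<beta>" and Y: "transport L Y \<gamma>" and \<delta>: "0 < \<delta>"
  defines "Z \<equiv> \<lambda>x. \<integral>\<^sup>+ s. ennreal (norm (\<beta> s x - \<gamma> s x) * slope \<delta> (norm (X s x - Y s x))) \<partial>lborel"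
  shows "Z \<in> borel_measurable borel"
    and "AE x in lborel. \<forall>t\<in>{0..T}. ennreal (potential \<delta> (norm (X t x - Y t x))) \<le> Z x"
    and "(\<integral>\<^sup>+ x\<in>cball 0 R. Z x \<partial>lborel)
      \<le> ennreal (1 / \<delta>) * (defect R X \<beta> + defect R Y \<gamma>) + 2 * (ennreal L * mass (R + M * T))"
proof -
  note [measurable] = transportD(2,3)[OF X] transportD(2,3)[OF Y] slope_measurable[OF \<delta>]
  note slices = transport_slice[OF X] transport_slice[OF Y]
  show [measurable]: "Z \<in> borel_measurable borel" unfolding Z_def by measurable
  show "AE x in lborel. \<forall>t\<in>{0..T}. ennreal (potential \<delta> (norm (X t x - Y t x))) \<le> Z x"
    using transportD(6)[OF X] transportD(6)[OF Y]
  proof eventually_elim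
    case (elim x)
    let ?\<zeta> = "\<lambda>s. \<beta> s x - \<gamma> s x" and ?z = "\<lambda>s. X s x - Y s x"
    have \<zeta>: "?\<zeta> \<in> borel_measurable borel" and zm: "?z \<in> borel_measurable borel" by measurable
    have K: "norm (?\<zeta> s) \<le> 2 * M" for s
      using norm_triangle_ineq4[of "\<beta> s x" "\<gamma> s x"] transportD(4)[OF X, of s x] transportD(4)[OF Y, of s x] by simp
    have z: "?z t = (LINT s:{0..t}|lborel. ?\<zeta> s)" if "t \<in> {0..T}" for t
      using elim that set_integrable_bounded_interval[OF slices(3)[of x] transportD(4)[OF X], of "{0..t}"]
        set_integrable_bounded_interval[OF slices(6)[of x] transportD(4)[OF Y], of "{0..t}"]
      by simp
    show ?case
    proof
      fix t assume t: "t \<in> {0..T}"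
      have h: "norm (norm (?\<zeta> s) * slope \<delta> (norm (?z s))) \<le> 2 * M * (1 / \<delta>)" for s
        using mult_mono[OF K[of s] slope_le[OF \<delta>, of "norm (?z s)"]] M_nonneg slope_nonneg[OF \<delta>, of "norm (?z s)"]
        by (simp add: abs_mult)
      have int: "set_integrable lborel {0..t} (\<lambda>s. norm (?\<zeta> s) * slope \<delta> (norm (?z s)))"
        by (rule set_integrable_bounded_interval[OF _ h]) auto
      have "ennreal (potential \<delta> (norm (?z t))) \<le> ennreal (LINT s:{0..t}|lborel. norm (?\<zeta> s) * slope \<delta> (norm (?z s)))"
        by (intro ennreal_leI potential_le_integral[OF \<delta> \<zeta> K z zm t])
      also have "\<dots> = (\<integral>\<^sup>+ s. ennreal (indicator {0..t} s *\<^sub>R (norm (?\<zeta> s) * slope \<delta> (norm (?z s)))) \<partial>lborel)"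
        unfolding set_lebesgue_integral_def using int slope_nonneg[OF \<delta>]
        by (intro nn_integral_eq_integral[symmetric]) (auto simp: set_integrable_def)
      also have "\<dots> \<le> Z x" unfolding Z_def
        using slope_nonneg[OF \<delta>] by (intro nn_integral_mono ennreal_leI) (auto simp: indicator_def)
      finally show "ennreal (potential \<delta> (norm (X t x - Y t x))) \<le> Z x" .
    qed
  qed
  let ?e = "\<lambda>s x. ennreal (norm (\<beta> s x - b s (X s x)))" and ?f = "\<lambda>s x. ennreal (norm (\<gamma> s x - b s (Y s x)))"
  have "AE x in lborel. Z x \<le> ennreal (1 / \<delta>) * ((\<integral>\<^sup>+ s. ?e s x \<partial>lborel) + (\<integral>\<^sup>+ s. ?f s x \<partial>lborel))
      + ((\<integral>\<^sup>+ s. ennreal (g s (X s x)) \<partial>lborel) + (\<integral>\<^sup>+ s. ennreal (g s (Y s x)) \<partial>lborel))"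
    using spread_H[OF transport_spread[OF X] transport_spread[OF Y]]
  proof eventually_elim
    case (elim x)
    have "Z x \<le> (\<integral>\<^sup>+ s. ennreal (1 / \<delta>) * (?e s x + ?f s x) + (ennreal (g s (X s x)) + ennreal (g s (Y s x))) \<partial>lborel)"
      unfolding Z_def
    proof (rule nn_integral_mono_AE, use elim in eventually_elim)
      case (elim s)
      let ?q = "slope \<delta> (norm (X s x - Y s x))"
      have q: "0 \<le> ?q" "?q \<le> 1 / \<delta>" using slope_nonneg[OF \<delta>] slope_le[OF \<delta>] by auto
      have "norm (\<beta> s x - \<gamma> s x) \<le> (norm (\<beta> s x - b s (X s x)) + norm (\<gamma> s x - b s (Y s x))) + norm (b s (X s x) - b s (Y s x))"
        using norm_triangle_ineq[of "\<beta> s x - b s (X s x)" "b s (X s x) - b s (Y s x)"]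
          norm_triangle_ineq[of "\<beta> s x - b s (Y s x)" "b s (Y s x) - \<gamma> s x"]
        by (simp add: norm_minus_commute)
      also have "\<dots> \<le> (norm (\<beta> s x - b s (X s x)) + norm (\<gamma> s x - b s (Y s x))) + (g s (X s x) + g s (Y s x)) * \<rho> (norm (X s x - Y s x))"
        using elim by simp
      finally have "norm (\<beta> s x - \<gamma> s x) * ?q \<le> ((norm (\<beta> s x - b s (X s x)) + norm (\<gamma> s x - b s (Y s x)))
          + (g s (X s x) + g s (Y s x)) * \<rho> (norm (X s x - Y s x))) * ?q"
        using q by (intro mult_right_mono)
      also have "\<dots> = (norm (\<beta> s x - b s (X s x)) + norm (\<gamma> s x - b s (Y s x))) * ?q
          + (g s (X s x) + g s (Y s x)) * (\<rho> (norm (X s x - Y s x)) * ?q)" by (simp add: algebra_simps)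
      \<comment> \<open>The defects see only the crude bound \<open>1 / \<delta>\<close> for the
        slope, while the (H) term uses the cancellation of modulus and slope.\<close>
      also have "\<dots> \<le> (norm (\<beta> s x - b s (X s x)) + norm (\<gamma> s x - b s (Y s x))) * (1 / \<delta>) + (g s (X s x) + g s (Y s x)) * 1"
        using q g_nonneg rho_mult_slope_le[OF \<delta>] by (intro add_mono mult_left_mono) auto
      finally have "ennreal (norm (\<beta> s x - \<gamma> s x) * ?q)
          \<le> ennreal ((1 / \<delta>) * (norm (\<beta> s x - b s (X s x)) + norm (\<gamma> s x - b s (Y s x))) + (g s (X s x) + g s (Y s x)))"
        by (intro ennreal_leI) (simp add: mult.commute)
      also have "\<dots> = ennreal (1 / \<delta>) * (?e s x + ?f s x) + (ennreal (g s (X s x)) + ennreal (g s (Y s x)))"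
        using \<delta> g_nonneg by (intro ennreal_affine) auto
      finally show ?case .
    qed
    also have "\<dots> = ennreal (1 / \<delta>) * ((\<integral>\<^sup>+ s. ?e s x \<partial>lborel) + (\<integral>\<^sup>+ s. ?f s x \<partial>lborel))
      + ((\<integral>\<^sup>+ s. ennreal (g s (X s x)) \<partial>lborel) + (\<integral>\<^sup>+ s. ennreal (g s (Y s x)) \<partial>lborel))"
      by (subst nn_integral_add nn_integral_cmult, measurable)+
    finally show ?case .
  qed
  then have "(\<integral>\<^sup>+ x\<in>cball 0 R. Z x \<partial>lborel) \<le> (\<integral>\<^sup>+ x. ennreal (1 / \<delta>) *
      ((\<integral>\<^sup>+ s. ?e s x \<partial>lborel) * indicator (cball 0 R) x + (\<integral>\<^sup>+ s. ?f s x \<partial>lborel) * indicator (cball 0 R) x)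
      + ((\<integral>\<^sup>+ s. ennreal (g s (X s x)) \<partial>lborel) * indicator (cball 0 R) x + (\<integral>\<^sup>+ s. ennreal (g s (Y s x)) \<partial>lborel) * indicator (cball 0 R) x) \<partial>lborel)"
    by (intro nn_integral_mono_AE) (auto elim!: eventually_mono split: split_indicator)
  also have "\<dots> = ennreal (1 / \<delta>) * (defect R X \<beta> + defect R Y \<gamma>)
      + ((\<integral>\<^sup>+ x\<in>cball 0 R. (\<integral>\<^sup>+ s. ennreal (g s (X s x)) \<partial>lborel) \<partial>lborel) + (\<integral>\<^sup>+ x\<in>cball 0 R. (\<integral>\<^sup>+ s. ennreal (g s (Y s x)) \<partial>lborel) \<partial>lborel))"
    unfolding defect_def by (subst nn_integral_add nn_integral_cmult, measurable)+
  also have "\<dots> \<le> ennreal (1 / \<delta>) * (defect R X \<beta> + defect R Y \<gamma>) + (ennreal L * mass (R + M * T) + ennreal L * mass (R + M * T))"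
    by (intro add_left_mono add_mono spread_mass[OF transport_spread[OF X]] spread_mass[OF transport_spread[OF Y]])
  finally show "(\<integral>\<^sup>+ x\<in>cball 0 R. Z x \<partial>lborel)
      \<le> ennreal (1 / \<delta>) * (defect R X \<beta> + defect R Y \<gamma>) + 2 * (ennreal L * mass (R + M * T))"
    by (simp add: mult_2)
qed

text \<open>Markov's inequality for \<open>Z\<close> at the level
  \<open>potential \<delta> \<eta>\<close>: a trajectory that deviates by more than \<eta> at some
  time has at least this potential there. The set \<open>A\<close> is defined through
  \<open>Z\<close>, which makes it Borel.\<close>

lemma transport_deviation:
  assumes X: "transport L X \<beta>" and Y: "transport L Y \<gamma>" and \<delta>: "0 < \<delta>" and \<eta>: "0 < \<eta>"
  shows "\<exists>A\<in>sets borel. emeasure lborel A \<le> ennreal (1 / potential \<delta> \<eta>) *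
        (ennreal (1 / \<delta>) * (defect R X \<beta> + defect R Y \<gamma>) + 2 * (ennreal L * mass (R + M * T)))
      \<and> (AE x in lborel. x \<in> cball 0 R \<longrightarrow> x \<notin> A \<longrightarrow> (\<forall>t\<in>{0..T}. norm (X t x - Y t x) \<le> \<eta>))"
proof -
  let ?p = "potential \<delta> \<eta>"
  have p: "0 < ?p" by (rule potential_pos[OF \<delta> \<eta>])
  define Z where "Z x = (\<integral>\<^sup>+ s. ennreal (norm (\<beta> s x - \<gamma> s x) * slope \<delta> (norm (X s x - Y s x))) \<partial>lborel)" for x
  note Z = transport_stability[OF X Y \<delta>, folded Z_def]
  note [measurable] = Z(1)
  define A where "A = {x \<in> cball 0 R. 1 \<le> ennreal (1 / ?p) * Z x}"
  have A: "A \<in> sets borel" unfolding A_def by measurable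
  have "emeasure lborel A \<le> ennreal (1 / ?p) * (\<integral>\<^sup>+ x\<in>cball 0 R. Z x \<partial>lborel)"
    unfolding A_def by (rule nn_integral_Markov_inequality) auto
  also have "\<dots> \<le> ennreal (1 / ?p) * (ennreal (1 / \<delta>) * (defect R X \<beta> + defect R Y \<gamma>) + 2 * (ennreal L * mass (R + M * T)))"
    by (intro mult_left_mono Z(3)) simp
  finally have "emeasure lborel A \<le> \<dots>" .
  moreover have "AE x in lborel. x \<in> cball 0 R \<longrightarrow> x \<notin> A \<longrightarrow> (\<forall>t\<in>{0..T}. norm (X t x - Y t x) \<le> \<eta>)"
    using Z(2)
  proof eventually_elim
    case (elim x)
    show ?case
    proof (intro impI ballI, rule ccontr)
      fix t assume x: "x \<in> cball 0 R" "x \<notin> A" and t: "t \<in> {0..T}" "\<not> norm (X t x - Y t x) \<le> \<eta>"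
      have "?p \<le> potential \<delta> (norm (X t x - Y t x))" using t \<eta> by (intro potential_mono[OF \<delta>]) auto
      then have "ennreal ?p \<le> Z x" using elim t by (metis ennreal_leI order_trans)
      then have "ennreal (1 / ?p) * ennreal ?p \<le> ennreal (1 / ?p) * Z x" by (intro mult_left_mono) auto
      moreover have "ennreal (1 / ?p) * ennreal ?p = 1" using p by (simp flip: ennreal_mult')
      ultimately have "x \<in> A" using x by (simp add: A_def)
      then show False using x by simp
    qed
  qed
  ultimately show ?thesis using A by blast
qed

text \<open>
  Without defects, the bound on the measure of the exceptional set tends to \<open>0\<close> with \<open>\<delta>\<close>, because
  the potential blows up.
\<close>

lemma transport_unique:
  assumes X: "transport L X \<beta>" and Y: "transport L Y \<gamma>"
    and dX: "\<And>R. defect R X \<beta> = 0" and dY: "\<And>R. defect R Y \<gamma> = 0"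
  shows "AE x in lborel. \<forall>t\<in>{0..T}. X t x = Y t x"
proof -
  have "AE x in lborel. x \<in> cball 0 (real R) \<longrightarrow> (\<forall>t\<in>{0..T}. norm (X t x - Y t x) \<le> 1 / real (Suc n))" for R n :: nat
  proof -
    let ?K = "2 * (ennreal L * mass (real R + M * T))"
    have K: "?K < \<infinity>" using mass_finite[of "real R + M * T"] by (simp add: ennreal_mult_less_top)
    have "\<exists>A\<in>sets borel. emeasure lborel A \<le> ennreal (1 / real (Suc k)) * ?K
        \<and> (AE x in lborel. x \<in> cball 0 (real R) \<longrightarrow> x \<notin> A \<longrightarrow> (\<forall>t\<in>{0..T}. norm (X t x - Y t x) \<le> 1 / real (Suc n)))" for k
    proof -
      obtain \<delta> where \<delta>: "0 < \<delta>" "real (Suc k) \<le> potential \<delta> (1 / real (Suc n))"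
        using potential_unbounded[of "1 / real (Suc n)" "real (Suc k)"] by auto
      have "ennreal (1 / potential \<delta> (1 / real (Suc n))) * ?K \<le> ennreal (1 / real (Suc k)) * ?K"
        using \<delta>(2) by (intro mult_right_mono ennreal_leI divide_left_mono mult_pos_pos) auto
      with transport_deviation[OF X Y \<delta>(1), of "1 / real (Suc n)" "real R"] show ?thesis
        unfolding dX dY by (auto intro: order_trans)
    qed
    then have "\<forall>k. \<exists>A. A \<in> sets borel \<and> emeasure lborel A \<le> ennreal (1 / real (Suc k)) * ?K
        \<and> (AE x in lborel. x \<in> cball 0 (real R) \<longrightarrow> x \<notin> A \<longrightarrow> (\<forall>t\<in>{0..T}. norm (X t x - Y t x) \<le> 1 / real (Suc n)))"
      unfolding Bex_def by (rule allI)
    from choice[OF this] obtain A where A: "\<And>k. A k \<in> sets borel" "\<And>k. emeasure lborel (A k) \<le> ennreal (1 / real (Suc k)) * ?K"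
      and AE: "\<And>k. AE x in lborel. x \<in> cball 0 (real R) \<longrightarrow> x \<notin> A k \<longrightarrow> (\<forall>t\<in>{0..T}. norm (X t x - Y t x) \<le> 1 / real (Suc n))"
      by blast
    \<comment> \<open>The sets \<open>A k\<close> belong to different values of \<delta> but capture
      the same deviating points up to null sets, so these points lie in the intersection.\<close>
    have "emeasure lborel (\<Inter>k. A k) \<le> ennreal (1 / real (Suc k)) * ?K" for k
      by (rule order.trans[OF emeasure_mono A(2)[of k]]) (auto simp: A(1))
    moreover have "(\<lambda>k. ennreal (1 / real (Suc k)) * ?K) \<longlonglongrightarrow> ennreal 0 * ?K"
      using K by (intro tendsto_mult_ennreal tendsto_const tendsto_ennrealI LIMSEQ_Suc[OF lim_1_over_n]) (auto simp: less_top)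
    ultimately have "emeasure lborel (\<Inter>k. A k) \<le> ennreal 0 * ?K"
      using LIMSEQ_le_const by blast
    then have "(\<Inter>k. A k) \<in> null_sets lborel" using A(1) by (auto simp: null_sets_def)
    then have "AE x in lborel. x \<notin> (\<Inter>k. A k)" by (rule AE_not_in)
    moreover have "AE x in lborel. \<forall>k. x \<in> cball 0 (real R) \<longrightarrow> x \<notin> A k \<longrightarrow> (\<forall>t\<in>{0..T}. norm (X t x - Y t x) \<le> 1 / real (Suc n))"
      unfolding AE_all_countable by (intro allI AE)
    ultimately show ?thesis by eventually_elim blast
  qed
  then have "AE x in lborel. \<forall>R n. x \<in> cball 0 (real R) \<longrightarrow> (\<forall>t\<in>{0..T}. norm (X t x - Y t x) \<le> 1 / real (Suc n))"
    unfolding AE_all_countable by (intro allI)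
  then show ?thesis
  proof eventually_elim
    case (elim x)
    obtain R :: nat where "norm x \<le> real R" using real_arch_simple by blast
    then have "x \<in> cball 0 (real R)" by simp
    then have le: "norm (X t x - Y t x) \<le> 1 / real (Suc n)" if "t \<in> {0..T}" for t n using elim that by blast
    show ?case
    proof
      fix t assume "t \<in> {0..T}"
      from le[OF this] have "norm (X t x - Y t x) \<le> 0"
        using LIMSEQ_le_const[OF LIMSEQ_Suc[OF lim_1_over_n]] by blast
      then show "X t x = Y t x" by simp
    qed
  qed
qed

end

section \<open>A polygonal approximation scheme\<close>

text \<open>The integral in the last assumption is the divergence of the mollified field at
  \<open>x\<close>. The distributional hypothesis is used only in this pointwise form, valid for all
  \<epsilon> and \<open>x\<close> at almost every time. The space is \<open>real^'n\<close> because
  determinants are taken.\<close>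

locale osgood_divergence = osgood_field \<rho> T M b g
  for \<rho> T M and b :: "real \<Rightarrow> real^'n \<Rightarrow> real^'n" and g +
  fixes m :: "real \<Rightarrow> real"
  assumes m_integrable: "integrable lborel m" and m_nonneg: "\<And>t. 0 \<le> m t"
    and divergence: "AE t in lborel. \<forall>\<epsilon>>0. \<forall>x. - m t \<le> (LINT y|lborel. mollifier_grad \<epsilon> (x - y) \<bullet> b t y)"
begin

lemma b_slice_measurable[measurable]: "b t \<in> borel_measurable borel" "(\<lambda>t. b t x) \<in> borel_measurable borel"
  by measurable

lemma mollify_b_measurable[measurable]:
  "(\<lambda>(t, x). mollify \<epsilon> (b t) x) \<in> borel_measurable (borel \<Otimes>\<^sub>M borel)"
  unfolding mollify_def by measurable

lemma norm_mollify_b: "0 < \<epsilon> \<Longrightarrow> norm (mollify \<epsilon> (b t) x) \<le> M"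
  by (rule norm_mollify_le[OF _ b_slice_measurable(1) b_bound])

lemma mollify_b_outside: "t \<notin> {0..T} \<Longrightarrow> mollify \<epsilon> (b t) x = 0"
  by (simp add: mollify_def b_outside)

text \<open>(H) is averaged over \<open>y\<close> with the kernel as weight. On the support
  \<open>norm (x - y)\<close> is below \<epsilon>, so the modulus is at most
  \<open>\<rho> \<epsilon>\<close>; the unit mass of the kernel leaves \<open>g t x\<close> and a
  convolution of \<open>g\<close>.\<close>

lemma mollify_b_approx:
  assumes \<epsilon>: "0 < \<epsilon>"
  shows "AE t in lborel. AE x in lborel. ennreal (norm (mollify \<epsilon> (b t) x - b t x))
    \<le> ennreal (\<rho> \<epsilon>) * (ennreal (g t x) + (\<integral>\<^sup>+ y. ennreal (mollifier \<epsilon> (x - y)) * ennreal (g t y) \<partial>lborel))"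
  using H
proof eventually_elim
  case (elim t)
  then obtain N where N: "N \<in> null_sets lborel" "\<And>x y. x \<notin> N \<Longrightarrow> y \<notin> N \<Longrightarrow>
      norm (b t x - b t y) \<le> (g t x + g t y) * \<rho> (norm (x - y))" by blast
  show ?case using AE_not_in[OF N(1)]
  proof eventually_elim
    case (elim x)
    have int: "integrable lborel (\<lambda>y. mollifier \<epsilon> (x - y) *\<^sub>R b t x)"
      by (rule integrable_mollify[OF \<epsilon>, of "\<lambda>_. b t x"]) auto
    have "mollify \<epsilon> (b t) x - b t x = (LINT y|lborel. mollifier \<epsilon> (x - y) *\<^sub>R (b t y - b t x))"
    proof -
      have "(LINT y|lborel. mollifier \<epsilon> (x - y) *\<^sub>R b t x) = b t x"
        using nn_integral_mollifier[OF \<epsilon>, of x]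
        by (subst integral_scaleR_left)
          (auto intro!: integrableI_nonneg simp: mollifier_nonneg integral_eq_nn_integral)
      then show ?thesis
        using int integrable_mollify[OF \<epsilon> b_slice_measurable(1) b_bound, of x t]
        by (simp add: mollify_def scaleR_right_diff_distrib)
    qed
    also have "ennreal (norm \<dots>) \<le> (\<integral>\<^sup>+ y. ennreal (norm (mollifier \<epsilon> (x - y) *\<^sub>R (b t y - b t x))) \<partial>lborel)"
      by (rule integral_norm_bound_ennreal)
        (use int integrable_mollify[OF \<epsilon> b_slice_measurable(1) b_bound, of x t] in \<open>simp add: scaleR_right_diff_distrib\<close>)
    also have "\<dots> \<le> (\<integral>\<^sup>+ y. ennreal (\<rho> \<epsilon>) * (ennreal (mollifier \<epsilon> (x - y)) * ennreal (g t x) + ennreal (mollifier \<epsilon> (x - y)) * ennreal (g t y)) \<partial>lborel)"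
    proof (rule nn_integral_mono_AE, use AE_not_in[OF N(1)] in eventually_elim)
      case (elim y)
      show ?case
      proof (cases "\<epsilon> \<le> norm (x - y)")
        case True then show ?thesis by (simp add: mollifier_eq_0[OF \<epsilon>])
      next
        case False
        have "norm (b t y - b t x) \<le> (g t x + g t y) * \<rho> (norm (x - y))"
          using N(2)[of x y] \<open>x \<notin> N\<close> elim by (simp add: norm_minus_commute)
        also have "\<dots> \<le> (g t x + g t y) * \<rho> \<epsilon>"
          using False g_nonneg by (intro mult_left_mono rho_mono) auto
        finally have "norm (mollifier \<epsilon> (x - y) *\<^sub>R (b t y - b t x)) \<le> mollifier \<epsilon> (x - y) * ((g t x + g t y) * \<rho> \<epsilon>)"
          by (simp add: mollifier_nonneg mult_left_mono)
        also have "\<dots> = \<rho> \<epsilon> * (mollifier \<epsilon> (x - y) * g t x + mollifier \<epsilon> (x - y) * g t y)" by (simp add: algebra_simps)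
        finally have "ennreal (norm (mollifier \<epsilon> (x - y) *\<^sub>R (b t y - b t x)))
          \<le> ennreal (\<rho> \<epsilon> * (mollifier \<epsilon> (x - y) * g t x + mollifier \<epsilon> (x - y) * g t y))" by (rule ennreal_leI)
        then show ?thesis using rho_nonneg[of \<epsilon>] \<epsilon>
          by (simp add: ennreal_mult mollifier_nonneg g_nonneg)
      qed
    qed
    also have "\<dots> = ennreal (\<rho> \<epsilon>) * ((\<integral>\<^sup>+ y. ennreal (mollifier \<epsilon> (x - y)) \<partial>lborel) * ennreal (g t x)
        + (\<integral>\<^sup>+ y. ennreal (mollifier \<epsilon> (x - y)) * ennreal (g t y) \<partial>lborel))"
      by (subst nn_integral_cmult nn_integral_add nn_integral_multc, measurable)+
    finally show ?case by (simp add: nn_integral_mollifier[OF \<epsilon>])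
  qed
qed

lemma mollify_b_error:
  assumes \<epsilon>: "0 < \<epsilon>"
  shows "(\<integral>\<^sup>+ t. (\<integral>\<^sup>+ x\<in>cball 0 R. ennreal (norm (mollify \<epsilon> (b t) x - b t x)) \<partial>lborel) \<partial>lborel)
    \<le> ennreal (\<rho> \<epsilon>) * (mass R + mass (R + \<epsilon>))"
proof -
  \<comment> \<open>Convolution with a kernel of mass one does not increase the integral, except
    that the ball has to grow by the radius \<epsilon> of the support.\<close>
  have conv: "(\<integral>\<^sup>+ x\<in>cball 0 R. (\<integral>\<^sup>+ y. ennreal (mollifier \<epsilon> (x - y)) * ennreal (g t y) \<partial>lborel) \<partial>lborel)
      \<le> (\<integral>\<^sup>+ y\<in>cball 0 (R + \<epsilon>). ennreal (g t y) \<partial>lborel)" for t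
  proof -
    have "(\<integral>\<^sup>+ x\<in>cball 0 R. (\<integral>\<^sup>+ y. ennreal (mollifier \<epsilon> (x - y)) * ennreal (g t y) \<partial>lborel) \<partial>lborel)
        = (\<integral>\<^sup>+ x. (\<integral>\<^sup>+ y. ennreal (mollifier \<epsilon> (x - y)) * ennreal (g t y) * indicator (cball 0 R) x \<partial>lborel) \<partial>lborel)"
      by (intro nn_integral_cong nn_integral_multc[symmetric]) measurable
    also have "\<dots> = (\<integral>\<^sup>+ y. (\<integral>\<^sup>+ x. ennreal (mollifier \<epsilon> (x - y)) * ennreal (g t y) * indicator (cball 0 R) x \<partial>lborel) \<partial>lborel)"
      by (rule lborel_pair.Fubini') measurable
    also have "\<dots> \<le> (\<integral>\<^sup>+ y. (\<integral>\<^sup>+ x. ennreal (mollifier \<epsilon> (y - x)) * (ennreal (g t y) * indicator (cball 0 (R + \<epsilon>)) y) \<partial>lborel) \<partial>lborel)"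
    proof (intro nn_integral_mono)
      fix x y :: "real^'n"
      show "ennreal (mollifier \<epsilon> (x - y)) * ennreal (g t y) * indicator (cball 0 R) x
        \<le> ennreal (mollifier \<epsilon> (y - x)) * (ennreal (g t y) * indicator (cball 0 (R + \<epsilon>)) y)"
      proof (cases "\<epsilon> \<le> norm (x - y) \<or> x \<notin> cball 0 R")
        case True then show ?thesis by (auto simp: mollifier_eq_0[OF \<epsilon>])
      next
        case False
        then have "norm y \<le> R + \<epsilon>" using norm_triangle_ineq2[of y x] by (simp add: norm_minus_commute)
        then show ?thesis using False by (simp add: mollifier_commute[of \<epsilon> x])
      qed
    qed
    also have "\<dots> = (\<integral>\<^sup>+ y\<in>cball 0 (R + \<epsilon>). ennreal (g t y) \<partial>lborel)"
      by (subst nn_integral_multc) (measurable, simp add: nn_integral_mollifier[OF \<epsilon>])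
    finally show ?thesis .
  qed
  have "(\<integral>\<^sup>+ t. (\<integral>\<^sup>+ x\<in>cball 0 R. ennreal (norm (mollify \<epsilon> (b t) x - b t x)) \<partial>lborel) \<partial>lborel)
    \<le> (\<integral>\<^sup>+ t. ennreal (\<rho> \<epsilon>) * ((\<integral>\<^sup>+ x\<in>cball 0 R. ennreal (g t x) \<partial>lborel) + (\<integral>\<^sup>+ y\<in>cball 0 (R + \<epsilon>). ennreal (g t y) \<partial>lborel)) \<partial>lborel)"
  proof (rule nn_integral_mono_AE, use mollify_b_approx[OF \<epsilon>] in eventually_elim)
    case (elim t)
    have "(\<integral>\<^sup>+ x\<in>cball 0 R. ennreal (norm (mollify \<epsilon> (b t) x - b t x)) \<partial>lborel)
      \<le> (\<integral>\<^sup>+ x. ennreal (\<rho> \<epsilon>) * (ennreal (g t x) * indicator (cball 0 R) x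
          + (\<integral>\<^sup>+ y. ennreal (mollifier \<epsilon> (x - y)) * ennreal (g t y) \<partial>lborel) * indicator (cball 0 R) x) \<partial>lborel)"
      using elim by (intro nn_integral_mono_AE) (auto elim!: eventually_mono split: split_indicator)
    also have "\<dots> = ennreal (\<rho> \<epsilon>) * ((\<integral>\<^sup>+ x\<in>cball 0 R. ennreal (g t x) \<partial>lborel)
        + (\<integral>\<^sup>+ x\<in>cball 0 R. (\<integral>\<^sup>+ y. ennreal (mollifier \<epsilon> (x - y)) * ennreal (g t y) \<partial>lborel) \<partial>lborel))"
      by (subst nn_integral_cmult nn_integral_add, measurable)+
    also have "\<dots> \<le> ennreal (\<rho> \<epsilon>) * ((\<integral>\<^sup>+ x\<in>cball 0 R. ennreal (g t x) \<partial>lborel) + (\<integral>\<^sup>+ y\<in>cball 0 (R + \<epsilon>). ennreal (g t y) \<partial>lborel))"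
      by (intro mult_left_mono add_left_mono conv) simp
    finally show ?case .
  qed
  also have "\<dots> = ennreal (\<rho> \<epsilon>) * (mass R + mass (R + \<epsilon>))"
    unfolding mass_def by (subst nn_integral_cmult nn_integral_add, measurable)+
  finally show ?thesis .
qed

section \<open>The displacement in one time step\<close>

definition increment :: "real \<Rightarrow> real \<Rightarrow> real \<Rightarrow> real^'n \<Rightarrow> real^'n" where
  "increment \<epsilon> a c x = (LINT s:{a<..c}|lborel. mollify \<epsilon> (b s) x)"

lemma norm_increment_le: "0 < \<epsilon> \<Longrightarrow> a \<le> c \<Longrightarrow> norm (increment \<epsilon> a c x) \<le> M * (c - a)"
  unfolding increment_def by (intro norm_interval_integral_le norm_mollify_b) measurable

text \<open>By Fubini the displacement over a time interval is the mollification of the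
  time-integrated field. Its spatial derivative and Lipschitz bound are then those of a single
  convolution, and no differentiation under the time integral occurs.\<close>

lemma increment_eq_mollify:
  assumes \<epsilon>: "0 < \<epsilon>" and ac: "a \<le> c"
  shows "increment \<epsilon> a c x = mollify \<epsilon> (\<lambda>y. LINT s:{a<..c}|lborel. b s y) x"
    and "(LINT y|lborel. mollifier_grad \<epsilon> (x - y) \<bullet> (LINT s:{a<..c}|lborel. b s y))
      = (LINT s:{a<..c}|lborel. (LINT y|lborel. mollifier_grad \<epsilon> (x - y) \<bullet> b s y))"
proof -
  obtain G where G: "0 < G" "\<And>z::real^'n. norm (mollifier_grad \<epsilon> z) \<le> G" using mollifier_grad_bounded[OF \<epsilon>] by blast
  let ?K = "1 / kernel_mass TYPE(real^'n) \<epsilon>"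
  have ind: "integrable (lborel \<Otimes>\<^sub>M lborel) (\<lambda>(s, y). C * (indicator {a<..c} s * indicator (cball x \<epsilon>) y) :: real)" for C
  proof -
    have "integrable (lborel \<Otimes>\<^sub>M lborel) (\<lambda>p. indicator ({a<..c} \<times> cball x \<epsilon>) p :: real)"
      by (intro integrable_real_indicator)
        (auto simp: lborel.emeasure_pair_measure_Times ennreal_mult_less_top emeasure_lborel_cball_finite[unfolded infinity_ennreal_def] ac)
    then have "integrable (lborel \<Otimes>\<^sub>M lborel) (\<lambda>p. C * indicator ({a<..c} \<times> cball x \<epsilon>) p :: real)"
      by (rule integrable_mult_right)
    moreover have "(\<lambda>p. C * indicator ({a<..c} \<times> cball x \<epsilon>) p :: real) = (\<lambda>(s, y). C * (indicator {a<..c} s * indicator (cball x \<epsilon>) y))"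
      by (auto simp: fun_eq_iff indicator_def)
    ultimately show ?thesis by simp
  qed
  have 1: "integrable (lborel \<Otimes>\<^sub>M lborel) (\<lambda>(s, y). indicator {a<..c} s *\<^sub>R mollifier \<epsilon> (x - y) *\<^sub>R b s y)"
  proof (rule Bochner_Integration.integrable_bound[OF ind[of "?K * M"]])
    show "AE p in lborel \<Otimes>\<^sub>M lborel. norm (case p of (s, y) \<Rightarrow> indicator {a<..c} s *\<^sub>R mollifier \<epsilon> (x - y) *\<^sub>R b s y)
      \<le> norm (case p of (s, y) \<Rightarrow> (?K * M * (indicator {a<..c} s * indicator (cball x \<epsilon>) y) :: real))"
    proof (intro AE_I2, clarify)
      fix s and y :: "real^'n"
      have "norm (mollifier \<epsilon> (x - y) *\<^sub>R b s y) \<le> ?K * M"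
        unfolding norm_scaleR using mollifier_bounded[OF \<epsilon>, of "x - y"] b_bound[of s y] kernel_mass_pos[OF \<epsilon>, where 'a="real^'n"]
        by (intro mult_mono) auto
      moreover have "y \<notin> cball x \<epsilon> \<Longrightarrow> mollifier \<epsilon> (x - y) = 0" using mollifier_eq_0[OF \<epsilon>, of "x - y"] by (simp add: dist_norm)
      ultimately show "norm (indicat_real {a<..c} s *\<^sub>R mollifier \<epsilon> (x - y) *\<^sub>R b s y)
        \<le> norm (?K * M * (indicator {a<..c} s * indicator (cball x \<epsilon>) y) :: real)"
        using kernel_mass_pos[OF \<epsilon>, where 'a="real^'n"] M_nonneg by (auto simp: indicator_def)
    qed
  qed measurable
  have 2: "integrable (lborel \<Otimes>\<^sub>M lborel) (\<lambda>(s, y). indicator {a<..c} s *\<^sub>R (mollifier_grad \<epsilon> (x - y) \<bullet> b s y))"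
  proof (rule Bochner_Integration.integrable_bound[OF ind[of "G * M"]])
    show "AE p in lborel \<Otimes>\<^sub>M lborel. norm (case p of (s, y) \<Rightarrow> indicator {a<..c} s *\<^sub>R (mollifier_grad \<epsilon> (x - y) \<bullet> b s y))
      \<le> norm (case p of (s, y) \<Rightarrow> (G * M * (indicator {a<..c} s * indicator (cball x \<epsilon>) y) :: real))"
    proof (intro AE_I2, clarify)
      fix s and y :: "real^'n"
      have "\<bar>mollifier_grad \<epsilon> (x - y) \<bullet> b s y\<bar> \<le> G * M"
        using G b_bound[of s y] by (intro order.trans[OF Cauchy_Schwarz_ineq2] mult_mono) auto
      moreover have "y \<notin> cball x \<epsilon> \<Longrightarrow> mollifier_grad \<epsilon> (x - y) = 0" using mollifier_grad_eq_0[OF \<epsilon>, of "x - y"] by (simp add: dist_norm)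
      ultimately show "norm (indicat_real {a<..c} s *\<^sub>R (mollifier_grad \<epsilon> (x - y) \<bullet> b s y))
        \<le> norm (G * M * (indicator {a<..c} s * indicator (cball x \<epsilon>) y) :: real)"
        using G(1) M_nonneg by (auto simp: indicator_def)
    qed
  qed measurable
  have bint: "integrable lborel (\<lambda>s. indicator {a<..c} s *\<^sub>R b s y)" for y
    using set_integrable_bounded_interval[OF b_slice_measurable(2) b_bound, of "{a<..c}" y] by (simp add: set_integrable_def)
  have "increment \<epsilon> a c x = (LINT s|lborel. (LINT y|lborel. indicator {a<..c} s *\<^sub>R mollifier \<epsilon> (x - y) *\<^sub>R b s y))"
    unfolding increment_def mollify_def set_lebesgue_integral_def by (simp only: integral_scaleR_right)
  also have "\<dots> = (LINT y|lborel. (LINT s|lborel. indicator {a<..c} s *\<^sub>R mollifier \<epsilon> (x - y) *\<^sub>R b s y))"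
    by (rule lborel_pair.Fubini_integral[OF 1, symmetric])
  also have "\<dots> = (LINT y|lborel. (LINT s|lborel. mollifier \<epsilon> (x - y) *\<^sub>R (indicator {a<..c} s *\<^sub>R b s y)))"
    by (simp add: mult.commute)
  also have "\<dots> = mollify \<epsilon> (\<lambda>y. LINT s:{a<..c}|lborel. b s y) x"
    unfolding mollify_def set_lebesgue_integral_def by (simp only: integral_scaleR_right)
  finally show "increment \<epsilon> a c x = mollify \<epsilon> (\<lambda>y. LINT s:{a<..c}|lborel. b s y) x" .
  have "(LINT y|lborel. mollifier_grad \<epsilon> (x - y) \<bullet> (LINT s:{a<..c}|lborel. b s y))
      = (LINT y|lborel. (LINT s|lborel. indicator {a<..c} s *\<^sub>R (mollifier_grad \<epsilon> (x - y) \<bullet> b s y)))"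
    unfolding set_lebesgue_integral_def
    by (subst integral_inner_right[symmetric]) (auto intro: bint)
  also have "\<dots> = (LINT s|lborel. (LINT y|lborel. indicator {a<..c} s *\<^sub>R (mollifier_grad \<epsilon> (x - y) \<bullet> b s y)))"
    by (rule lborel_pair.Fubini_integral[OF 2])
  also have "\<dots> = (LINT s:{a<..c}|lborel. (LINT y|lborel. mollifier_grad \<epsilon> (x - y) \<bullet> b s y))"
    unfolding set_lebesgue_integral_def by simp
  finally show "(LINT y|lborel. mollifier_grad \<epsilon> (x - y) \<bullet> (LINT s:{a<..c}|lborel. b s y))
      = (LINT s:{a<..c}|lborel. (LINT y|lborel. mollifier_grad \<epsilon> (x - y) \<bullet> b s y))" .
qed


lemma m_set_integrable: "S \<in> sets borel \<Longrightarrow> set_integrable lborel S m"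
  using integrable_mult_indicator[of S lborel m] m_integrable by (simp add: set_integrable_def)

text \<open>\<open>P\<close> is uniform in the time interval, so Lipschitz constant and matrix
  entries are proportional to its length; \<open>P\<close> may depend badly on \<epsilon>. The
  trace, in contrast, is bounded by the integral of \<open>m\<close> alone, with no dependence on
  \<epsilon>.\<close>

lemma increment_slope_bound:
  assumes \<epsilon>: "0 < \<epsilon>"
  shows "\<exists>P>0. (\<forall>s x x'. norm (mollify \<epsilon> (b s) x - mollify \<epsilon> (b s) x') \<le> P * norm (x - x')) \<and>
    (\<forall>a c. a \<le> c \<longrightarrow> (\<exists>w'. (\<forall>x. (increment \<epsilon> a c has_derivative w' x) (at x)) \<and>
      (\<forall>x i j. \<bar>w' x (axis j 1) $ i\<bar> \<le> (c - a) * P) \<and>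
      (\<forall>x. - (LINT s:{a<..c}|lborel. m s) \<le> (\<Sum>i\<in>UNIV. w' x (axis i 1) $ i))) \<and>
      (\<forall>x x'. norm (increment \<epsilon> a c x - increment \<epsilon> a c x') \<le> (c - a) * P * norm (x - x')))"
proof -
  obtain G where G: "0 < G" "\<And>z::real^'n. norm (mollifier_grad \<epsilon> z) \<le> G" using mollifier_grad_bounded[OF \<epsilon>] by blast
  obtain \<Lambda> where \<Lambda>: "0 < \<Lambda>" "\<And>z w::real^'n. \<bar>mollifier \<epsilon> z - mollifier \<epsilon> w\<bar> \<le> \<Lambda> * norm (z - w)" using mollifier_lipschitz[OF \<epsilon>] by blast
  let ?V = "measure lborel (cball (0::real^'n) \<epsilon>)"
  have V: "measure lborel (cball z \<epsilon>) = ?V" for z :: "real^'n"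
    using \<epsilon> by (simp add: measure_def emeasure_cball)
  \<comment> \<open>The first summand bounds the entries of the derivative, the second the Lipschitz
    constants of field and displacement, and 1 ensures positivity.\<close>
  define P where "P = G * M * ?V + 2 * \<Lambda> * M * ?V + 1"
  have nn: "0 \<le> G * M * ?V" "0 \<le> 2 * \<Lambda> * M * ?V" using G(1) \<Lambda>(1) M_nonneg by auto
  have P: "0 < P" "G * M * ?V \<le> P" "2 * \<Lambda> * M * ?V \<le> P" using nn unfolding P_def by linarith+
  have "norm (mollify \<epsilon> (b s) x - mollify \<epsilon> (b s) x') \<le> P * norm (x - x')" for s x x'
    using mollify_lipschitz[OF \<epsilon> b_slice_measurable(1) b_bound less_imp_le[OF \<Lambda>(1)] \<Lambda>(2), of s x x']
      mult_right_mono[OF P(3) norm_ge_zero[of "x - x'"]] by linarith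
  moreover have "(\<exists>w'. (\<forall>x. (increment \<epsilon> a c has_derivative w' x) (at x)) \<and>
      (\<forall>x i j. \<bar>w' x (axis j 1) $ i\<bar> \<le> (c - a) * P) \<and>
      (\<forall>x. - (LINT s:{a<..c}|lborel. m s) \<le> (\<Sum>i\<in>UNIV. w' x (axis i 1) $ i))) \<and>
      (\<forall>x x'. norm (increment \<epsilon> a c x - increment \<epsilon> a c x') \<le> (c - a) * P * norm (x - x'))"
    if ac: "a \<le> c" for a c
  proof -
    define B where "B = (\<lambda>y. LINT s:{a<..c}|lborel. b s y)"
    have Bm[measurable]: "B \<in> borel_measurable borel" unfolding B_def set_lebesgue_integral_def by measurable
    have BM: "norm (B y) \<le> M * (c - a)" for y
      unfolding B_def by (intro norm_interval_integral_le b_bound ac) measurable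
    have inc: "increment \<epsilon> a c = mollify \<epsilon> B"
      using increment_eq_mollify(1)[OF \<epsilon> ac] by (simp add: B_def fun_eq_iff)
    define w' where "w' x h = (LINT y|lborel. (mollifier_grad \<epsilon> (x - y) \<bullet> h) *\<^sub>R B y)" for x h
    have der: "(increment \<epsilon> a c has_derivative w' x) (at x)" for x
      unfolding inc w'_def by (rule mollify_has_derivative[OF \<epsilon> Bm BM])
    have intw: "integrable lborel (\<lambda>y. (mollifier_grad \<epsilon> (x - y) \<bullet> h) *\<^sub>R B y)" for x h
      by (rule integrable_mollifier_grad[OF \<epsilon> Bm BM])
    have comp: "w' x h $ i = (LINT y|lborel. (mollifier_grad \<epsilon> (x - y) \<bullet> h) * B y $ i)" for x h i
      unfolding w'_def using integral_bounded_linear[OF bounded_linear_vec_nth[of i] intw[of x h]] by simp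
    have intc: "integrable lborel (\<lambda>y. (mollifier_grad \<epsilon> (x - y) \<bullet> h) * B y $ i)" for x h i
      using integrable_bounded_linear[OF bounded_linear_vec_nth[of i] intw[of x h]] by simp
    have entries: "\<bar>w' x (axis j 1) $ i\<bar> \<le> (c - a) * P" for x i j
    proof -
      have "\<bar>w' x (axis j 1) $ i\<bar> \<le> (LINT y|lborel. \<bar>(mollifier_grad \<epsilon> (x - y) \<bullet> axis j 1) * B y $ i\<bar>)"
        unfolding comp using integral_norm_bound[of lborel "\<lambda>y. (mollifier_grad \<epsilon> (x - y) \<bullet> axis j 1) * B y $ i"] by simp
      also have "\<dots> \<le> (LINT y|lborel. (G * (M * (c - a))) * indicator (cball x \<epsilon>) y)"
      proof (rule integral_mono)
        show "integrable lborel (\<lambda>y. \<bar>(mollifier_grad \<epsilon> (x - y) \<bullet> axis j 1) * B y $ i\<bar>)"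
          by (intro integrable_abs intc)
        show "integrable lborel (\<lambda>y. (G * (M * (c - a))) * indicator (cball x \<epsilon>) y :: real)"
          by (intro integrable_mult_right integrable_real_indicator) (auto simp: emeasure_lborel_cball_finite[unfolded infinity_ennreal_def])
        show "\<bar>(mollifier_grad \<epsilon> (x - y) \<bullet> axis j 1) * B y $ i\<bar> \<le> (G * (M * (c - a))) * indicator (cball x \<epsilon>) y" for y
        proof (cases "y \<in> cball x \<epsilon>")
          case True
          have "\<bar>mollifier_grad \<epsilon> (x - y) \<bullet> axis j 1\<bar> \<le> G"
            using component_le_norm_cart[of "mollifier_grad \<epsilon> (x - y)" j] G(2)[of "x - y"] by (simp add: inner_axis)
          moreover have "\<bar>B y $ i\<bar> \<le> M * (c - a)" using component_le_norm_cart[of "B y" i] BM[of y] by simp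
          ultimately show ?thesis using True G(1) unfolding abs_mult by (auto intro!: mult_mono)
        next
          case False
          then show ?thesis using mollifier_grad_eq_0[OF \<epsilon>, of "x - y"] by (simp add: dist_norm)
        qed
      qed
      also have "\<dots> = (c - a) * (G * M * ?V)" by (simp add: V[of x])
      also have "\<dots> \<le> (c - a) * P" using ac P(2) by (intro mult_left_mono) auto
      finally show ?thesis .
    qed
    have trace: "- (LINT s:{a<..c}|lborel. m s) \<le> (\<Sum>i\<in>UNIV. w' x (axis i 1) $ i)" for x
    proof -
      have "- (LINT s:{a<..c}|lborel. m s) = (LINT s:{a<..c}|lborel. - m s)"
        by (simp add: set_lebesgue_integral_def)
      also have "\<dots> \<le> (LINT s:{a<..c}|lborel. (LINT y|lborel. mollifier_grad \<epsilon> (x - y) \<bullet> b s y))"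
        unfolding set_lebesgue_integral_def
      proof (rule integral_mono_AE)
        show "integrable lborel (\<lambda>s. indicator {a<..c} s *\<^sub>R - m s)"
          using m_set_integrable[of "{a<..c}"] by (simp add: set_integrable_def)
        have db: "\<bar>LINT y|lborel. mollifier_grad \<epsilon> (x - y) \<bullet> b s y\<bar> \<le> G * M * ?V" for s
        proof -
          have "\<bar>LINT y|lborel. mollifier_grad \<epsilon> (x - y) \<bullet> b s y\<bar> \<le> (LINT y|lborel. \<bar>mollifier_grad \<epsilon> (x - y) \<bullet> b s y\<bar>)"
            using integral_norm_bound[of lborel "\<lambda>y. mollifier_grad \<epsilon> (x - y) \<bullet> b s y"] by simp
          also have "\<dots> \<le> (LINT y|lborel. (G * M) * indicator (cball x \<epsilon>) y)"
          proof (rule integral_mono')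
            show "integrable lborel (\<lambda>y. (G * M) * indicator (cball x \<epsilon>) y :: real)"
              by (intro integrable_mult_right integrable_real_indicator) (auto simp: emeasure_lborel_cball_finite[unfolded infinity_ennreal_def])
            show "\<bar>mollifier_grad \<epsilon> (x - y) \<bullet> b s y\<bar> \<le> (G * M) * indicator (cball x \<epsilon>) y" for y
            proof (cases "y \<in> cball x \<epsilon>")
              case True
              then show ?thesis using G b_bound[of s y] by (auto intro!: order.trans[OF Cauchy_Schwarz_ineq2] mult_mono)
            next
              case False
              then show ?thesis using mollifier_grad_eq_0[OF \<epsilon>, of "x - y"] by (simp add: dist_norm)
            qed
          qed (use G M_nonneg in auto)
          also have "\<dots> = G * M * ?V" by (simp add: V[of x])
          finally show ?thesis .
        qed
        have "set_integrable lborel {a<..c} (\<lambda>s. LINT y|lborel. mollifier_grad \<epsilon> (x - y) \<bullet> b s y)"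
          using db by (intro set_integrable_bounded_interval[where K="G * M * ?V"]) auto
        then show "integrable lborel (\<lambda>s. indicator {a<..c} s *\<^sub>R (LINT y|lborel. mollifier_grad \<epsilon> (x - y) \<bullet> b s y))"
          by (simp add: set_integrable_def)
        show "AE s in lborel. indicator {a<..c} s *\<^sub>R - m s \<le> indicator {a<..c} s *\<^sub>R (LINT y|lborel. mollifier_grad \<epsilon> (x - y) \<bullet> b s y)"
          using divergence by eventually_elim (use \<epsilon> in \<open>auto simp: indicator_def\<close>)
      qed
      also have "\<dots> = (LINT y|lborel. mollifier_grad \<epsilon> (x - y) \<bullet> B y)"
        using increment_eq_mollify(2)[OF \<epsilon> ac] by (simp add: B_def)
      also have "\<dots> = (LINT y|lborel. (\<Sum>i\<in>UNIV. (mollifier_grad \<epsilon> (x - y) \<bullet> axis i 1) * B y $ i))"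
        by (simp add: inner_vec_def[of _ "B _"] inner_axis)
      also have "\<dots> = (\<Sum>i\<in>UNIV. w' x (axis i 1) $ i)"
        unfolding comp by (rule Bochner_Integration.integral_sum) (rule intc)
      finally show ?thesis .
    qed
    have lip: "norm (increment \<epsilon> a c x - increment \<epsilon> a c x') \<le> (c - a) * P * norm (x - x')" for x x'
    proof -
      have "norm (increment \<epsilon> a c x - increment \<epsilon> a c x') \<le> (c - a) * (2 * \<Lambda> * M * ?V) * norm (x - x')"
        unfolding inc using mollify_lipschitz[OF \<epsilon> Bm BM less_imp_le[OF \<Lambda>(1)] \<Lambda>(2), of x x'] by (simp only: ac_simps)
      also have "\<dots> \<le> (c - a) * P * norm (x - x')"
        using ac P(3) by (intro mult_right_mono mult_left_mono) auto
      finally show ?thesis .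
    qed
    show ?thesis using der entries trace lip by blast
  qed
  ultimately show ?thesis using P(1) by blast
qed


lemma m_integral_split:
  assumes "a \<le> s" "s \<le> t"
  shows "(LINT u:{a<..t}|lborel. m u) = (LINT u:{a<..s}|lborel. m u) + (LINT u:{s<..t}|lborel. m u)"
proof -
  have "{a<..t} = {a<..s} \<union> {s<..t}" using assms by auto
  then show ?thesis by (simp, intro set_integral_Un m_set_integrable) auto
qed

lemma m_integral_bounds: "0 \<le> (LINT u:{a<..t}|lborel. m u)" "(LINT u:{a<..t}|lborel. m u) \<le> (LINT u|lborel. m u)"
proof -
  show "0 \<le> (LINT u:{a<..t}|lborel. m u)" by (simp add: set_lebesgue_integral_def m_nonneg)
  show "(LINT u:{a<..t}|lborel. m u) \<le> (LINT u|lborel. m u)"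
    unfolding set_lebesgue_integral_def using m_set_integrable[of "{a<..t}"]
    by (intro integral_mono m_integrable) (auto simp: set_integrable_def indicator_def m_nonneg)
qed

text \<open>
  In each time step the mollified field is evaluated at the position at the beginning of the step,
  but at the running time. A step is therefore an explicit small perturbation of the identity, whose
  Jacobian is controlled without solving a differential equation.
\<close>

primrec node :: "real \<Rightarrow> real \<Rightarrow> nat \<Rightarrow> real^'n \<Rightarrow> real^'n" where
  "node \<epsilon> h 0 x = x"
| "node \<epsilon> h (Suc k) x = node \<epsilon> h k x + increment \<epsilon> (real k * h) (real (Suc k) * h) (node \<epsilon> h k x)"

definition frozen_field :: "real \<Rightarrow> real \<Rightarrow> real \<Rightarrow> real^'n \<Rightarrow> real^'n" where
  "frozen_field \<epsilon> h s x = mollify \<epsilon> (b s) (node \<epsilon> h (nat \<lfloor>s / h\<rfloor>) x)"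

definition polygon :: "real \<Rightarrow> real \<Rightarrow> real \<Rightarrow> real^'n \<Rightarrow> real^'n" where
  "polygon \<epsilon> h t x = x + (LINT s:{0..t}|lborel. frozen_field \<epsilon> h s x)"

lemma increment_measurable[measurable]: "increment \<epsilon> a c \<in> borel_measurable borel"
  unfolding increment_def set_lebesgue_integral_def by measurable

lemma node_measurable[measurable]: "node \<epsilon> h k \<in> borel_measurable borel"
proof (induction k)
  case (Suc k)
  note [measurable] = this
  have "(\<lambda>x. node \<epsilon> h k x + increment \<epsilon> (real k * h) (real (Suc k) * h) (node \<epsilon> h k x)) \<in> borel_measurable borel"
    by measurable
  then show ?case by simp
qed simp

lemma frozen_field_measurable[measurable]: "case_prod (frozen_field \<epsilon> h) \<in> borel_measurable (borel \<Otimes>\<^sub>M borel)"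
proof -
  have [measurable]: "(\<lambda>p. node \<epsilon> h (nat \<lfloor>fst p / h\<rfloor>) (snd p)) \<in> borel_measurable (borel \<Otimes>\<^sub>M borel)"
    by (rule measurable_compose_countable[where f="\<lambda>k p. node \<epsilon> h k (snd p)"]) measurable
  show ?thesis unfolding frozen_field_def case_prod_beta by measurable
qed

lemma polygon_measurable[measurable]: "case_prod (polygon \<epsilon> h) \<in> borel_measurable (borel \<Otimes>\<^sub>M borel)"
proof -
  have [measurable]: "Measurable.pred ((borel \<Otimes>\<^sub>M borel) \<Otimes>\<^sub>M borel) (\<lambda>(p, s). s \<in> {0..fst p :: real})"
    unfolding atLeastAtMost_iff by measurable
  show ?thesis unfolding polygon_def set_lebesgue_integral_def case_prod_beta by measurable
qed

lemma frozen_field_slice: "(\<lambda>s. frozen_field \<epsilon> h s x) \<in> borel_measurable borel"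
  by measurable

context
  fixes \<epsilon> h :: real assumes \<epsilon>: "0 < \<epsilon>" and h: "0 < h"
begin

lemma norm_frozen_field: "norm (frozen_field \<epsilon> h s x) \<le> M"
  unfolding frozen_field_def by (rule norm_mollify_b[OF \<epsilon>])

lemma polygon_advance:
  assumes k: "polygon \<epsilon> h (real k * h) x = node \<epsilon> h k x" and t: "real k * h \<le> t" "t \<le> real (Suc k) * h"
  shows "polygon \<epsilon> h t x = node \<epsilon> h k x + increment \<epsilon> (real k * h) t (node \<epsilon> h k x)"
proof -
  have "(LINT s:{0..t}|lborel. frozen_field \<epsilon> h s x) = (LINT s:{0..real k * h}|lborel. frozen_field \<epsilon> h s x)
      + (LINT s:{real k * h<..t}|lborel. frozen_field \<epsilon> h s x)"
    using t h by (intro interval_integral_split[where K=M] frozen_field_slice norm_frozen_field) auto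
  moreover have "(LINT s:{real k * h<..t}|lborel. frozen_field \<epsilon> h s x) = increment \<epsilon> (real k * h) t (node \<epsilon> h k x)"
    unfolding increment_def set_lebesgue_integral_def
  proof (rule integral_cong_AE)
    show "AE s in lborel. indicator {real k * h<..t} s *\<^sub>R frozen_field \<epsilon> h s x
        = indicator {real k * h<..t} s *\<^sub>R mollify \<epsilon> (b s) (node \<epsilon> h k x)"
      \<comment> \<open>At the right end of the full step the floor jumps to \<open>k + 1\<close>;
        this single time is negligible.\<close>
      using AE_lborel_singleton[of "real (Suc k) * h"]
    proof eventually_elim
      case (elim s)
      show ?case
      proof (cases "s \<in> {real k * h<..t}")
        case True
        then have "real k \<le> s / h" "s / h < real k + 1" using elim t(2) h by (auto simp: field_simps)
        then have "\<lfloor>s / h\<rfloor> = int k" by (intro floor_unique) auto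
        then show ?thesis by (simp add: frozen_field_def)
      qed simp
    qed
  qed measurable
  ultimately show ?thesis using k by (simp add: polygon_def)
qed

lemma polygon_node: "polygon \<epsilon> h (real k * h) x = node \<epsilon> h k x"
proof (induction k)
  case 0
  show ?case by (simp add: polygon_def set_integral_singleton)
next
  case (Suc k)
  show ?case using polygon_advance[OF Suc, of "real (Suc k) * h"] h by (simp add: mult_right_mono)
qed

lemma polygon_eq:
  assumes "0 \<le> t"
  obtains k where "real k * h \<le> t" "t \<le> real (Suc k) * h" "k = nat \<lfloor>t / h\<rfloor>"
    "\<And>x. polygon \<epsilon> h t x = node \<epsilon> h k x + increment \<epsilon> (real k * h) t (node \<epsilon> h k x)"
proof -
  define k where "k = nat \<lfloor>t / h\<rfloor>"
  have "0 \<le> t / h" using assms h by simp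
  then have "real k \<le> t / h" "t / h \<le> real k + 1" unfolding k_def by linarith+
  then have "real k * h \<le> t" "t \<le> real (Suc k) * h" using h by (simp_all add: field_simps)
  with that[of k] polygon_advance[OF polygon_node] k_def show ?thesis by blast
qed

end

text \<open>The push-forward constant does not depend on \<epsilon>: in its exponent, the integral
  of \<open>m\<close> comes from the traces and the summand 2 from the accumulated quadratic errors,
  which total at most 1 before the factor 2. The defect is of order
  \<open>\<rho> \<epsilon>\<close>, because freezing the position within a step is made no worse
  than mollification.\<close>

lemma polygon_transport:
  assumes \<epsilon>: "0 < \<epsilon>"
  shows "\<exists>X \<beta>. transport (exp (2 * (LINT s|lborel. m s) + 2)) X \<beta> \<and>
    (\<forall>R. defect R X \<beta> \<le> ennreal (\<rho> \<epsilon>) * (ennreal T * emeasure lborel (cball (0::real^'n) R)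
      + ennreal (exp (2 * (LINT s|lborel. m s) + 2)) * (mass (R + M * T) + mass (R + M * T + \<epsilon>))))"
proof -
  obtain P where P: "0 < P" "\<And>s x x'. norm (mollify \<epsilon> (b s) x - mollify \<epsilon> (b s) x') \<le> P * norm (x - x')"
    and inc: "\<And>a c. a \<le> c \<Longrightarrow> (\<exists>w'. (\<forall>x. (increment \<epsilon> a c has_derivative w' x) (at x)) \<and>
      (\<forall>x i j. \<bar>w' x (axis j 1) $ i\<bar> \<le> (c - a) * P) \<and>
      (\<forall>x. - (LINT s:{a<..c}|lborel. m s) \<le> (\<Sum>i\<in>UNIV. w' x (axis i 1) $ i))) \<and>
      (\<forall>x x'. norm (increment \<epsilon> a c x - increment \<epsilon> a c x') \<le> (c - a) * P * norm (x - x'))"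
    using increment_slope_bound[OF \<epsilon>] by blast
  let ?D = "det_const TYPE('n)"
  let ?L = "exp (2 * (LINT s|lborel. m s) + 2)"
  have D: "0 \<le> ?D" by (simp add: det_const_def)
  \<comment> \<open>The four conditions serve different ends: injectivity of a step, smallness of
    \<open>u\<close> in the determinant estimate, a total below 1 for the quadratic errors of all
    steps up to time \<open>T\<close>, and a freezing error below
    \<open>\<rho> \<epsilon>\<close>.\<close>
  have "\<forall>\<^sub>F h in at_right 0. h * P < 1 / 2 \<and> CARD('n) * (h * P) + ?D * (h * P)\<^sup>2 < 1 / 2 \<and> ?D * P\<^sup>2 * h * (T + h) < 1 \<and> P * (M * h) < \<rho> \<epsilon>"
  proof (intro eventually_conj)
    have "((\<lambda>h. h * P) \<longlongrightarrow> 0 * P) (at_right 0)" by (intro tendsto_intros)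
    then show "\<forall>\<^sub>F h in at_right 0. h * P < 1 / 2" by (rule order_tendstoD) simp
    have "((\<lambda>h. CARD('n) * (h * P) + ?D * (h * P)\<^sup>2) \<longlongrightarrow> CARD('n) * (0 * P) + ?D * (0 * P)\<^sup>2) (at_right 0)" by (intro tendsto_intros)
    then show "\<forall>\<^sub>F h in at_right 0. CARD('n) * (h * P) + ?D * (h * P)\<^sup>2 < 1 / 2" by (rule order_tendstoD) simp
    have "((\<lambda>h. ?D * P\<^sup>2 * h * (T + h)) \<longlongrightarrow> ?D * P\<^sup>2 * 0 * (T + 0)) (at_right 0)" by (intro tendsto_intros)
    then show "\<forall>\<^sub>F h in at_right 0. ?D * P\<^sup>2 * h * (T + h) < 1" by (rule order_tendstoD) simp
    have "((\<lambda>h. P * (M * h)) \<longlongrightarrow> P * (M * 0)) (at_right 0)" by (intro tendsto_intros)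
    then show "\<forall>\<^sub>F h in at_right 0. P * (M * h) < \<rho> \<epsilon>" by (rule order_tendstoD) (use rho_pos[OF \<epsilon>] in simp)
  qed
  then have "\<forall>\<^sub>F h in at_right 0. 0 < h \<and> h * P < 1 / 2 \<and> CARD('n) * (h * P) + ?D * (h * P)\<^sup>2 < 1 / 2 \<and> ?D * P\<^sup>2 * h * (T + h) < 1 \<and> P * (M * h) < \<rho> \<epsilon>"
    using eventually_at_right_less[of 0] by eventually_elim auto
  then obtain h where h: "0 < h" "h * P < 1 / 2" "CARD('n) * (h * P) + ?D * (h * P)\<^sup>2 < 1 / 2" "?D * P\<^sup>2 * h * (T + h) < 1" "P * (M * h) < \<rho> \<epsilon>"
    using eventually_happens'[of "at_right (0::real)"] by auto
  let ?q = "?D * (h * P)\<^sup>2"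
  have step: "emeasure lborel ((\<lambda>x. x + increment \<epsilon> a c x) -` A) \<le> ennreal (exp (2 * ((LINT s:{a<..c}|lborel. m s) + ?q))) * emeasure lborel A"
    if ac: "a \<le> c" "c \<le> a + h" and A: "A \<in> sets borel" for a c A
  proof -
    obtain w' where w': "\<And>x. (increment \<epsilon> a c has_derivative w' x) (at x)" "\<And>x i j. \<bar>w' x (axis j 1) $ i\<bar> \<le> (c - a) * P"
      "\<And>x. - (LINT s:{a<..c}|lborel. m s) \<le> (\<Sum>i\<in>UNIV. w' x (axis i 1) $ i)"
      and lip: "\<And>x x'. norm (increment \<epsilon> a c x - increment \<epsilon> a c x') \<le> (c - a) * P * norm (x - x')"
      using inc[OF ac(1)] by blast
    have cP: "(c - a) * P \<le> h * P" using ac P(1) by (intro mult_right_mono) auto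
    show ?thesis
    proof (rule emeasure_vimage_perturbed_identity[OF w'(1) _ w'(3) _ _ _ _ _ A])
      show "\<bar>w' x (axis j 1) $ i\<bar> \<le> h * P" for x i j using w'(2)[where x=x and i=i and j=j] cP by simp
      show "0 \<le> (LINT s:{a<..c}|lborel. m s)" by (rule m_integral_bounds)
      show "0 \<le> h * P" "h * P \<le> 1" "CARD('n) * (h * P) + ?D * (h * P)\<^sup>2 \<le> 1 / 2" using h P(1) by auto
      show "inj (\<lambda>x. x + increment \<epsilon> a c x)"
      proof (rule injI)
        fix x y assume "x + increment \<epsilon> a c x = y + increment \<epsilon> a c y"
        then have "x - y = increment \<epsilon> a c y - increment \<epsilon> a c x" by (simp add: algebra_simps)
        then have "norm (x - y) \<le> (c - a) * P * norm (x - y)" using lip[of y x] by (simp add: norm_minus_commute)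
        also have "\<dots> \<le> (1 / 2) * norm (x - y)" using cP h(2) by (intro mult_right_mono) auto
        finally show "x = y" by simp
      qed
    qed
  qed
  have comp: "ennreal (exp (2 * u)) * (ennreal (exp (2 * v)) * E) = ennreal (exp (2 * (u + v))) * E" for u v E
    by (simp add: distrib_left exp_add ennreal_mult' mult.assoc)
  have node: "emeasure lborel (node \<epsilon> h k -` A) \<le> ennreal (exp (2 * ((LINT s:{0<..real k * h}|lborel. m s) + real k * ?q))) * emeasure lborel A"
    if "A \<in> sets borel" for k A
    using that
  proof (induction k arbitrary: A)
    case 0
    have "node \<epsilon> h 0 -` A = A" by auto
    then show ?case by (simp add: set_lebesgue_integral_def)
  next
    case (Suc k)
    let ?S = "\<lambda>x. x + increment \<epsilon> (real k * h) (real (Suc k) * h) x"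
    have S: "?S -` A \<in> sets borel" using measurable_sets[of ?S borel borel A] Suc.prems by simp
    have "node \<epsilon> h (Suc k) -` A = node \<epsilon> h k -` (?S -` A)" by auto
    also have "emeasure lborel \<dots> \<le> ennreal (exp (2 * ((LINT s:{0<..real k * h}|lborel. m s) + real k * ?q))) * emeasure lborel (?S -` A)"
      by (rule Suc.IH[OF S])
    also have "\<dots> \<le> ennreal (exp (2 * ((LINT s:{0<..real k * h}|lborel. m s) + real k * ?q))) *
        (ennreal (exp (2 * ((LINT s:{real k * h<..real (Suc k) * h}|lborel. m s) + ?q))) * emeasure lborel A)"
      using h(1) Suc.prems by (intro mult_left_mono step) (auto simp: algebra_simps)
    also have "\<dots> = ennreal (exp (2 * ((LINT s:{0<..real (Suc k) * h}|lborel. m s) + real (Suc k) * ?q))) * emeasure lborel A"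
      unfolding comp using m_integral_split[of 0 "real k * h" "real (Suc k) * h"] h(1) by (simp add: algebra_simps)
    finally show ?case .
  qed
  have push: "emeasure lborel (polygon \<epsilon> h t -` A) \<le> ennreal ?L * emeasure lborel A" if t: "t \<in> {0..T}" and A: "A \<in> sets borel" for t A
  proof -
    obtain k where k: "real k * h \<le> t" "t \<le> real (Suc k) * h"
      "\<And>x. polygon \<epsilon> h t x = node \<epsilon> h k x + increment \<epsilon> (real k * h) t (node \<epsilon> h k x)"
      using polygon_eq[OF \<epsilon> h(1), of t] t by auto
    let ?S = "\<lambda>x. x + increment \<epsilon> (real k * h) t x"
    have S: "?S -` A \<in> sets borel" using measurable_sets[of ?S borel borel A] A by simp
    have "polygon \<epsilon> h t -` A = node \<epsilon> h k -` (?S -` A)" using k(3) by auto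
    also have "emeasure lborel \<dots> \<le> ennreal (exp (2 * ((LINT s:{0<..real k * h}|lborel. m s) + real k * ?q))) * emeasure lborel (?S -` A)"
      by (rule node[OF S])
    also have "\<dots> \<le> ennreal (exp (2 * ((LINT s:{0<..real k * h}|lborel. m s) + real k * ?q))) *
        (ennreal (exp (2 * ((LINT s:{real k * h<..t}|lborel. m s) + ?q))) * emeasure lborel A)"
      using k A by (intro mult_left_mono step) (auto simp: algebra_simps)
    also have "\<dots> = ennreal (exp (2 * ((LINT s:{0<..t}|lborel. m s) + real (Suc k) * ?q))) * emeasure lborel A"
      unfolding comp using m_integral_split[of 0 "real k * h" t] h(1) k by (simp add: algebra_simps)
    also have "\<dots> \<le> ennreal ?L * emeasure lborel A"
    proof (intro mult_right_mono ennreal_leI)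
      \<comment> \<open>There are \<open>k\<close> full steps and one partial step, hence
        \<open>Suc k\<close> quadratic errors; together these steps overshoot \<open>T\<close> by at
        most \<open>h\<close>.\<close>
      have "real (Suc k) * h \<le> T + h" using k t by (simp add: algebra_simps)
      then have "?D * P\<^sup>2 * h * (real (Suc k) * h) \<le> ?D * P\<^sup>2 * h * (T + h)"
        using D h(1) by (intro mult_left_mono) auto
      then have "real (Suc k) * ?q \<le> 1" using h(4) by (simp add: power2_eq_square algebra_simps)
      then show "exp (2 * ((LINT s:{0<..t}|lborel. m s) + real (Suc k) * ?q)) \<le> ?L"
        using m_integral_bounds(2)[of 0 t] by simp
    qed simp
    finally show ?thesis .
  qed
  have tr: "transport ?L (polygon \<epsilon> h) (frozen_field \<epsilon> h)"
    unfolding transport_def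
    using push norm_frozen_field[OF \<epsilon> h(1)] polygon_measurable frozen_field_measurable
    by (auto simp: polygon_def frozen_field_def mollify_b_outside)
  moreover have "defect R (polygon \<epsilon> h) (frozen_field \<epsilon> h) \<le> ennreal (\<rho> \<epsilon>) * (ennreal T * emeasure lborel (cball (0::real^'n) R)
      + ennreal ?L * (mass (R + M * T) + mass (R + M * T + \<epsilon>)))" for R
  proof -
    let ?f = "\<lambda>s x. ennreal (norm (mollify \<epsilon> (b s) x - b s x))"
    \<comment> \<open>The freezing error is the Lipschitz constant times the distance moved since
      the last node. The mollification error is evaluated at the actual position of the polygon, so
      that the push-forward bound turns it into an integral in space.\<close>
    have pt: "ennreal (norm (frozen_field \<epsilon> h s x - b s (polygon \<epsilon> h s x))) \<le> ennreal (\<rho> \<epsilon>) * indicator {0..T} s + ?f s (polygon \<epsilon> h s x)" for s x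
    proof (cases "s \<in> {0..T}")
      case True
      then obtain k where k: "real k * h \<le> s" "s \<le> real (Suc k) * h" "k = nat \<lfloor>s / h\<rfloor>"
        "polygon \<epsilon> h s x = node \<epsilon> h k x + increment \<epsilon> (real k * h) s (node \<epsilon> h k x)"
        using polygon_eq[OF \<epsilon> h(1), of s] by auto
      have "norm (frozen_field \<epsilon> h s x - mollify \<epsilon> (b s) (polygon \<epsilon> h s x)) \<le> P * norm (node \<epsilon> h k x - polygon \<epsilon> h s x)"
        unfolding frozen_field_def k(3)[symmetric] by (rule P(2))
      also have "\<dots> \<le> P * (M * (s - real k * h))"
        using P(1) norm_increment_le[OF \<epsilon> k(1), of "node \<epsilon> h k x"] unfolding k(4) by (intro mult_left_mono) auto
      also have "\<dots> \<le> P * (M * h)" using k P(1) M_nonneg by (intro mult_left_mono) (auto simp: algebra_simps)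
      also have "\<dots> \<le> \<rho> \<epsilon>" using h by simp
      finally have "norm (frozen_field \<epsilon> h s x - b s (polygon \<epsilon> h s x)) \<le> \<rho> \<epsilon> + norm (mollify \<epsilon> (b s) (polygon \<epsilon> h s x) - b s (polygon \<epsilon> h s x))"
        using norm_triangle_ineq[of "frozen_field \<epsilon> h s x - mollify \<epsilon> (b s) (polygon \<epsilon> h s x)" "mollify \<epsilon> (b s) (polygon \<epsilon> h s x) - b s (polygon \<epsilon> h s x)"]
        by simp
      then have "ennreal (norm (frozen_field \<epsilon> h s x - b s (polygon \<epsilon> h s x))) \<le> ennreal (\<rho> \<epsilon> + norm (mollify \<epsilon> (b s) (polygon \<epsilon> h s x) - b s (polygon \<epsilon> h s x)))"
        by (rule ennreal_leI)
      then show ?thesis using True rho_nonneg[of \<epsilon>] \<epsilon> by simp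
    qed (simp add: frozen_field_def mollify_b_outside b_outside)
    have "defect R (polygon \<epsilon> h) (frozen_field \<epsilon> h)
      \<le> (\<integral>\<^sup>+ x\<in>cball 0 R. (\<integral>\<^sup>+ s. ennreal (\<rho> \<epsilon>) * indicator {0..T} s + ?f s (polygon \<epsilon> h s x) \<partial>lborel) \<partial>lborel)"
      unfolding defect_def by (intro nn_integral_mono mult_right_mono pt) simp
    also have "\<dots> = (\<integral>\<^sup>+ x. ennreal (\<rho> \<epsilon>) * ennreal T * indicator (cball 0 R) x
        + (\<integral>\<^sup>+ s. ?f s (polygon \<epsilon> h s x) \<partial>lborel) * indicator (cball 0 R) x \<partial>lborel)"
      using T_pos by (intro nn_integral_cong) (subst nn_integral_add, auto simp: nn_integral_cmult distrib_right)
    also have "\<dots> = ennreal (\<rho> \<epsilon>) * ennreal T * emeasure lborel (cball (0::real^'n) R)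
        + (\<integral>\<^sup>+ x\<in>cball 0 R. (\<integral>\<^sup>+ s. ?f s (polygon \<epsilon> h s x) \<partial>lborel) \<partial>lborel)"
      by (subst nn_integral_add) (auto simp: nn_integral_cmult)
    also have "\<dots> \<le> ennreal (\<rho> \<epsilon>) * ennreal T * emeasure lborel (cball (0::real^'n) R)
        + ennreal ?L * (ennreal (\<rho> \<epsilon>) * (mass (R + M * T) + mass (R + M * T + \<epsilon>)))"
    proof (rule add_left_mono)
      have "(\<integral>\<^sup>+ x\<in>cball 0 R. (\<integral>\<^sup>+ s. ?f s (polygon \<epsilon> h s x) \<partial>lborel) \<partial>lborel)
        \<le> ennreal ?L * (\<integral>\<^sup>+ s. (\<integral>\<^sup>+ x\<in>cball 0 (R + M * T). ?f s x \<partial>lborel) \<partial>lborel)"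
        by (rule spread_space_time[OF transport_spread[OF tr]]) (measurable, simp add: mollify_b_outside b_outside)
      also have "\<dots> \<le> ennreal ?L * (ennreal (\<rho> \<epsilon>) * (mass (R + M * T) + mass (R + M * T + \<epsilon>)))"
        by (intro mult_left_mono mollify_b_error \<epsilon>) simp
      finally show "(\<integral>\<^sup>+ x\<in>cball 0 R. (\<integral>\<^sup>+ s. ?f s (polygon \<epsilon> h s x) \<partial>lborel) \<partial>lborel)
        \<le> ennreal ?L * (ennreal (\<rho> \<epsilon>) * (mass (R + M * T) + mass (R + M * T + \<epsilon>)))" .
    qed
    finally show ?thesis by (simp add: distrib_left mult.assoc mult.left_commute)
  qed
  ultimately show ?thesis by blast
qed

end

section \<open>Passage to the limit\<close>

lemma AE_cball_extend:
  assumes "\<And>R::nat. AE x in lborel. x \<in> cball (0::'a::euclidean_space) (real R) \<longrightarrow> P x"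
  shows "AE x in lborel. P x"
proof -
  have "AE x in lborel. \<forall>R::nat. x \<in> cball (0::'a) (real R) \<longrightarrow> P x"
    unfolding AE_all_countable by (intro allI assms)
  then show ?thesis
  proof eventually_elim
    case (elim x)
    obtain R :: nat where "norm x \<le> real R" using real_arch_simple by blast
    then have "x \<in> cball 0 (real R)" by simp
    then show ?case using elim by blast
  qed
qed

lemma geometric_cauchy:
  fixes u :: "nat \<Rightarrow> 'b::banach"
  assumes "\<And>j. J \<le> j \<Longrightarrow> norm (u j - u (Suc j)) \<le> (1 / 2) ^ j"
  shows "convergent u" and "J \<le> j \<Longrightarrow> norm (u j - lim u) \<le> 2 * (1 / 2) ^ j"
proof -
  \<comment> \<open>Subtracting the remaining geometric tail is what lets the induction
    close.\<close>
  have tele: "norm (u j - u (j + p)) \<le> 2 * (1 / 2) ^ j - 2 * (1 / 2) ^ (j + p)" if j: "J \<le> j" for j p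
  proof (induction p)
    case (Suc p)
    have "norm (u j - u (j + Suc p)) \<le> norm (u j - u (j + p)) + norm (u (j + p) - u (Suc (j + p)))"
      using norm_triangle_ineq[of "u j - u (j + p)" "u (j + p) - u (Suc (j + p))"] by simp
    then show ?case using Suc assms[of "j + p"] j by simp
  qed simp
  have le: "norm (u j - u n) \<le> 2 * (1 / 2) ^ j" if "J \<le> j" "j \<le> n" for j n
  proof -
    have "norm (u j - u n) \<le> 2 * (1 / 2) ^ j - 2 * (1 / 2) ^ n" using tele[OF that(1), of "n - j"] that(2) by simp
    moreover have "0 \<le> (1 / 2 :: real) ^ n" by simp
    ultimately show ?thesis by linarith
  qed
  have "Cauchy u"
  proof (rule metric_CauchyI)
    fix e :: real assume e: "0 < e"
    have "(\<lambda>j. 4 * (1 / 2 :: real) ^ j) \<longlonglongrightarrow> 4 * 0" by (intro tendsto_intros LIMSEQ_power_zero) auto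
    then have "\<forall>\<^sub>F j in sequentially. 4 * (1 / 2) ^ j < e" by (rule order_tendstoD) (use e in simp)
    then have "\<forall>\<^sub>F j in sequentially. J \<le> j \<and> 4 * (1 / 2) ^ j < e"
      using eventually_ge_at_top[of J] by eventually_elim simp
    then obtain K where K: "J \<le> K" "4 * (1 / 2) ^ K < e"
      using eventually_happens'[OF sequentially_bot] by blast
    show "\<exists>K. \<forall>m\<ge>K. \<forall>n\<ge>K. dist (u m) (u n) < e"
    proof (intro exI allI impI)
      fix m n assume "K \<le> m" "K \<le> n"
      then show "dist (u m) (u n) < e"
        using le[OF K(1), of m] le[OF K(1), of n] K(2) norm_triangle_ineq[of "u m - u K" "u K - u n"]
        by (simp add: dist_norm norm_minus_commute)
    qed
  qed
  then show c: "convergent u" by (rule Cauchy_convergent)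
  then have lim: "u \<longlonglongrightarrow> lim u" by (simp add: convergent_LIMSEQ_iff)
  show "norm (u j - lim u) \<le> 2 * (1 / 2) ^ j" if "J \<le> j"
  proof (rule LIMSEQ_le_const2)
    show "(\<lambda>n. norm (u j - u n)) \<longlonglongrightarrow> norm (u j - lim u)" by (intro tendsto_intros lim)
    show "\<exists>N. \<forall>n\<ge>N. norm (u j - u n) \<le> 2 * (1 / 2) ^ j" using le[OF that] by blast
  qed
qed

text \<open>For open sets the indicator is lower semicontinuous along the convergence, so Fatou's
  lemma gives the bound. Outer regularity carries it over to Borel sets; the excess
  \<open>e / L\<close> becomes \<open>e\<close> after multiplication with \<open>L\<close>.\<close>

lemma pushforward_limit:
  fixes Z :: "'a::euclidean_space \<Rightarrow> 'a"
  assumes m: "\<And>n. Y n \<in> borel_measurable borel" "Z \<in> borel_measurable borel"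
    and lim: "AE x in lborel. (\<lambda>n. Y n x) \<longlonglongrightarrow> Z x" and L: "0 < L"
    and le: "\<And>n A. A \<in> sets borel \<Longrightarrow> emeasure lborel (Y n -` A) \<le> ennreal L * emeasure lborel A"
    and A: "A \<in> sets borel"
  shows "emeasure lborel (Z -` A) \<le> ennreal L * emeasure lborel A"
proof -
  have vm: "f -` B \<in> sets lborel" if "f \<in> borel_measurable borel" "B \<in> sets borel" for f :: "'a \<Rightarrow> 'a" and B
    using measurable_sets[OF that] by simp
  have op: "emeasure lborel (Z -` U) \<le> ennreal L * emeasure lborel U" if U: "open U" for U
  proof -
    have "emeasure lborel (Z -` U) = (\<integral>\<^sup>+ x. indicator (Z -` U) x \<partial>lborel)"
      using vm[OF m(2)] U by simp
    also have "\<dots> \<le> (\<integral>\<^sup>+ x. liminf (\<lambda>n. indicator (Y n -` U) x) \<partial>lborel)"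
    proof (rule nn_integral_mono_AE, use lim in eventually_elim)
      case (elim x)
      show "indicator (Z -` U) x \<le> liminf (\<lambda>n. indicator (Y n -` U) x :: ennreal)"
      proof (cases "Z x \<in> U")
        case True
        have "\<forall>\<^sub>F n in sequentially. Y n x \<in> U" using topological_tendstoD[OF elim U True] .
        then have "\<forall>\<^sub>F n in sequentially. (1::ennreal) \<le> indicator (Y n -` U) x" by eventually_elim simp
        from Liminf_bounded[OF this] show ?thesis using True by simp
      qed simp
    qed
    also have "\<dots> \<le> liminf (\<lambda>n. \<integral>\<^sup>+ x. indicator (Y n -` U) x \<partial>lborel)"
      using vm[OF m(1)] U by (intro nn_integral_liminf) auto
    also have "\<dots> \<le> liminf (\<lambda>n. ennreal L * emeasure lborel U)"
      using vm[OF m(1)] U le by (intro Liminf_mono always_eventually) auto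
    also have "\<dots> = ennreal L * emeasure lborel U" by (simp add: Liminf_const)
    finally show ?thesis .
  qed
  show ?thesis
  proof (rule ennreal_le_epsilon)
    fix e :: real assume e: "0 < e"
    obtain U where U: "open U" "A \<subseteq> U" "emeasure lborel (U - A) < ennreal (e / L)"
      using outer_regular_lborel[OF A, of "e / L"] e L by auto
    have "emeasure lborel (Z -` A) \<le> emeasure lborel (Z -` U)"
      using U vm[OF m(2)] by (intro emeasure_mono) auto
    also have "\<dots> \<le> ennreal L * emeasure lborel U" by (rule op[OF U(1)])
    also have "emeasure lborel U \<le> emeasure lborel A + emeasure lborel (U - A)"
    proof -
      have "U = A \<union> (U - A)" using U(2) by auto
      then show ?thesis using emeasure_subadditive[of A lborel "U - A"] A U(1) by (metis borel_open sets.Diff sets_lborel)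
    qed
    also have "\<dots> \<le> emeasure lborel A + ennreal (e / L)" using U(3) by (intro add_left_mono) auto
    also have "ennreal L * (emeasure lborel A + ennreal (e / L)) = ennreal L * emeasure lborel A + ennreal e"
      using L by (simp add: distrib_left flip: ennreal_mult')
    finally show "emeasure lborel (Z -` A) \<le> ennreal L * emeasure lborel A + ennreal e"
      by (simp add: mult_left_mono)
  qed
qed


text \<open>Fatou's lemma yields only a finite lower limit at almost every point, hence a bound
  along infinitely many indices that depend on the point. This is enough to identify a limit that is
  already known to exist.\<close>

lemma finite_liminf_frequently:
  fixes f :: "nat \<Rightarrow> ennreal"
  assumes "liminf f \<noteq> \<infinity>"
  shows "\<exists>C. 0 \<le> C \<and> (\<exists>\<^sub>F n in sequentially. f n \<le> ennreal C)"
proof -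
  obtain c where c: "0 \<le> c" "liminf f = ennreal c" using assms by (cases "liminf f") auto
  have "\<exists>\<^sub>F n in sequentially. f n \<le> ennreal (c + 1)"
  proof (rule ccontr)
    assume "\<not> ?thesis"
    then have "\<forall>\<^sub>F n in sequentially. ennreal (c + 1) \<le> f n"
      by (auto simp: not_frequently elim!: eventually_mono)
    from Liminf_bounded[OF this] show False using c by (simp add: ennreal_le_iff)
  qed
  then show ?thesis using c by (intro exI[of _ "c + 1"]) auto
qed

section \<open>Convergence of transports with vanishing defect\<close>

context osgood_field
begin

text \<open>The order of choices matters: \<delta> is fixed first, so that the potential at \<eta>
  beats \<open>(1 + K) / \<eta>\<close>, and only then are the indices taken so large that the
  defects are below \<open>\<delta> / 2\<close>. The 1 in \<open>1 + K\<close> is the resulting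
  bound for the two defects divided by \<delta>.\<close>

lemma transport_cauchy:
  assumes tr: "\<And>n. transport L (X n) (\<beta> n)" and d: "\<And>R. (\<lambda>n. defect R (X n) (\<beta> n)) \<longlonglongrightarrow> 0"
    and \<eta>: "0 < \<eta>"
  shows "\<exists>N. \<forall>n\<ge>N. \<forall>k\<ge>N. \<exists>A\<in>sets borel. emeasure lborel A \<le> ennreal \<eta> \<and>
    (AE x in lborel. x \<in> cball 0 R \<longrightarrow> x \<notin> A \<longrightarrow> (\<forall>t\<in>{0..T}. norm (X n t x - X k t x) \<le> \<eta>))"
proof -
  let ?K = "2 * (ennreal L * mass (R + M * T))"
  have "?K < top" using mass_finite[of "R + M * T"] by (simp add: ennreal_mult_less_top)
  then obtain K where K: "0 \<le> K" "?K = ennreal K" by (metis ennreal_cases less_irrefl)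
  obtain \<delta> where \<delta>: "0 < \<delta>" "(1 + K) / \<eta> \<le> potential \<delta> \<eta>"
    using potential_unbounded[OF \<eta>] by blast
  have pos: "0 < (1 + K) / \<eta>" using K(1) \<eta> by simp
  have pK: "1 / potential \<delta> \<eta> * (1 + K) \<le> \<eta>"
  proof -
    have "1 + K \<le> potential \<delta> \<eta> * \<eta>" using \<delta>(2) \<eta> by (simp add: field_simps)
    moreover have "0 < potential \<delta> \<eta>" using pos \<delta>(2) by linarith
    ultimately show ?thesis by (simp add: field_simps)
  qed
  have "\<forall>\<^sub>F n in sequentially. defect R (X n) (\<beta> n) < ennreal (\<delta> / 2)"
    by (rule order_tendstoD(2)[OF d]) (use \<delta>(1) in simp)
  then obtain N where N: "\<And>n. n \<ge> N \<Longrightarrow> defect R (X n) (\<beta> n) < ennreal (\<delta> / 2)"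
    by (auto simp: eventually_sequentially)
  show ?thesis
  proof (intro exI[of _ N] allI impI)
    fix n k assume nk: "N \<le> n" "N \<le> k"
    obtain A where A: "A \<in> sets borel" "emeasure lborel A \<le> ennreal (1 / potential \<delta> \<eta>) *
        (ennreal (1 / \<delta>) * (defect R (X n) (\<beta> n) + defect R (X k) (\<beta> k)) + ?K)"
      "AE x in lborel. x \<in> cball 0 R \<longrightarrow> x \<notin> A \<longrightarrow> (\<forall>t\<in>{0..T}. norm (X n t x - X k t x) \<le> \<eta>)"
      using transport_deviation[OF tr tr \<delta>(1) \<eta>] by blast
    have "ennreal (1 / \<delta>) * (defect R (X n) (\<beta> n) + defect R (X k) (\<beta> k)) \<le> ennreal (1 / \<delta>) * (ennreal (\<delta> / 2) + ennreal (\<delta> / 2))"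
      using N[OF nk(1)] N[OF nk(2)] by (intro mult_left_mono add_mono) auto
    also have "\<dots> = 1" using \<delta>(1) by (simp flip: ennreal_plus ennreal_mult')
    finally have 1: "ennreal (1 / \<delta>) * (defect R (X n) (\<beta> n) + defect R (X k) (\<beta> k)) \<le> 1" .
    have p: "0 \<le> 1 / potential \<delta> \<eta>" using pos \<delta>(2) by simp
    note A(2)
    also have "ennreal (1 / potential \<delta> \<eta>) * (ennreal (1 / \<delta>) * (defect R (X n) (\<beta> n) + defect R (X k) (\<beta> k)) + ?K)
        \<le> ennreal (1 / potential \<delta> \<eta>) * (1 + ennreal K)"
      using 1 unfolding K(2) by (intro mult_left_mono add_right_mono) auto
    also have "\<dots> = ennreal (1 / potential \<delta> \<eta> * (1 + K))"
      unfolding ennreal_mult'[OF p] using K(1) by simp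
    also have "\<dots> \<le> ennreal \<eta>" by (rule ennreal_leI[OF pK])
    finally show "\<exists>A\<in>sets borel. emeasure lborel A \<le> ennreal \<eta> \<and>
      (AE x in lborel. x \<in> cball 0 R \<longrightarrow> x \<notin> A \<longrightarrow> (\<forall>t\<in>{0..T}. norm (X n t x - X k t x) \<le> \<eta>))"
      using A(1,3) by blast
  qed
qed

text \<open>Markov's inequality at level \<eta>: an integral bound by the square of \<eta> is split
  evenly between the measure of the bad set and the bound outside it.\<close>

lemma transport_small_defect:
  assumes tr: "transport L X \<beta>" and d: "defect R X \<beta> \<le> ennreal (\<eta> * \<eta>)" and \<eta>: "0 < \<eta>"
  shows "\<exists>A\<in>sets borel. emeasure lborel A \<le> ennreal \<eta> \<and>
    (\<forall>x. x \<in> cball 0 R \<longrightarrow> x \<notin> A \<longrightarrow> (\<integral>\<^sup>+ s. ennreal (norm (\<beta> s x - b s (X s x))) \<partial>lborel) \<le> ennreal \<eta>)"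
proof -
  note [measurable] = transportD(2,3)[OF tr]
  define F where "F x = (\<integral>\<^sup>+ s. ennreal (norm (\<beta> s x - b s (X s x))) \<partial>lborel)" for x
  have [measurable]: "F \<in> borel_measurable borel" unfolding F_def by measurable
  define A where "A = {x \<in> cball 0 R. 1 \<le> ennreal (1 / \<eta>) * F x}"
  have "emeasure lborel A \<le> ennreal (1 / \<eta>) * (\<integral>\<^sup>+ x\<in>cball 0 R. F x \<partial>lborel)"
    unfolding A_def by (rule nn_integral_Markov_inequality) auto
  also have "\<dots> \<le> ennreal (1 / \<eta>) * ennreal (\<eta> * \<eta>)"
    using d unfolding defect_def F_def by (intro mult_left_mono) auto
  also have "\<dots> = ennreal \<eta>" using \<eta> by (simp flip: ennreal_mult')
  finally have "emeasure lborel A \<le> ennreal \<eta>" .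
  moreover have "A \<in> sets borel" unfolding A_def by measurable
  moreover have "F x \<le> ennreal \<eta>" if "x \<in> cball 0 R" "x \<notin> A" for x
  proof -
    have "ennreal (1 / \<eta>) * F x < 1" using that by (simp add: A_def not_le)
    then have "ennreal \<eta> * (ennreal (1 / \<eta>) * F x) \<le> ennreal \<eta> * 1" by (intro mult_left_mono) auto
    moreover have "ennreal \<eta> * (ennreal (1 / \<eta>) * F x) = F x"
      using \<eta> by (simp add: mult.assoc[symmetric] flip: ennreal_mult')
    ultimately show ?thesis by simp
  qed
  ultimately show ?thesis unfolding F_def by blast
qed

text \<open>Borel-Cantelli with bad sets of geometrically small measure. The balls grow with
  \<open>j\<close>, so every point eventually lies in them; uniformity in time is inherited from the
  deviation estimate.\<close>

lemma transport_subsequence: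
  assumes tr: "\<And>n. transport L (X n) (\<beta> n)" and d: "\<And>R. (\<lambda>n. defect R (X n) (\<beta> n)) \<longlonglongrightarrow> 0"
  shows "\<exists>r. AE x in lborel. \<forall>\<^sub>F j in sequentially.
    (\<forall>t\<in>{0..T}. norm (X (r j) t x - X (r (Suc j)) t x) \<le> (1 / 2) ^ j) \<and>
    (\<integral>\<^sup>+ s. ennreal (norm (\<beta> (r j) s x - b s (X (r j) s x))) \<partial>lborel) \<le> ennreal ((1 / 2) ^ j)"
proof -
  define Q where "Q j N \<longleftrightarrow> (\<forall>n\<ge>N. \<forall>k\<ge>N. \<exists>A\<in>sets borel. emeasure lborel A \<le> ennreal ((1 / 2) ^ j) \<and>
    (AE x in lborel. x \<in> cball 0 (real j) \<longrightarrow> x \<notin> A \<longrightarrow> (\<forall>t\<in>{0..T}. norm (X n t x - X k t x) \<le> (1 / 2) ^ j)))" for j N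
  define S where "S j N \<longleftrightarrow> (\<forall>n\<ge>N. defect (real j) (X n) (\<beta> n) \<le> ennreal ((1 / 2) ^ j * (1 / 2) ^ j))" for j N
  have "\<exists>N. Q j N \<and> S j N" for j
  proof -
    have "\<exists>N. Q j N" unfolding Q_def by (rule transport_cauchy[OF tr d]) simp
    then obtain N1 where N1: "Q j N1" by blast
    have "\<forall>\<^sub>F n in sequentially. defect (real j) (X n) (\<beta> n) < ennreal ((1 / 2) ^ j * (1 / 2) ^ j)"
      by (rule order_tendstoD(2)[OF d]) simp
    then obtain N2 where "S j N2" unfolding S_def eventually_sequentially by (auto intro: less_imp_le)
    then have "Q j (max N1 N2) \<and> S j (max N1 N2)" using N1 unfolding Q_def S_def by simp
    then show ?thesis by blast
  qed
  then obtain N where N: "\<And>j. Q j (N j)" "\<And>j. S j (N j)" by metis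
  \<comment> \<open>Partial sums put both \<open>r j\<close> and \<open>r (Suc j)\<close> beyond the
    threshold \<open>N j\<close>, as the comparison of consecutive members requires.\<close>
  define r where "r j = (\<Sum>i\<le>j. N i)" for j
  have r: "N j \<le> r j" "N j \<le> r (Suc j)" for j unfolding r_def by (auto intro: member_le_sum trans_le_add1)
  have "\<exists>A. A \<in> sets borel \<and> emeasure lborel A \<le> ennreal ((1 / 2) ^ j + (1 / 2) ^ j) \<and>
    (AE x in lborel. x \<in> cball 0 (real j) \<longrightarrow> x \<notin> A \<longrightarrow> (\<forall>t\<in>{0..T}. norm (X (r j) t x - X (r (Suc j)) t x) \<le> (1 / 2) ^ j) \<and>
      (\<integral>\<^sup>+ s. ennreal (norm (\<beta> (r j) s x - b s (X (r j) s x))) \<partial>lborel) \<le> ennreal ((1 / 2) ^ j))" for j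
  proof -
    obtain A where A: "A \<in> sets borel" "emeasure lborel A \<le> ennreal ((1 / 2) ^ j)"
      "AE x in lborel. x \<in> cball 0 (real j) \<longrightarrow> x \<notin> A \<longrightarrow> (\<forall>t\<in>{0..T}. norm (X (r j) t x - X (r (Suc j)) t x) \<le> (1 / 2) ^ j)"
      using N(1)[of j] r[of j] unfolding Q_def by blast
    have "defect (real j) (X (r j)) (\<beta> (r j)) \<le> ennreal ((1 / 2) ^ j * (1 / 2) ^ j)" using N(2)[of j] r[of j] unfolding S_def by blast
    from transport_small_defect[OF tr this] obtain B where B: "B \<in> sets borel" "emeasure lborel B \<le> ennreal ((1 / 2) ^ j)"
      "\<And>x. x \<in> cball 0 (real j) \<Longrightarrow> x \<notin> B \<Longrightarrow> (\<integral>\<^sup>+ s. ennreal (norm (\<beta> (r j) s x - b s (X (r j) s x))) \<partial>lborel) \<le> ennreal ((1 / 2) ^ j)"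
      by auto
    have "emeasure lborel (A \<union> B) \<le> emeasure lborel A + emeasure lborel B" using A(1) B(1) by (intro emeasure_subadditive) auto
    also have "\<dots> \<le> ennreal ((1 / 2) ^ j) + ennreal ((1 / 2) ^ j)" by (intro add_mono A B)
    also have "\<dots> = ennreal ((1 / 2) ^ j + (1 / 2) ^ j)" by (rule ennreal_plus[symmetric]) auto
    finally have "emeasure lborel (A \<union> B) \<le> ennreal ((1 / 2) ^ j + (1 / 2) ^ j)" .
    moreover have "AE x in lborel. x \<in> cball 0 (real j) \<longrightarrow> x \<notin> A \<union> B \<longrightarrow> (\<forall>t\<in>{0..T}. norm (X (r j) t x - X (r (Suc j)) t x) \<le> (1 / 2) ^ j) \<and>
      (\<integral>\<^sup>+ s. ennreal (norm (\<beta> (r j) s x - b s (X (r j) s x))) \<partial>lborel) \<le> ennreal ((1 / 2) ^ j)"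
      using A(3) by eventually_elim (use B(3) in blast)
    ultimately show ?thesis using A(1) B(1) by blast
  qed
  then have "\<forall>j. \<exists>A. A \<in> sets borel \<and> emeasure lborel A \<le> ennreal ((1 / 2) ^ j + (1 / 2) ^ j) \<and>
    (AE x in lborel. x \<in> cball 0 (real j) \<longrightarrow> x \<notin> A \<longrightarrow> (\<forall>t\<in>{0..T}. norm (X (r j) t x - X (r (Suc j)) t x) \<le> (1 / 2) ^ j) \<and>
      (\<integral>\<^sup>+ s. ennreal (norm (\<beta> (r j) s x - b s (X (r j) s x))) \<partial>lborel) \<le> ennreal ((1 / 2) ^ j))"
    by (rule allI)
  from choice[OF this] obtain A where A: "\<And>j. A j \<in> sets borel" "\<And>j. emeasure lborel (A j) \<le> ennreal ((1 / 2) ^ j + (1 / 2) ^ j)"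
    and good: "\<And>j. AE x in lborel. x \<in> cball 0 (real j) \<longrightarrow> x \<notin> A j \<longrightarrow> (\<forall>t\<in>{0..T}. norm (X (r j) t x - X (r (Suc j)) t x) \<le> (1 / 2) ^ j) \<and>
      (\<integral>\<^sup>+ s. ennreal (norm (\<beta> (r j) s x - b s (X (r j) s x))) \<partial>lborel) \<le> ennreal ((1 / 2) ^ j)"
    by blast
  have "AE x in lborel. \<forall>\<^sub>F j in sequentially. x \<in> space lborel - A j"
  proof (rule borel_cantelli_AE1)
    show "A j \<in> sets lborel" for j using A(1) by simp
    show fin: "emeasure lborel (A j) < \<infinity>" for j using A(2)[of j] by (simp add: le_less_trans)
    have "summable (\<lambda>j. (1 / 2) ^ j + (1 / 2 :: real) ^ j)" by (intro summable_add summable_geometric) auto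
    then show "summable (\<lambda>j. measure lborel (A j))"
    proof (rule summable_comparison_test'[where N=0])
      show "norm (measure lborel (A j)) \<le> (1 / 2) ^ j + (1 / 2) ^ j" for j
        using A(2)[of j] fin[of j] by (simp add: emeasure_eq_ennreal_measure)
    qed
  qed
  moreover have "AE x in lborel. \<forall>j. x \<in> cball 0 (real j) \<longrightarrow> x \<notin> A j \<longrightarrow> (\<forall>t\<in>{0..T}. norm (X (r j) t x - X (r (Suc j)) t x) \<le> (1 / 2) ^ j) \<and>
      (\<integral>\<^sup>+ s. ennreal (norm (\<beta> (r j) s x - b s (X (r j) s x))) \<partial>lborel) \<le> ennreal ((1 / 2) ^ j)"
    unfolding AE_all_countable by (intro allI good)
  ultimately have "AE x in lborel. \<forall>\<^sub>F j in sequentially.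
    (\<forall>t\<in>{0..T}. norm (X (r j) t x - X (r (Suc j)) t x) \<le> (1 / 2) ^ j) \<and>
    (\<integral>\<^sup>+ s. ennreal (norm (\<beta> (r j) s x - b s (X (r j) s x))) \<partial>lborel) \<le> ennreal ((1 / 2) ^ j)"
  proof eventually_elim
    case (elim x)
    note good = elim(2)
    obtain n :: nat where n: "norm x \<le> real n" using real_arch_simple by blast
    show ?case using elim(1) eventually_ge_at_top[of n]
    proof eventually_elim
      case (elim j)
      then have "x \<in> cball 0 (real j)" using n by simp
      then show ?case using good elim by blast
    qed
  qed
  then show ?thesis by blast
qed

text \<open>Convergence of positions says nothing about \<open>b\<close> along them without (H): the
  difference of \<open>b\<close> at \<open>X j s x\<close> and at \<open>Y s x\<close> is at most
  the modulus of a geometrically small distance times \<open>g\<close> at both positions. The time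
  integral of \<open>g\<close> along \<open>X j\<close> is not known to be bounded in
  \<open>j\<close> for a given starting point, but its lower limit is finite for almost every one,
  and this suffices.\<close>

lemma transport_limit:
  assumes tr0: "\<And>n. transport L (X0 n) (\<beta>0 n)" and d0: "\<And>R. (\<lambda>n. defect R (X0 n) (\<beta>0 n)) \<longlonglongrightarrow> 0"
  shows "\<exists>Y. transport L Y (\<lambda>s x. b s (Y s x))"
proof -
  obtain r where r: "AE x in lborel. \<forall>\<^sub>F j in sequentially.
    (\<forall>t\<in>{0..T}. norm (X0 (r j) t x - X0 (r (Suc j)) t x) \<le> (1 / 2) ^ j) \<and>
    (\<integral>\<^sup>+ s. ennreal (norm (\<beta>0 (r j) s x - b s (X0 (r j) s x))) \<partial>lborel) \<le> ennreal ((1 / 2) ^ j)"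
    using transport_subsequence[OF tr0 d0] by blast
  define X where "X j = X0 (r j)" for j
  define \<beta> where "\<beta> j = \<beta>0 (r j)" for j
  have tr: "transport L (X j) (\<beta> j)" for j unfolding X_def \<beta>_def by (rule tr0)
  note sp = transport_spread[OF tr]
  \<comment> \<open>\<open>lim\<close> gives a total function, measurable without regard to where
    the sequence converges; its values at divergent points do not matter.\<close>
  define Y where "Y t x = lim (\<lambda>j. X j t x)" for t x
  note [measurable] = transportD(2,3)[OF tr]
  have Ym[measurable]: "case_prod Y \<in> borel_measurable (borel \<Otimes>\<^sub>M borel)"
    unfolding Y_def case_prod_beta by measurable
  have conv: "AE x in lborel. \<forall>\<^sub>F j in sequentially. (\<forall>t\<in>{0..T}. norm (X j t x - Y t x) \<le> 2 * (1 / 2) ^ j) \<and>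
    (\<integral>\<^sup>+ s. ennreal (norm (\<beta> j s x - b s (X j s x))) \<partial>lborel) \<le> ennreal ((1 / 2) ^ j)"
    using r
  proof eventually_elim
    case (elim x)
    then obtain J where J: "\<And>j. J \<le> j \<Longrightarrow> (\<forall>t\<in>{0..T}. norm (X j t x - X (Suc j) t x) \<le> (1 / 2) ^ j) \<and>
      (\<integral>\<^sup>+ s. ennreal (norm (\<beta> j s x - b s (X j s x))) \<partial>lborel) \<le> ennreal ((1 / 2) ^ j)"
      unfolding X_def[symmetric] \<beta>_def[symmetric] eventually_sequentially by blast
    show ?case using eventually_ge_at_top[of J]
    proof eventually_elim
      case (elim j)
      have "norm (X j t x - Y t x) \<le> 2 * (1 / 2) ^ j" if "t \<in> {0..T}" for t
        unfolding Y_def using geometric_cauchy(2)[of J "\<lambda>j. X j t x" j] J that elim by blast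
      then show ?case using J[OF elim] by blast
    qed
  qed
  have geo: "(\<lambda>j. 2 * (1 / 2 :: real) ^ j) \<longlonglongrightarrow> 0"
  proof -
    have "(\<lambda>j. 2 * (1 / 2 :: real) ^ j) \<longlonglongrightarrow> 2 * 0" by (intro tendsto_intros LIMSEQ_power_zero) auto
    then show ?thesis by simp
  qed
  have lim: "AE x in lborel. \<forall>t\<in>{0..T}. (\<lambda>j. X j t x) \<longlonglongrightarrow> Y t x"
    using conv
  proof eventually_elim
    case (elim x)
    show ?case
    proof
      fix t assume t: "t \<in> {0..T}"
      have "(\<lambda>j. X j t x - Y t x) \<longlonglongrightarrow> 0"
        by (rule Lim_null_comparison[OF _ geo]) (use elim t in \<open>auto elim: eventually_mono\<close>)
      then show "(\<lambda>j. X j t x) \<longlonglongrightarrow> Y t x" by (rule LIM_zero_cancel)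
    qed
  qed
  have disp: "AE x in lborel. \<forall>t\<in>{0..T}. norm (Y t x) \<le> norm x + M * T"
  proof -
    have "AE x in lborel. \<forall>j. \<forall>t\<in>{0..T}. norm (X j t x) \<le> norm x + M * T"
      unfolding AE_all_countable using spreadD(3)[OF sp] by blast
    with lim show ?thesis
    proof eventually_elim
      case (elim x)
      then show ?case by (auto intro!: LIMSEQ_le_const2[OF tendsto_norm])
    qed
  qed
  have push: "emeasure lborel (Y t -` A) \<le> ennreal L * emeasure lborel A" if t: "t \<in> {0..T}" and A: "A \<in> sets borel" for t A
  proof (rule pushforward_limit[where Y="\<lambda>j. X j t"])
    show "X j t \<in> borel_measurable borel" for j by (rule spread_slice[OF sp])
    show "Y t \<in> borel_measurable borel" by measurable
    show "AE x in lborel. (\<lambda>j. X j t x) \<longlonglongrightarrow> Y t x" using lim by eventually_elim (use t in blast)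
    show "emeasure lborel (X j t -` B) \<le> ennreal L * emeasure lborel B" if "B \<in> sets borel" for j B
      by (rule spreadD(4)[OF sp t that])
  qed (use transportD(1)[OF tr] A in auto)
  \<comment> \<open>The push-forward bound for the limit comes before its equation: it is needed for
    applying (H) between \<open>X j\<close> and \<open>Y\<close>.\<close>
  have spY: "spread L Y" unfolding spread_def using transportD(1)[OF tr] Ym disp push by blast
  define \<Gamma> where "\<Gamma> j x = (\<integral>\<^sup>+ s. ennreal (g s (X j s x)) \<partial>lborel)" for j x
  define \<Gamma>Y where "\<Gamma>Y x = (\<integral>\<^sup>+ s. ennreal (g s (Y s x)) \<partial>lborel)" for x
  have [measurable]: "\<Gamma> j \<in> borel_measurable borel" "\<Gamma>Y \<in> borel_measurable borel" for j
    unfolding \<Gamma>_def \<Gamma>Y_def by measurable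
  have mass_fin: "ennreal L * mass (R + M * T) \<noteq> \<infinity>" for R
    using mass_finite[of "R + M * T"] by (simp add: ennreal_mult_less_top less_top[symmetric] ennreal_mult_eq_top_iff)
  have finY: "AE x in lborel. \<Gamma>Y x \<noteq> \<infinity>"
  proof (rule AE_cball_extend)
    fix R :: nat
    have "(\<integral>\<^sup>+ x\<in>cball 0 (real R). \<Gamma>Y x \<partial>lborel) \<noteq> \<infinity>"
      using spread_mass[OF spY, of "real R"] mass_fin[of "real R"] unfolding \<Gamma>Y_def by (auto simp: top_unique)
    then have "AE x in lborel. \<Gamma>Y x * indicator (cball 0 (real R)) x \<noteq> \<infinity>" by (intro nn_integral_PInf_AE) auto
    then show "AE x in lborel. x \<in> cball 0 (real R) \<longrightarrow> \<Gamma>Y x \<noteq> \<infinity>" by eventually_elim (auto simp: indicator_def)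
  qed
  have finX: "AE x in lborel. liminf (\<lambda>j. \<Gamma> j x) \<noteq> \<infinity>"
  proof (rule AE_cball_extend)
    fix R :: nat
    let ?I = "indicator (cball (0::'a) (real R))"
    have "(\<integral>\<^sup>+ x. liminf (\<lambda>j. \<Gamma> j x * ?I x) \<partial>lborel) \<le> liminf (\<lambda>j. \<integral>\<^sup>+ x. \<Gamma> j x * ?I x \<partial>lborel)"
      by (intro nn_integral_liminf) measurable
    also have "\<dots> \<le> liminf (\<lambda>j. ennreal L * mass (real R + M * T))"
      unfolding \<Gamma>_def by (intro Liminf_mono always_eventually allI spread_mass[OF sp])
    finally have "(\<integral>\<^sup>+ x. liminf (\<lambda>j. \<Gamma> j x * ?I x) \<partial>lborel) \<noteq> \<infinity>"
      using mass_fin[of "real R"] by (auto simp: Liminf_const top_unique)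
    then have "AE x in lborel. liminf (\<lambda>j. \<Gamma> j x * ?I x) \<noteq> \<infinity>" by (intro nn_integral_PInf_AE) auto
    then show "AE x in lborel. x \<in> cball 0 (real R) \<longrightarrow> liminf (\<lambda>j. \<Gamma> j x) \<noteq> \<infinity>" by eventually_elim (auto simp: indicator_def)
  qed
  have HX: "AE x in lborel. \<forall>j. AE s in lborel.
    norm (b s (X j s x) - b s (Y s x)) \<le> (g s (X j s x) + g s (Y s x)) * \<rho> (norm (X j s x - Y s x))"
    unfolding AE_all_countable by (intro allI spread_H[OF sp spY])
  have eqX: "AE x in lborel. \<forall>j. \<forall>t\<in>{0..T}. X j t x = x + (LINT s:{0..t}|lborel. \<beta> j s x)"
    unfolding AE_all_countable by (intro allI transportD(6)[OF tr])
  have eqY: "AE x in lborel. \<forall>t\<in>{0..T}. Y t x = x + (LINT s:{0..t}|lborel. b s (Y s x))"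
    using conv finY finX HX eqX
  proof eventually_elim
    case (elim x)
    obtain C where C: "0 \<le> C" "\<exists>\<^sub>F j in sequentially. \<Gamma> j x \<le> ennreal C" using finite_liminf_frequently[OF elim(3)] by blast
    obtain D where D: "0 \<le> D" "\<Gamma>Y x = ennreal D" using elim(2) by (cases "\<Gamma>Y x") auto
    show ?case
    proof
      fix t assume t: "t \<in> {0..T}"
      let ?err = "\<lambda>j. 2 * (1 / 2) ^ j + ((1 / 2) ^ j + \<rho> \<bar>2 * (1 / 2) ^ j\<bar> * (C + D))"
      let ?N = "norm (Y t x - (x + (LINT s:{0..t}|lborel. b s (Y s x))))"
      have bound: "?N \<le> ?err j"
        if j: "\<forall>t\<in>{0..T}. norm (X j t x - Y t x) \<le> 2 * (1 / 2) ^ j"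
          "(\<integral>\<^sup>+ s. ennreal (norm (\<beta> j s x - b s (X j s x))) \<partial>lborel) \<le> ennreal ((1 / 2) ^ j)" "\<Gamma> j x \<le> ennreal C" for j
      proof -
        let ?k = "2 * (1 / 2 :: real) ^ j"
        have \<rho>0: "0 \<le> \<rho> ?k" by (rule rho_nonneg) simp
        have m1: "(\<lambda>s. \<beta> j s x) \<in> borel_measurable borel" "(\<lambda>s. b s (Y s x)) \<in> borel_measurable borel" by measurable
        have i1: "set_integrable lborel {0..t} (\<lambda>s. \<beta> j s x)" "set_integrable lborel {0..t} (\<lambda>s. b s (Y s x))"
          using set_integrable_bounded_interval[OF m1(1) transportD(4)[OF tr]] set_integrable_bounded_interval[OF m1(2) b_bound] by auto
        have diff: "X j t x - (x + (LINT s:{0..t}|lborel. b s (Y s x))) = (LINT s:{0..t}|lborel. \<beta> j s x - b s (Y s x))"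
          using elim(5) t i1 by simp
        have "ennreal (norm (X j t x - (x + (LINT s:{0..t}|lborel. b s (Y s x)))))
          \<le> (\<integral>\<^sup>+ s. ennreal (norm (indicat_real {0..t} s *\<^sub>R (\<beta> j s x - b s (Y s x)))) \<partial>lborel)"
          unfolding diff unfolding set_lebesgue_integral_def
          by (rule integral_norm_bound_ennreal[OF set_integral_diff(1)[OF i1, unfolded set_integrable_def]])
        also have "\<dots> \<le> (\<integral>\<^sup>+ s. ennreal (norm (\<beta> j s x - b s (X j s x)))
            + ennreal (\<rho> ?k) * (ennreal (g s (X j s x)) + ennreal (g s (Y s x))) \<partial>lborel)"
        proof (rule nn_integral_mono_AE, use elim(4)[rule_format, of j] in eventually_elim)
          case (elim s)
          have "norm (b s (X j s x) - b s (Y s x)) \<le> \<rho> ?k * (g s (X j s x) + g s (Y s x))"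
          proof (cases "s \<in> {0..T}")
            case True
            have "(g s (X j s x) + g s (Y s x)) * \<rho> (norm (X j s x - Y s x)) \<le> (g s (X j s x) + g s (Y s x)) * \<rho> ?k"
              using j(1) True g_nonneg by (intro mult_left_mono rho_mono) auto
            with elim show ?thesis by (simp add: mult.commute)
          qed (simp add: b_outside g_outside)
          moreover have "norm (indicat_real {0..t} s *\<^sub>R (\<beta> j s x - b s (Y s x))) \<le> norm (\<beta> j s x - b s (X j s x)) + norm (b s (X j s x) - b s (Y s x))"
            using norm_triangle_ineq[of "\<beta> j s x - b s (X j s x)" "b s (X j s x) - b s (Y s x)"] by (simp add: indicator_def)
          ultimately have "ennreal (norm (indicat_real {0..t} s *\<^sub>R (\<beta> j s x - b s (Y s x))))
            \<le> ennreal (norm (\<beta> j s x - b s (X j s x)) + \<rho> ?k * (g s (X j s x) + g s (Y s x)))"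
            by (intro ennreal_leI) simp
          also have "\<dots> = ennreal (norm (\<beta> j s x - b s (X j s x))) + ennreal (\<rho> ?k) * (ennreal (g s (X j s x)) + ennreal (g s (Y s x)))"
            using \<rho>0 g_nonneg by (simp add: ennreal_mult)
          finally show ?case .
        qed
        also have "\<dots> = (\<integral>\<^sup>+ s. ennreal (norm (\<beta> j s x - b s (X j s x))) \<partial>lborel) + ennreal (\<rho> ?k) * (\<Gamma> j x + \<Gamma>Y x)"
          unfolding \<Gamma>_def \<Gamma>Y_def by (subst nn_integral_add nn_integral_cmult, measurable)+
        also have "\<dots> \<le> ennreal ((1 / 2) ^ j) + ennreal (\<rho> ?k) * (ennreal C + ennreal D)"
          using j unfolding D(2) by (intro add_mono mult_left_mono) auto
        also have "\<dots> = ennreal ((1 / 2) ^ j + \<rho> ?k * (C + D))"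
          using \<rho>0 C(1) D(1) by (simp add: ennreal_mult)
        finally have e: "norm (X j t x - (x + (LINT s:{0..t}|lborel. b s (Y s x)))) \<le> (1 / 2) ^ j + \<rho> ?k * (C + D)"
          using \<rho>0 C(1) D(1) by (subst (asm) ennreal_le_iff) auto
        have "norm (Y t x - X j t x) \<le> ?k" using j(1) t by (simp add: norm_minus_commute)
        from norm_diff_triangle_le[OF this e] show ?thesis by simp
      qed
      have "(\<lambda>j. \<rho> \<bar>2 * (1 / 2) ^ j\<bar>) \<longlonglongrightarrow> 0"
        by (rule filterlim_compose[OF rho_tendsto_0]) (use geo in \<open>simp add: filterlim_at\<close>)
      then have "?err \<longlonglongrightarrow> 0 + (0 + 0 * (C + D))"
        by (intro tendsto_add tendsto_mult tendsto_const geo LIMSEQ_power_zero) auto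
      then have err: "?err \<longlonglongrightarrow> 0" by simp
      have "?N \<le> 0"
      proof (rule field_le_epsilon)
        fix e :: real assume e: "0 < e"
        have "\<forall>\<^sub>F j in sequentially. ?err j < e" by (rule order_tendstoD(2)[OF err e])
        \<comment> \<open>The closeness estimates hold eventually, the bound on the time integral of
          \<open>g\<close> only frequently; some index satisfies both.\<close>
        with elim(1) have "\<forall>\<^sub>F j in sequentially. ((\<forall>t\<in>{0..T}. norm (X j t x - Y t x) \<le> 2 * (1 / 2) ^ j) \<and>
          (\<integral>\<^sup>+ s. ennreal (norm (\<beta> j s x - b s (X j s x))) \<partial>lborel) \<le> ennreal ((1 / 2) ^ j)) \<and> ?err j < e"
          by eventually_elim blast
        from frequently_eventually_frequently[OF C(2) this] obtain j where j: "\<Gamma> j x \<le> ennreal C"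
          "\<forall>t\<in>{0..T}. norm (X j t x - Y t x) \<le> 2 * (1 / 2) ^ j"
          "(\<integral>\<^sup>+ s. ennreal (norm (\<beta> j s x - b s (X j s x))) \<partial>lborel) \<le> ennreal ((1 / 2) ^ j)" "?err j < e"
          using frequently_ex by blast
        show "?N \<le> 0 + e" using bound[OF j(2,3,1)] j(4) by linarith
      qed
      then show "Y t x = x + (LINT s:{0..t}|lborel. b s (Y s x))" by simp
    qed
  qed
  have "transport L Y (\<lambda>s x. b s (Y s x))"
    unfolding transport_def
    using transportD(1)[OF tr] Ym push eqY b_bound b_outside by auto
  then show ?thesis by blast
qed

end

lemma (in osgood_divergence) ex_transport:
  "\<exists>L Y. transport L Y (\<lambda>s x. b s (Y s x))"
proof -
  let ?L = "exp (2 * (LINT s|lborel. m s) + 2)"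
  let ?\<epsilon> = "\<lambda>n. 1 / real (Suc n)"
  \<comment> \<open>The summand 1 dominates every \<open>?\<epsilon> n\<close>, so the factor of
    \<open>\<rho> (?\<epsilon> n)\<close> is independent of \<open>n\<close>.\<close>
  let ?C = "\<lambda>R. ennreal T * emeasure lborel (cball (0::real^'n) R) + ennreal ?L * (mass (R + M * T) + mass (R + M * T + 1))"
  have mass_mono: "mass R \<le> mass R'" if "R \<le> R'" for R R'
    unfolding mass_def using that by (intro nn_integral_mono) (auto simp: indicator_def)
  have "\<exists>X \<beta>. transport ?L X \<beta> \<and> (\<forall>R. defect R X \<beta> \<le> ennreal (\<rho> (?\<epsilon> n)) * ?C R)" for n
  proof -
    obtain X \<beta> where X: "transport ?L X \<beta>" "\<And>R. defect R X \<beta> \<le> ennreal (\<rho> (?\<epsilon> n)) * (ennreal T * emeasure lborel (cball (0::real^'n) R)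
      + ennreal ?L * (mass (R + M * T) + mass (R + M * T + ?\<epsilon> n)))"
      using polygon_transport[of "?\<epsilon> n"] by auto
    have "defect R X \<beta> \<le> ennreal (\<rho> (?\<epsilon> n)) * ?C R" for R
      by (rule order.trans[OF X(2)]) (intro mult_left_mono add_left_mono mass_mono, auto)
    with X(1) show ?thesis by blast
  qed
  then have "\<forall>n. \<exists>p. transport ?L (fst p) (snd p) \<and> (\<forall>R. defect R (fst p) (snd p) \<le> ennreal (\<rho> (?\<epsilon> n)) * ?C R)" by simp
  from choice[OF this] obtain p where p: "\<And>n. transport ?L (fst (p n)) (snd (p n))"
    "\<And>n R. defect R (fst (p n)) (snd (p n)) \<le> ennreal (\<rho> (?\<epsilon> n)) * ?C R" by blast
  have "(\<lambda>n. defect R (fst (p n)) (snd (p n))) \<longlonglongrightarrow> 0" for R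
  proof (rule tendsto_sandwich[of "\<lambda>_. 0"])
    have "?\<epsilon> \<longlonglongrightarrow> 0" by (rule LIMSEQ_Suc[OF lim_1_over_n])
    then have "(\<lambda>n. \<rho> \<bar>?\<epsilon> n\<bar>) \<longlonglongrightarrow> 0"
      by (intro filterlim_compose[OF rho_tendsto_0]) (simp add: filterlim_at)
    then have "(\<lambda>n. ennreal (\<rho> (?\<epsilon> n))) \<longlonglongrightarrow> ennreal 0" by (intro tendsto_ennrealI) simp
    moreover have "?C R < top"
      using mass_finite[of "R + M * T"] mass_finite[of "R + M * T + 1"]
      by (auto simp: ennreal_mult_less_top ennreal_add_less_top emeasure_lborel_cball_finite[unfolded infinity_ennreal_def])
    ultimately have "(\<lambda>n. ennreal (\<rho> (?\<epsilon> n)) * ?C R) \<longlonglongrightarrow> ennreal 0 * ?C R"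
      by (intro tendsto_mult_ennreal tendsto_const) auto
    then show "(\<lambda>n. ennreal (\<rho> (?\<epsilon> n)) * ?C R) \<longlonglongrightarrow> 0" by simp
  qed (use p(2) in auto)
  from transport_limit[OF p(1) this] show ?thesis by blast
qed

section \<open>Borel versions and regular Lagrangian flows\<close>

lemma ex_borel_version:
  fixes f :: "'a::euclidean_space \<Rightarrow> 'b::euclidean_space"
  assumes "f \<in> borel_measurable lebesgue"
  shows "\<exists>f'\<in>borel_measurable borel. AE x in lborel. f x = f' x"
proof -
  have "\<exists>g. g \<in> borel_measurable borel \<and> (AE x in lborel. f x \<bullet> i = g x)" for i
    using completion_ex_borel_measurable_real[of "\<lambda>x. f x \<bullet> i" lborel] assms by auto
  then obtain g where g: "\<And>i. g i \<in> borel_measurable borel" "\<And>i. AE x in lborel. f x \<bullet> i = g i x" by metis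
  show ?thesis
  proof (intro bexI[of _ "\<lambda>x. \<Sum>i\<in>Basis. g i x *\<^sub>R i"])
    have "AE x in lborel. \<forall>i\<in>Basis. f x \<bullet> i = g i x" using g(2) by (simp add: AE_finite_all)
    then show "AE x in lborel. f x = (\<Sum>i\<in>Basis. g i x *\<^sub>R i)"
    proof eventually_elim
      case (elim x)
      have "f x = (\<Sum>i\<in>Basis. (f x \<bullet> i) *\<^sub>R i)" by (simp add: euclidean_representation)
      with elim show ?case by simp
    qed
    show "(\<lambda>x. \<Sum>i\<in>Basis. g i x *\<^sub>R i) \<in> borel_measurable borel"
      using g(1) by (intro borel_measurable_sum borel_measurable_scaleR) auto
  qed
qed

lemma lebesgue_measurable_AE_eq:
  fixes f :: "'a::euclidean_space \<Rightarrow> 'b::topological_space"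
  assumes g: "g \<in> borel_measurable borel" and eq: "AE x in lborel. f x = g x"
  shows "f \<in> borel_measurable lebesgue"
proof (rule measurableI)
  fix A :: "'b set" assume "A \<in> sets borel"
  then have "g -` A \<in> sets lebesgue" using measurable_sets[OF g, of A] by simp
  moreover have "AE x in lebesgue. x \<in> g -` A \<longleftrightarrow> x \<in> f -` A"
    by (rule AE_completion) (use eq in \<open>auto elim!: eventually_mono\<close>)
  ultimately have "f -` A \<in> sets lebesgue"
    by (intro completion.in_sets_AE[where A="g -` A" and B="f -` A"]) auto
  then show "f -` A \<inter> space lebesgue \<in> sets lebesgue" by simp
qed simp

text \<open>The exceptional set is returned as a Borel set \<open>Z\<close> in space-time and not
  merely as an almost everywhere statement, because membership of \<open>(s, X s x)\<close> in
  \<open>Z\<close> has to be measurable when flows are inserted. Its slices are null for almost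
  every time by Tonelli.\<close>

lemma strip_version:
  fixes f :: "real \<Rightarrow> 'a::euclidean_space \<Rightarrow> 'b::euclidean_space"
  assumes "measurable_on_strip T f"
  obtains f' Z where "case_prod f' \<in> borel_measurable (borel \<Otimes>\<^sub>M borel)" "Z \<in> sets (borel \<Otimes>\<^sub>M borel)"
    "AE t in lborel. {x. (t, x) \<in> Z} \<in> null_sets lborel"
    "\<And>t x. t \<in> {0..T} \<Longrightarrow> (t, x) \<notin> Z \<Longrightarrow> f t x = f' t x"
proof -
  let ?S = "{0..T} \<times> (UNIV :: 'a set)"
  have "closed ?S" by (intro closed_Times) auto
  then have S: "?S \<in> sets lebesgue" by simp
  have "(\<lambda>z. indicator ?S z *\<^sub>R (case z of (t, x) \<Rightarrow> f t x)) \<in> borel_measurable lebesgue"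
    using assms S unfolding measurable_on_strip_def by (subst (asm) borel_measurable_restrict_space_iff) auto
  then obtain F where F: "F \<in> borel_measurable borel"
    "AE z in lborel. indicator ?S z *\<^sub>R (case z of (t, x) \<Rightarrow> f t x) = F z"
    using ex_borel_version by blast
  then obtain Z where Z0: "Z \<in> null_sets lborel"
    "{z \<in> space lborel. \<not> indicator ?S z *\<^sub>R (case z of (t, x) \<Rightarrow> f t x) = F z} \<subseteq> Z"
    unfolding eventually_ae_filter by blast
  have sp: "space lborel = (UNIV :: (real \<times> 'a) set)" by simp
  have Z: "Z \<in> null_sets lborel" "\<And>z. z \<notin> Z \<Longrightarrow> indicator ?S z *\<^sub>R (case z of (t, x) \<Rightarrow> f t x) = F z"
    using Z0(1) Z0(2)[unfolded sp] by blast+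
  have Zs: "Z \<in> sets (borel \<Otimes>\<^sub>M borel)" using null_setsD2[OF Z(1)] unfolding borel_prod by simp
  have "AE z in lborel \<Otimes>\<^sub>M lborel. z \<notin> Z" using AE_not_in[OF Z(1)] unfolding lborel_prod .
  then have "AE t in lborel. AE x in lborel. (t, x) \<notin> Z" by (rule lborel_pair.AE_pair)
  then have "AE t in lborel. {x. (t, x) \<in> Z} \<in> null_sets lborel"
  proof eventually_elim
    case (elim t)
    have "{x. (t, x) \<in> Z} = Pair t -` Z" by auto
    then have "{x. (t, x) \<in> Z} \<in> sets lborel" using sets_Pair1[OF Zs, of t] by simp
    with elim show ?case by (subst AE_iff_null_sets) auto
  qed
  moreover have "f t x = F (t, x)" if "t \<in> {0..T}" "(t, x) \<notin> Z" for t x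
    using Z(2)[OF that(2)] that(1) by simp
  ultimately show ?thesis
    using that[of "\<lambda>t x. F (t, x)" Z] F(1) Zs by (simp add: borel_prod)
qed

lemma lipschitz_absolutely_continuous_curve:
  fixes f :: "real \<Rightarrow> 'a::real_normed_vector"
  assumes "\<And>s t. s \<in> {a..b} \<Longrightarrow> t \<in> {a..b} \<Longrightarrow> s \<le> t \<Longrightarrow> norm (f t - f s) \<le> K * (t - s)" "0 \<le> K"
  shows "absolutely_continuous_curve a b f"
  unfolding absolutely_continuous_curve_def
proof (intro allI impI)
  fix \<epsilon> :: real assume \<epsilon>: "0 < \<epsilon>"
  show "\<exists>\<delta>>0. \<forall>\<D> S. \<D> division_of S \<and> S \<subseteq> {a..b} \<and> (\<Sum>K\<in>\<D>. Sup K - Inf K) < \<delta> \<longrightarrow>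
        (\<Sum>K\<in>\<D>. norm (f (Sup K) - f (Inf K))) < \<epsilon>"
  proof (intro exI[of _ "\<epsilon> / (K + 1)"] conjI allI impI)
    show "0 < \<epsilon> / (K + 1)" using \<epsilon> assms(2) by simp
    fix \<D> S assume D: "\<D> division_of S \<and> S \<subseteq> {a..b} \<and> (\<Sum>K\<in>\<D>. Sup K - Inf K) < \<epsilon> / (K + 1)"
    have I: "norm (f (Sup I) - f (Inf I)) \<le> K * (Sup I - Inf I) \<and> 0 \<le> Sup I - Inf I" if ID: "I \<in> \<D>" for I
    proof -
      have div: "\<D> division_of S" and S: "S \<subseteq> {a..b}" using D by auto
      obtain c d where cd: "I = cbox c d" using division_ofD(4)[OF div ID] by blast
      have "I \<noteq> {}" "I \<subseteq> {a..b}" using division_ofD(2,3)[OF div ID] S by auto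
      then show ?thesis using assms(1)[of c d] cd by auto
    qed
    have "(\<Sum>I\<in>\<D>. norm (f (Sup I) - f (Inf I))) \<le> (\<Sum>I\<in>\<D>. K * (Sup I - Inf I))"
      using I by (intro sum_mono) auto
    also have "\<dots> = K * (\<Sum>I\<in>\<D>. Sup I - Inf I)" by (simp add: sum_distrib_left)
    also have "\<dots> \<le> (K + 1) * (\<Sum>I\<in>\<D>. Sup I - Inf I)"
      using I by (intro mult_right_mono sum_nonneg) auto
    also have "\<dots> < \<epsilon>" using D assms(2) by (simp add: field_simps)
    finally show "(\<Sum>K\<in>\<D>. norm (f (Sup K) - f (Inf K))) < \<epsilon>" .
  qed
qed

text \<open>Absolute continuity is applied to divisions that consist of a single interval.\<close>

lemma absolutely_continuous_curve_continuous:
  fixes f :: "real \<Rightarrow> 'a::real_normed_vector"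
  assumes "absolutely_continuous_curve a b f" shows "continuous_on {a..b} f"
  unfolding continuous_on_iff
proof (intro ballI allI impI)
  fix t \<epsilon> :: real assume t: "t \<in> {a..b}" and \<epsilon>: "0 < \<epsilon>"
  obtain \<delta> where \<delta>: "0 < \<delta>" "\<And>\<D> S. \<D> division_of S \<Longrightarrow> S \<subseteq> {a..b} \<Longrightarrow> (\<Sum>K\<in>\<D>. Sup K - Inf K) < \<delta> \<Longrightarrow>
        (\<Sum>K\<in>\<D>. norm (f (Sup K) - f (Inf K))) < \<epsilon>"
    using assms \<epsilon> unfolding absolutely_continuous_curve_def by metis
  have *: "norm (f d - f c) < \<epsilon>" if "c \<in> {a..b}" "d \<in> {a..b}" "c \<le> d" "d - c < \<delta>" for c d
    using \<delta>(2)[OF division_of_self, of c d] that by auto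
  show "\<exists>d>0. \<forall>s\<in>{a..b}. dist s t < d \<longrightarrow> dist (f s) (f t) < \<epsilon>"
  proof (intro exI[of _ \<delta>] conjI ballI impI)
    fix s assume "s \<in> {a..b}" "dist s t < \<delta>"
    then show "dist (f s) (f t) < \<epsilon>"
      using *[of s t] *[of t s] t by (cases "s \<le> t") (auto simp: dist_norm norm_minus_commute)
  qed (rule \<delta>(1))
qed

text \<open>Flows are defined by integrals of the given field over the completed measure, while
  transports use Borel representatives and \<open>lborel\<close>. Agreement at almost every time
  suffices; completeness supplies the measurability of \<open>u\<close>.\<close>

lemma set_integral_lebesgue_version:
  fixes u f :: "real \<Rightarrow> 'b::euclidean_space"
  assumes f: "f \<in> borel_measurable borel" "\<And>s. norm (f s) \<le> K" and eq: "AE s in lborel. s \<in> {0..T} \<longrightarrow> u s = f s"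
  shows "set_integrable lebesgue {0..T} u"
    and "t \<in> {0..T} \<Longrightarrow> (LINT s:{0..t}|lebesgue. u s) = (LINT s:{0..t}|lborel. f s)"
proof -
  have *: "AE s in lborel. indicat_real {0..t} s *\<^sub>R u s = indicat_real {0..t} s *\<^sub>R f s" if "t \<le> T" for t
    using eq by eventually_elim (use that in \<open>auto simp: indicator_def\<close>)
  have fm: "(\<lambda>s. indicat_real {0..t} s *\<^sub>R f s) \<in> borel_measurable borel" for t using f(1) by measurable
  have um: "(\<lambda>s. indicat_real {0..t} s *\<^sub>R u s) \<in> borel_measurable lebesgue" if "t \<le> T" for t
    by (rule lebesgue_measurable_AE_eq[OF fm *[OF that]])
  have fi: "integrable lebesgue (\<lambda>s. indicat_real {0..t} s *\<^sub>R f s)" for t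
    using set_integrable_bounded_interval[OF f, of "{0..t}"] by (simp add: set_integrable_def integrable_completion fm)
  show "set_integrable lebesgue {0..T} u" unfolding set_integrable_def
    using fi[of T] by (rule integrable_cong_AE_imp[OF _ um]) (use *[of T] in \<open>auto intro!: AE_completion elim: eventually_mono\<close>)
  assume t: "t \<in> {0..T}"
  have "(LINT s:{0..t}|lebesgue. u s) = (LINT s|lebesgue. indicat_real {0..t} s *\<^sub>R f s)"
    unfolding set_lebesgue_integral_def
    using t * by (intro integral_cong_AE um AE_completion) (auto simp: measurable_completion fm)
  also have "\<dots> = (LINT s:{0..t}|lborel. f s)"
    unfolding set_lebesgue_integral_def by (intro integral_completion) (simp add: fm)
  finally show "(LINT s:{0..t}|lebesgue. u s) = (LINT s:{0..t}|lborel. f s)" .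
qed

section \<open>Correspondence between regular Lagrangian flows and transports\<close>

context osgood_field
begin

lemma transport_mono: assumes "transport L X \<beta>" "L \<le> L'" shows "transport L' X \<beta>"
proof -
  have "ennreal L * emeasure lborel A \<le> ennreal L' * emeasure lborel A" for A :: "'a set"
    using assms(2) by (intro mult_right_mono ennreal_leI) auto
  then show ?thesis using assms unfolding transport_def by (force intro: order_trans)
qed

lemma defect_self: "defect R X (\<lambda>s x. b s (X s x)) = 0"
  by (simp add: defect_def)

context
  fixes u :: "real \<Rightarrow> 'a \<Rightarrow> 'a" and Z :: "(real \<times> 'a) set"
  assumes Z[measurable]: "Z \<in> sets (borel \<Otimes>\<^sub>M borel)" and Z_null: "AE t in lborel. {x. (t, x) \<in> Z} \<in> null_sets lborel"
    and u_eq: "\<And>t x. t \<in> {0..T} \<Longrightarrow> (t, x) \<notin> Z \<Longrightarrow> u t x = b t x"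
begin

text \<open>In the application \<open>u\<close> is the given field and \<open>b\<close> its Borel
  representative. At almost every time the slice of \<open>Z\<close> is null, hence so is its
  preimage under \<open>X s\<close>. So the two fields agree along almost every trajectory, although
  they may differ on \<open>Z\<close>.\<close>

lemma pushforward_avoids:
  assumes X[measurable]: "case_prod X \<in> borel_measurable (borel \<Otimes>\<^sub>M borel)"
    and push: "\<And>t A. t \<in> {0..T} \<Longrightarrow> A \<in> sets borel \<Longrightarrow> emeasure lborel (X t -` A) \<le> ennreal L * emeasure lborel A"
  shows "AE x in lborel. AE s in lborel. s \<in> {0..T} \<longrightarrow> u s (X s x) = b s (X s x)"
proof -
  have "AE s in lborel. AE x in lborel. s \<in> {0..T} \<longrightarrow> (s, X s x) \<notin> Z"
    using Z_null
  proof eventually_elim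
    case (elim s)
    show ?case
    proof (cases "s \<in> {0..T}")
      case True
      have Xs: "X s \<in> borel_measurable borel" by measurable
      let ?N = "{x. (s, x) \<in> Z}"
      have N: "?N \<in> sets borel" using elim by (auto simp: null_sets_def)
      have "emeasure lborel (X s -` ?N) \<le> ennreal L * emeasure lborel ?N" by (rule push[OF True N])
      then have "emeasure lborel (X s -` ?N) = 0" using elim by (auto simp: null_sets_def)
      then have "X s -` ?N \<in> null_sets lborel" using measurable_sets[OF Xs N] by (auto simp: null_sets_def)
      from AE_not_in[OF this] show ?thesis by (auto elim: eventually_mono)
    next
      case False
      then show ?thesis by (intro AE_I2) blast
    qed
  qed
  moreover have "Measurable.pred (borel \<Otimes>\<^sub>M borel) (\<lambda>(s, x). s \<in> {0..T} \<longrightarrow> (s, X s x) \<notin> Z)" by measurable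
  ultimately have "AE x in lborel. AE s in lborel. s \<in> {0..T} \<longrightarrow> (s, X s x) \<notin> Z"
    by (rule AE_lborel_commute[THEN iffD1, rotated])
  then show ?thesis
  proof eventually_elim
    case (elim x)
    then show ?case by eventually_elim (use u_eq in blast)
  qed
qed

lemma transport_imp_flow:
  assumes Y: "transport L Y (\<lambda>s x. b s (Y s x))"
    and loc: "(\<lambda>(t, x). u t x) locally_integrable_on ({0..T} \<times> UNIV)"
  shows "regular_lagrangian_flow T u Y"
proof -
  note [measurable] = transportD(2)[OF Y]
  have avoids: "AE x in lborel. AE s in lborel. s \<in> {0..T} \<longrightarrow> u s (Y s x) = b s (Y s x)"
    by (rule pushforward_avoids[OF transportD(2)[OF Y]]) (rule transportD(7)[OF Y])
  have "AE x in lebesgue. absolutely_continuous_curve 0 T (\<lambda>t. Y t x) \<and>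
        set_integrable lebesgue {0..T} (\<lambda>s. u s (Y s x)) \<and>
        (\<forall>t\<in>{0..T}. Y t x = x + (LINT s:{0..t}|lebesgue. u s (Y s x)))"
  proof (rule AE_completion, use transportD(6)[OF Y] avoids in eventually_elim)
    case (elim x)
    have m: "(\<lambda>s. b s (Y s x)) \<in> borel_measurable borel" by measurable
    have "norm (Y t x - Y s x) \<le> M * (t - s)" if "s \<in> {0..T}" "t \<in> {0..T}" "s \<le> t" for s t
      using norm_integral_le[OF m b_bound, of s t] elim(1) that by simp
    then have "absolutely_continuous_curve 0 T (\<lambda>t. Y t x)"
      by (intro lipschitz_absolutely_continuous_curve[where K=M] M_nonneg)
    then show ?case
      using set_integral_lebesgue_version[OF m b_bound elim(2)] elim(1) by simp
  qed
  moreover have "Y t \<in> borel_measurable lebesgue \<and> distr lebesgue lborel (Y t) \<le> scale_measure (ennreal L) lborel"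
    if t: "t \<in> {0..T}" for t
  proof
    have Yt: "Y t \<in> borel_measurable borel" by measurable
    then show Yl: "Y t \<in> borel_measurable lebesgue" by (simp add: measurable_completion)
    have "emeasure (distr lebesgue lborel (Y t)) A \<le> emeasure (scale_measure (ennreal L) lborel) A" for A
    proof (cases "A \<in> sets borel")
      case True
      then have "Y t -` A \<in> sets lborel" using measurable_sets[OF Yt] by simp
      then show ?thesis using True Yl transportD(7)[OF Y t True] by (simp add: emeasure_distr)
    next
      case False
      then show ?thesis by (simp add: emeasure_notin_sets)
    qed
    then show "distr lebesgue lborel (Y t) \<le> scale_measure (ennreal L) lborel"
      by (simp add: le_measure_iff le_fun_def space_scale_measure)
  qed
  ultimately show ?thesis
    unfolding regular_lagrangian_flow_def using loc transportD(1)[OF Y] by blast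
qed

text \<open>A flow is measurable only at each fixed time, whereas transports are jointly Borel. Its
  curves are continuous for almost every starting point, so it can be rebuilt from Borel
  representatives at countably many grid times; the limit of these is jointly Borel and equals the
  flow at all times outside one null set.\<close>

lemma flow_imp_transport:
  assumes flow: "regular_lagrangian_flow T u X"
  shows "\<exists>L X'. transport L X' (\<lambda>s x. b s (X' s x)) \<and> (AE x in lborel. \<forall>t\<in>{0..T}. X t x = X' t x)"
proof -
  obtain L where L: "0 < L" "\<And>t. t \<in> {0..T} \<Longrightarrow> X t \<in> borel_measurable lebesgue"
    "\<And>t. t \<in> {0..T} \<Longrightarrow> distr lebesgue lborel (X t) \<le> scale_measure (ennreal L) lborel"
    and curve: "AE x in lborel. absolutely_continuous_curve 0 T (\<lambda>t. X t x) \<and>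
        (\<forall>t\<in>{0..T}. X t x = x + (LINT s:{0..t}|lebesgue. u s (X s x)))"
    using flow unfolding regular_lagrangian_flow_def AE_completion_iff by (auto elim: eventually_mono)
  have "\<exists>V. V \<in> borel_measurable borel \<and> (q \<in> {0..T} \<longrightarrow> (AE x in lborel. X q x = V x))" for q
    using ex_borel_version[OF L(2)[of q]] by (cases "q \<in> {0..T}") (auto intro: borel_measurable_const)
  then obtain V where V[measurable]: "\<And>q. V q \<in> borel_measurable borel" and VX: "\<And>q. q \<in> {0..T} \<Longrightarrow> AE x in lborel. X q x = V q x"
    by metis
  \<comment> \<open>Time is clamped to the interval and rounded down to the grid of width
    \<open>1 / real (Suc n)\<close>; rounding down keeps the result in
    \<open>{0..T}\<close>.\<close>
  define \<tau> where "\<tau> n t = real_of_int \<lfloor>real (Suc n) * max 0 (min T t)\<rfloor> / real (Suc n)" for n t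
  have \<tau>0: "\<tau> n t \<in> {0..T}" "\<tau> n t \<le> t" "t - \<tau> n t \<le> 1 / real (Suc n)" if "t \<in> {0..T}" for n t
  proof -
    have m: "max 0 (min T t) = t" using that by simp
    have le: "real_of_int \<lfloor>real (Suc n) * t\<rfloor> \<le> real (Suc n) * t" "real (Suc n) * t \<le> real_of_int \<lfloor>real (Suc n) * t\<rfloor> + 1" by linarith+
    have "0 \<le> real (Suc n) * t" using that by simp
    then have "0 \<le> \<tau> n t" by (simp add: \<tau>_def m)
    moreover show "\<tau> n t \<le> t" using le(1) unfolding \<tau>_def m by (simp add: divide_le_eq mult.commute)
    ultimately show "\<tau> n t \<in> {0..T}" using that by simp
    have "t \<le> (real_of_int \<lfloor>real (Suc n) * t\<rfloor> + 1) / real (Suc n)"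
      using le(2) by (subst pos_le_divide_eq) (simp_all only: mult.commute of_nat_0_less_iff zero_less_Suc)
    then show "t - \<tau> n t \<le> 1 / real (Suc n)" unfolding \<tau>_def m add_divide_distrib by linarith
  qed
  define X' where "X' t x = lim (\<lambda>n. V (\<tau> n t) x)" for t x
  have X'm[measurable]: "case_prod X' \<in> borel_measurable (borel \<Otimes>\<^sub>M borel)"
  proof -
    have [measurable]: "(\<lambda>p. V (\<tau> n (fst p)) (snd p)) \<in> borel_measurable (borel \<Otimes>\<^sub>M borel)" for n
      unfolding \<tau>_def
      by (rule measurable_compose_countable[where f="\<lambda>k p. V (real_of_int k / real (Suc n)) (snd p)"]) measurable
    show ?thesis unfolding X'_def case_prod_beta by measurable
  qed
  \<comment> \<open>Grid times are indexed by \<open>n\<close> and an integer, hence countable, so a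
    single null set of starting points serves all of them.\<close>
  have "AE x in lborel. \<forall>n. \<forall>k::int. real_of_int k / real (Suc n) \<in> {0..T} \<longrightarrow> X (real_of_int k / real (Suc n)) x = V (real_of_int k / real (Suc n)) x"
    unfolding AE_all_countable using VX by (auto intro: AE_I2)
  with curve have XX': "AE x in lborel. \<forall>t\<in>{0..T}. X t x = X' t x"
  proof eventually_elim
    case (elim x)
    show ?case
    proof
      fix t assume t: "t \<in> {0..T}"
      have c: "continuous_on {0..T} (\<lambda>t. X t x)" using elim(1) by (intro absolutely_continuous_curve_continuous) blast
      have "(\<lambda>n. t - \<tau> n t) \<longlonglongrightarrow> 0"
        by (rule tendsto_sandwich[OF _ _ tendsto_const LIMSEQ_Suc[OF lim_1_over_n]]) (use \<tau>0[OF t] in auto)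
      then have "(\<lambda>n. t - (t - \<tau> n t)) \<longlonglongrightarrow> t - 0" by (intro tendsto_intros)
      then have "(\<lambda>n. \<tau> n t) \<longlonglongrightarrow> t" by simp
      then have "(\<lambda>n. X (\<tau> n t) x) \<longlonglongrightarrow> X t x"
        by (rule continuous_on_tendsto_compose[OF c _ t]) (intro always_eventually allI \<tau>0(1)[OF t])
      moreover have "X (\<tau> n t) x = V (\<tau> n t) x" for n
        using elim(2) \<tau>0(1)[OF t, of n] unfolding \<tau>_def by blast
      ultimately show "X t x = X' t x" unfolding X'_def by (simp add: limI)
    qed
  qed
  have push: "emeasure lborel (X' t -` A) \<le> ennreal L * emeasure lborel A" if t: "t \<in> {0..T}" and A: "A \<in> sets borel" for t A
  proof -
    have X't: "X' t \<in> borel_measurable borel" by measurable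
    have "X' t -` A \<in> sets lborel" using measurable_sets[OF X't A] by simp
    then have "emeasure lborel (X' t -` A) = emeasure lebesgue (X' t -` A)" by simp
    also have "\<dots> = emeasure lebesgue (X t -` A)"
    proof (rule emeasure_eq_AE)
      show "AE x in lebesgue. x \<in> X' t -` A \<longleftrightarrow> x \<in> X t -` A"
        by (rule AE_completion) (use XX' t in \<open>auto elim!: eventually_mono\<close>)
      show "X' t -` A \<in> sets lebesgue" using \<open>X' t -` A \<in> sets lborel\<close> by simp
      show "X t -` A \<in> sets lebesgue" using measurable_sets[OF L(2)[OF t] A] by simp
    qed
    also have "\<dots> = emeasure (distr lebesgue lborel (X t)) A" using L(2)[OF t] A by (simp add: emeasure_distr)
    also have "\<dots> \<le> emeasure (scale_measure (ennreal L) lborel) A" by (intro le_measureD3 L(3) t) simp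
    finally show ?thesis by simp
  qed
  have "AE x in lborel. AE s in lborel. s \<in> {0..T} \<longrightarrow> u s (X' s x) = b s (X' s x)"
    by (rule pushforward_avoids[OF X'm]) (rule push)
  with curve XX' have "AE x in lborel. \<forall>t\<in>{0..T}. X' t x = x + (LINT s:{0..t}|lborel. b s (X' s x))"
  proof eventually_elim
    case (elim x)
    have m: "(\<lambda>s. b s (X' s x)) \<in> borel_measurable borel" by measurable
    have "AE s in lborel. s \<in> {0..T} \<longrightarrow> u s (X s x) = b s (X' s x)"
      using elim(3) by eventually_elim (use elim(2) in auto)
    from set_integral_lebesgue_version(2)[OF m b_bound this] show ?case using elim(1,2) by auto
  qed
  then have "transport L X' (\<lambda>s x. b s (X' s x))"
    unfolding transport_def using L(1) X'm push b_bound b_outside by auto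
  then show ?thesis using XX' by blast
qed

text \<open>The two flows may come with different constants; both are transports for the larger one,
  and their defects vanish identically.\<close>

lemma flow_unique:
  assumes "regular_lagrangian_flow T u X" "regular_lagrangian_flow T u Y"
  shows "AE x in lebesgue. \<forall>t\<in>{0..T}. X t x = Y t x"
proof (rule AE_completion)
  obtain L X' where X: "transport L X' (\<lambda>s x. b s (X' s x))" "AE x in lborel. \<forall>t\<in>{0..T}. X t x = X' t x"
    using flow_imp_transport[OF assms(1)] by blast
  obtain K Y' where Y: "transport K Y' (\<lambda>s x. b s (Y' s x))" "AE x in lborel. \<forall>t\<in>{0..T}. Y t x = Y' t x"
    using flow_imp_transport[OF assms(2)] by blast
  have "AE x in lborel. \<forall>t\<in>{0..T}. X' t x = Y' t x"
    by (rule transport_unique[OF transport_mono[OF X(1)] transport_mono[OF Y(1)], of "max L K"]) (auto simp: defect_self)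
  with X(2) Y(2) show "AE x in lborel. \<forall>t\<in>{0..T}. X t x = Y t x" by eventually_elim simp
qed

end

end

section \<open>Passage from the given hypotheses to Borel data\<close>

lemma esssup_slice_measurable:
  fixes f :: "real \<Rightarrow> 'a::euclidean_space \<Rightarrow> ennreal"
  assumes f[measurable]: "case_prod f \<in> borel_measurable (borel \<Otimes>\<^sub>M borel)"
  shows "(\<lambda>t. esssup lborel (f t)) \<in> borel_measurable borel"
proof (rule borel_measurableI_le)
  fix c
  have slice: "f t \<in> borel_measurable lborel" for t by measurable
  \<comment> \<open>A bound on the essential supremum says that a superlevel set has measure 0, and
    by Tonelli this measure depends measurably on \<open>t\<close>.\<close>
  have iff: "esssup lborel (f t) \<le> c \<longleftrightarrow> emeasure lborel {x. c < f t x} = 0" for t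
  proof -
    have "esssup lborel (f t) \<le> c \<longleftrightarrow> (AE x in lborel. f t x \<le> c)"
      using esssup_AE[of "f t" lborel] esssup_I[OF slice, of t c] by (auto elim: eventually_mono)
    also have "\<dots> \<longleftrightarrow> emeasure lborel {x \<in> space lborel. \<not> f t x \<le> c} = 0"
      by (rule AE_iff_measurable) (auto simp: slice)
    finally show ?thesis by (simp add: not_le)
  qed
  have "{p \<in> space (borel \<Otimes>\<^sub>M lborel). c < f (fst p) (snd p)} \<in> sets (borel \<Otimes>\<^sub>M lborel)" by measurable
  from lborel.measurable_emeasure_Pair[OF this]
  have "(\<lambda>t. emeasure lborel {x. c < f t x}) \<in> borel_measurable borel"
    by (simp add: vimage_def space_pair_measure)
  then have "{t \<in> space borel. emeasure lborel {x. c < f t x} = 0} \<in> sets borel" by measurable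
  then show "{t \<in> space borel. esssup lborel (f t) \<le> c} \<in> sets borel" by (simp add: iff)
qed

text \<open>The distributional identity is tested with the kernel reflected and centred at
  \<open>x\<close>; the minus signs of reflection and integration by parts cancel. Since the kernel
  is nonnegative with mass one, averaging preserves the lower bound \<open>- c\<close>.\<close>

lemma mollified_divergence_ge:
  fixes u v :: "'a::euclidean_space \<Rightarrow> 'a"
  assumes div: "has_distributional_divergence u D" and v[measurable]: "v \<in> borel_measurable borel"
    and eq: "AE y in lborel. u y = v y" and D: "AE y in lborel. - D y \<le> c" and \<epsilon>: "0 < \<epsilon>"
  shows "- c \<le> (LINT y|lborel. mollifier_grad \<epsilon> (x - y) \<bullet> v y)"
proof -
  let ?\<phi> = "\<lambda>y. mollifier \<epsilon> (x - y)"
  have um: "u \<in> borel_measurable lebesgue" by (rule lebesgue_measurable_AE_eq[OF v eq])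
  have gm: "(\<lambda>y. mollifier_grad \<epsilon> (x - y)) \<in> borel_measurable lebesgue"
    by (rule measurable_completion) measurable
  have \<phi>m: "?\<phi> \<in> borel_measurable lborel" by measurable
  have Dint: "integrable lebesgue (\<lambda>y. indicat_real (cball x \<epsilon>) y *\<^sub>R D y)"
  proof -
    have "D locally_integrable_on UNIV" using div unfolding has_distributional_divergence_def by (elim conjE)
    then have "set_integrable lebesgue (cball x \<epsilon>) D" unfolding locally_integrable_on_def by simp
    then show ?thesis by (simp only: set_integrable_def)
  qed
  have out: "?\<phi> y = 0" if "y \<notin> cball x \<epsilon>" for y
    using that mollifier_eq_0[OF \<epsilon>, of "x - y"] by (simp add: dist_norm)
  have prod: "?\<phi> y * D y = ?\<phi> y * (indicat_real (cball x \<epsilon>) y *\<^sub>R D y)" for y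
    using out[of y] by (cases "y \<in> cball x \<epsilon>") auto
  have int: "integrable lebesgue (\<lambda>y. ?\<phi> y * D y)"
  proof (rule Bochner_Integration.integrable_bound)
    let ?K = "1 / kernel_mass TYPE('a) \<epsilon>"
    show "integrable lebesgue (\<lambda>y. ?K * norm (indicat_real (cball x \<epsilon>) y *\<^sub>R D y))"
      by (intro integrable_mult_right integrable_norm Dint)
    show "(\<lambda>y. ?\<phi> y * D y) \<in> borel_measurable lebesgue"
      unfolding prod by (intro borel_measurable_times measurable_completion[OF \<phi>m] borel_measurable_integrable Dint)
    show "AE y in lebesgue. norm (?\<phi> y * D y) \<le> norm (?K * norm (indicat_real (cball x \<epsilon>) y *\<^sub>R D y))"
    proof (rule AE_I2)
      fix y
      have "norm (?\<phi> y * D y) = norm (?\<phi> y) * norm (indicat_real (cball x \<epsilon>) y *\<^sub>R D y)"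
        unfolding prod norm_mult ..
      also have "\<dots> \<le> ?K * norm (indicat_real (cball x \<epsilon>) y *\<^sub>R D y)"
        by (intro mult_right_mono mollifier_bounded[OF \<epsilon>]) simp
      finally show "norm (?\<phi> y * D y) \<le> norm (?K * norm (indicat_real (cball x \<epsilon>) y *\<^sub>R D y))"
        using kernel_mass_pos[OF \<epsilon>, where 'a='a] by simp
    qed
  qed
  have \<phi>1: "integrable lborel ?\<phi>" "(LINT y|lborel. ?\<phi> y) = 1"
    using integrableI_nonneg[of ?\<phi> lborel] integral_eq_nn_integral[of ?\<phi> lborel] nn_integral_mollifier[OF \<epsilon>, of x]
    by (auto simp: mollifier_nonneg)
  have "- c = (LINT y|lebesgue. - c * ?\<phi> y)"
    using integral_completion[OF \<phi>m] \<phi>1(2) by simp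
  also have "\<dots> \<le> (LINT y|lebesgue. ?\<phi> y * D y)"
  proof (rule integral_mono_AE[OF _ int])
    show "integrable lebesgue (\<lambda>y. - c * ?\<phi> y)"
      using \<phi>1(1) integrable_completion[OF \<phi>m] by (intro integrable_mult_right) simp
    have "AE y in lebesgue. - D y \<le> c" by (rule AE_completion[OF D])
    then show "AE y in lebesgue. - c * ?\<phi> y \<le> ?\<phi> y * D y"
    proof eventually_elim
      case (elim y)
      then have "?\<phi> y * - c \<le> ?\<phi> y * D y" by (intro mult_left_mono mollifier_nonneg) simp
      then show ?case by (simp add: mult.commute)
    qed
  qed
  also have "\<dots> = - (LINT y|lebesgue. frechet_derivative ?\<phi> (at y) (u y))"
    using div mollifier_test_function[OF \<epsilon>, of x] unfolding has_distributional_divergence_def by simp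
  also have "\<dots> = (LINT y|lebesgue. mollifier_grad \<epsilon> (x - y) \<bullet> u y)"
    by (simp add: mollifier_shift_derivative)
  also have "\<dots> = (LINT y|lebesgue. mollifier_grad \<epsilon> (x - y) \<bullet> v y)"
  proof (rule integral_cong_AE)
    show "(\<lambda>y. mollifier_grad \<epsilon> (x - y) \<bullet> u y) \<in> borel_measurable lebesgue" by (intro borel_measurable_inner gm um)
    show "(\<lambda>y. mollifier_grad \<epsilon> (x - y) \<bullet> v y) \<in> borel_measurable lebesgue"
      by (intro borel_measurable_inner gm measurable_completion) simp
    show "AE y in lebesgue. mollifier_grad \<epsilon> (x - y) \<bullet> u y = mollifier_grad \<epsilon> (x - y) \<bullet> v y"
      by (rule AE_completion) (use eq in \<open>auto elim!: eventually_mono\<close>)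
  qed
  also have "\<dots> = (LINT y|lborel. mollifier_grad \<epsilon> (x - y) \<bullet> v y)"
    by (rule integral_completion) measurable
  finally show ?thesis .
qed

lemma AE_slice_eq:
  assumes null: "AE t in lborel. {x. (t, x) \<in> Z} \<in> null_sets lborel"
    and eq: "\<And>t x. t \<in> {0..T} \<Longrightarrow> (t, x) \<notin> Z \<Longrightarrow> f t x = f' t x"
  shows "AE t in lborel. t \<in> {0..T} \<longrightarrow> (AE x in lborel. f t x = f' t x)"
  using null
proof eventually_elim
  case (elim t)
  show ?case using AE_not_in[OF elim] by (auto elim!: eventually_mono intro: eq)
qed

text \<open>\<open>m\<close> is the slicewise essential supremum of the negative part. Its
  measurability in time is obtained from a Borel representative, whose essential suprema agree with
  the given ones at almost every time.\<close>

lemma ex_divergence_bound: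
  fixes D :: "real \<Rightarrow> 'a::euclidean_space \<Rightarrow> real"
  assumes "L1_Linf T (\<lambda>t x. max 0 (- D t x))"
  obtains m where "integrable lborel m" "\<And>t. 0 \<le> m t"
    "AE t in lborel. t \<in> {0..T} \<longrightarrow> (AE x in lborel. - D t x \<le> m t)"
proof -
  let ?h = "\<lambda>t x. max 0 (- D t x)"
  have strip: "measurable_on_strip T ?h" and
    fin: "(\<integral>\<^sup>+ t\<in>{0..T}. esssup lebesgue (\<lambda>x. ennreal \<bar>?h t x\<bar>) \<partial>lebesgue) < \<infinity>"
    using assms by (auto simp: L1_Linf_def)
  obtain h' Z where h'[measurable]: "case_prod h' \<in> borel_measurable (borel \<Otimes>\<^sub>M borel)"
    and "Z \<in> sets (borel \<Otimes>\<^sub>M borel)"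
    and Z: "AE t in lborel. {x. (t, x) \<in> Z} \<in> null_sets lborel" "\<And>t x. t \<in> {0..T} \<Longrightarrow> (t, x) \<notin> Z \<Longrightarrow> ?h t x = h' t x"
    by (rule strip_version[OF strip]) blast
  define e where "e t = esssup lborel (\<lambda>x. ennreal \<bar>h' t x\<bar>)" for t
  have e[measurable]: "e \<in> borel_measurable borel"
    unfolding e_def by (rule esssup_slice_measurable) measurable
  have eq: "AE t in lborel. t \<in> {0..T} \<longrightarrow> (AE x in lborel. ?h t x = h' t x)"
    by (rule AE_slice_eq[OF Z])
  have ess: "esssup lebesgue (\<lambda>x. ennreal \<bar>?h t x\<bar>) = e t" if "AE x in lborel. ?h t x = h' t x" for t
  proof -
    have m': "(\<lambda>x. ennreal \<bar>h' t x\<bar>) \<in> borel_measurable borel" by measurable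
    have ae: "AE x in lborel. ennreal \<bar>?h t x\<bar> = ennreal \<bar>h' t x\<bar>" using that by eventually_elim simp
    have m: "(\<lambda>x. ennreal \<bar>?h t x\<bar>) \<in> borel_measurable lebesgue"
      by (rule lebesgue_measurable_AE_eq[OF m' ae])
    have "(AE x in lborel. ennreal \<bar>?h t x\<bar> \<le> z) \<longleftrightarrow> (AE x in lborel. ennreal \<bar>h' t x\<bar> \<le> z)" for z
      by (rule eventually_cong[OF ae]) simp
    then show ?thesis
      unfolding e_def esssup_eq_AE[OF m] using m' by (subst esssup_eq_AE) (simp_all add: AE_completion_iff)
  qed
  have "(\<integral>\<^sup>+ t. e t * indicator {0..T} t \<partial>lborel) = (\<integral>\<^sup>+ t. e t * indicator {0..T} t \<partial>lebesgue)"
    by (simp add: nn_integral_completion)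
  also have "\<dots> = (\<integral>\<^sup>+ t\<in>{0..T}. esssup lebesgue (\<lambda>x. ennreal \<bar>?h t x\<bar>) \<partial>lebesgue)"
  proof (rule nn_integral_cong_AE, rule AE_completion, use eq in eventually_elim)
    case (elim t)
    then show ?case using ess[of t] by (cases "t \<in> {0..T}") simp_all
  qed
  finally have efin: "(\<integral>\<^sup>+ t. e t * indicator {0..T} t \<partial>lborel) < \<infinity>" using fin by simp
  then have "AE t in lborel. e t * indicator {0..T} t \<noteq> \<infinity>" by (intro nn_integral_PInf_AE) auto
  then have e_fin: "AE t in lborel. t \<in> {0..T} \<longrightarrow> e t < \<infinity>"
    by eventually_elim (auto simp: indicator_def less_top)
  \<comment> \<open>\<open>enn2real\<close> sends an infinite essential supremum to 0; this concerns
    only a null set of times. The indicator discards the times outside the interval.\<close>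
  define m where "m t = enn2real (e t) * indicator {0..T} t" for t
  have "AE t in lborel. t \<in> {0..T} \<longrightarrow> (AE x in lborel. - D t x \<le> m t)"
    using eq e_fin
  proof eventually_elim
    case (elim t)
    show ?case
    proof
      assume t: "t \<in> {0..T}"
      have "AE x in lborel. ennreal \<bar>h' t x\<bar> \<le> e t" unfolding e_def by (rule esssup_AE)
      moreover have "AE x in lborel. ?h t x = h' t x" using elim t by blast
      ultimately show "AE x in lborel. - D t x \<le> m t"
      proof eventually_elim
        case (elim x)
        have "ennreal \<bar>h' t x\<bar> \<le> ennreal (m t)"
          using elim(1) t \<open>t \<in> {0..T} \<longrightarrow> e t < \<infinity>\<close> by (simp add: m_def)
        then have "\<bar>h' t x\<bar> \<le> m t" by (subst (asm) ennreal_le_iff) (auto simp: m_def)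
        then show ?case using elim(2) by linarith
      qed
    qed
  qed
  moreover have "integrable lborel m"
  proof (rule integrableI_nonneg)
    show "m \<in> borel_measurable lborel" unfolding m_def by measurable
    have "(\<integral>\<^sup>+ t. ennreal (m t) \<partial>lborel) \<le> (\<integral>\<^sup>+ t. e t * indicator {0..T} t \<partial>lborel)"
    proof (rule nn_integral_mono)
      fix t show "ennreal (m t) \<le> e t * indicator {0..T} t"
        by (cases "e t") (auto simp: m_def indicator_def)
    qed
    then show "(\<integral>\<^sup>+ t. ennreal (m t) \<partial>lborel) < \<infinity>" using efin by (rule le_less_trans)
  qed (simp add: m_def)
  moreover have "0 \<le> m t" for t by (simp add: m_def)
  ultimately show ?thesis using that by blast
qed

theorem theorem3p2:
  fixes T :: real
    and \<rho> :: "real \<Rightarrow> real"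
    and b :: "real \<Rightarrow> real ^ 'n \<Rightarrow> real ^ 'n"
    and g div_b :: "real \<Rightarrow> real ^ 'n \<Rightarrow> real"
  assumes "T > 0"
    and "osgood_modulus \<rho>"
    and "measurable_on_strip T b"
    and "bounded ((\<lambda>(t, x). b t x) ` ({0..T} \<times> UNIV))"
    and "condition_H \<rho> T b g"
    and "has_spatial_divergence T b div_b"
    and "L1_Linf T (\<lambda>t x. max 0 (- div_b t x))"
  shows "(\<exists>X. regular_lagrangian_flow T b X) \<and>
    (\<forall>X Y. regular_lagrangian_flow T b X \<and> regular_lagrangian_flow T b Y \<longrightarrow>
       (AE x in lebesgue. \<forall>t\<in>{0..T}. X t x = Y t x))"
proof -
  obtain M where "\<forall>y\<in>(\<lambda>(t, x). b t x) ` ({0..T} \<times> UNIV). norm y \<le> M"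
    using assms(4) unfolding bounded_iff by blast
  then have M: "\<And>t x. t \<in> {0..T} \<Longrightarrow> norm (b t x) \<le> M" by force
  have M0: "0 \<le> M" using order_trans[OF norm_ge_zero M[of 0 0]] assms(1) by simp
  have gstrip: "measurable_on_strip T g" and gfin: "\<And>K. compact K \<Longrightarrow>
       (\<integral>\<^sup>+ t\<in>{0..T}. (\<integral>\<^sup>+ x\<in>K. ennreal \<bar>g t x\<bar> \<partial>lebesgue) \<partial>lebesgue) < \<infinity>"
    and g0: "\<And>t x. t \<in> {0..T} \<Longrightarrow> 0 \<le> g t x"
    using assms(5) by (auto simp: condition_H_def L1_L1loc_def)
  obtain N where N: "\<And>t. t \<in> {0..T} \<Longrightarrow> N t \<in> null_sets lebesgue"
    "\<And>t x y. t \<in> {0..T} \<Longrightarrow> x \<notin> N t \<Longrightarrow> y \<notin> N t \<Longrightarrow>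
      norm (b t x - b t y) \<le> (g t x + g t y) * \<rho> (norm (x - y))"
    using assms(5) unfolding condition_H_def by blast
  obtain bb Z where bb[measurable]: "case_prod bb \<in> borel_measurable (borel \<Otimes>\<^sub>M borel)" and Z: "Z \<in> sets (borel \<Otimes>\<^sub>M borel)"
    "AE t in lborel. {x. (t, x) \<in> Z} \<in> null_sets lborel" "\<And>t x. t \<in> {0..T} \<Longrightarrow> (t, x) \<notin> Z \<Longrightarrow> b t x = bb t x"
    by (rule strip_version[OF assms(3)]) blast
  obtain gg W where gg[measurable]: "case_prod gg \<in> borel_measurable (borel \<Otimes>\<^sub>M borel)"
    and "W \<in> sets (borel \<Otimes>\<^sub>M borel)"
    and W: "AE t in lborel. {x. (t, x) \<in> W} \<in> null_sets lborel" "\<And>t x. t \<in> {0..T} \<Longrightarrow> (t, x) \<notin> W \<Longrightarrow> g t x = gg t x"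
    by (rule strip_version[OF gstrip]) blast
  obtain m0 where m0: "integrable lborel m0" "\<And>t. 0 \<le> m0 t"
    "AE t in lborel. t \<in> {0..T} \<longrightarrow> (AE x in lborel. - div_b t x \<le> m0 t)"
    by (rule ex_divergence_bound[OF assms(7)]) blast
  \<comment> \<open>A Borel representative obeys the bound and the sign condition only almost
    everywhere. Truncation makes them hold at every point; where the representative agrees with the
    given function nothing changes, so \<open>Z\<close> and \<open>W\<close> remain valid
    exceptional sets.\<close>
  define b' where "b' t x = (if t \<in> {0..T} \<and> norm (bb t x) \<le> M then bb t x else 0)" for t x
  define g' where "g' t x = (if t \<in> {0..T} then max 0 (gg t x) else 0)" for t x
  have b'm[measurable]: "case_prod b' \<in> borel_measurable (borel \<Otimes>\<^sub>M borel)" unfolding b'_def case_prod_beta by measurable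
  have g'm[measurable]: "case_prod g' \<in> borel_measurable (borel \<Otimes>\<^sub>M borel)" unfolding g'_def case_prod_beta by measurable
  have b_eq: "b t x = b' t x" if "t \<in> {0..T}" "(t, x) \<notin> Z" for t x
    using Z(3)[OF that] M[OF that(1), of x] that(1) by (simp add: b'_def)
  have g_eq: "g t x = g' t x" if "t \<in> {0..T}" "(t, x) \<notin> W" for t x
    using W(2)[OF that] g0[OF that(1), of x] that(1) by (simp add: g'_def)
  have b_slice: "AE t in lborel. t \<in> {0..T} \<longrightarrow> (AE x in lborel. b t x = b' t x)"
    by (rule AE_slice_eq[OF Z(2)]) (rule b_eq)
  have g_slice: "AE t in lborel. t \<in> {0..T} \<longrightarrow> (AE x in lborel. g t x = g' t x)"
    by (rule AE_slice_eq[OF W(1)]) (rule g_eq)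
  interpret osgood_divergence \<rho> T M b' g' m0
  proof unfold_locales
    show "osgood_modulus \<rho>" by (rule assms(2))
    show "0 < T" by (rule assms(1))
    show "norm (b' t x) \<le> M" "t \<notin> {0..T} \<Longrightarrow> b' t x = 0" for t x using M0 by (auto simp: b'_def)
    show "0 \<le> g' t x" "t \<notin> {0..T} \<Longrightarrow> g' t x = 0" for t x by (auto simp: g'_def)
    show "case_prod b' \<in> borel_measurable (borel \<Otimes>\<^sub>M borel)" "case_prod g' \<in> borel_measurable (borel \<Otimes>\<^sub>M borel)" by measurable
    show "integrable lborel m0" "0 \<le> m0 t" for t using m0 by auto
    show "(\<integral>\<^sup>+ t. (\<integral>\<^sup>+ x\<in>cball 0 R. ennreal (g' t x) \<partial>lborel) \<partial>lborel) < \<infinity>" for R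
    proof -
      have "(\<integral>\<^sup>+ t. (\<integral>\<^sup>+ x\<in>cball 0 R. ennreal (g' t x) \<partial>lborel) \<partial>lborel)
        = (\<integral>\<^sup>+ t. (\<integral>\<^sup>+ x\<in>cball 0 R. ennreal (g' t x) \<partial>lborel) \<partial>lebesgue)" by (simp add: nn_integral_completion)
      also have "\<dots> = (\<integral>\<^sup>+ t\<in>{0..T}. (\<integral>\<^sup>+ x\<in>cball 0 R. ennreal \<bar>g t x\<bar> \<partial>lebesgue) \<partial>lebesgue)"
      proof (rule nn_integral_cong_AE, rule AE_completion, use g_slice in eventually_elim)
        case (elim t)
        show ?case
        proof (cases "t \<in> {0..T}")
          case True
          have ae: "AE x in lborel. g t x = g' t x" using elim True by blast
          have "(\<integral>\<^sup>+ x\<in>cball 0 R. ennreal \<bar>g t x\<bar> \<partial>lborel) = (\<integral>\<^sup>+ x\<in>cball 0 R. ennreal (g' t x) \<partial>lborel)"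
            by (rule nn_integral_cong_AE, use ae in eventually_elim) (simp add: g'_def True)
          then show ?thesis using True by (simp add: nn_integral_completion)
        next
          case False
          then have "g' t x = 0" for x by (auto simp: g'_def)
          then show ?thesis using False by simp
        qed
      qed
      also have "\<dots> < \<infinity>" by (rule gfin) simp
      finally show ?thesis .
    qed
    show "AE t in lborel. \<exists>N\<in>null_sets lborel. \<forall>x y. x \<notin> N \<longrightarrow> y \<notin> N \<longrightarrow>
              norm (b' t x - b' t y) \<le> (g' t x + g' t y) * \<rho> (norm (x - y))"
      using Z(2) W(1)
    proof eventually_elim
      case (elim t)
      show ?case
      proof (cases "t \<in> {0..T}")
        case True
        obtain N' where N': "N' \<in> null_sets lborel" "N t \<subseteq> N'"
          using N(1)[OF True] unfolding null_sets_completion_iff2 by blast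
        \<comment> \<open>Outside these three null sets (H) holds for the given functions, and both
          the field and \<open>g\<close> agree with their representatives. \<open>N'\<close> is a
          Borel null set that contains the Lebesgue null set \<open>N t\<close>.\<close>
        let ?N = "N' \<union> {x. (t, x) \<in> Z} \<union> {x. (t, x) \<in> W}"
        have "norm (b' t x - b' t y) \<le> (g' t x + g' t y) * \<rho> (norm (x - y))" if "x \<notin> ?N" "y \<notin> ?N" for x y
        proof -
          have "b t x = b' t x" "b t y = b' t y" "g t x = g' t x" "g t y = g' t y"
            using that by (auto intro!: b_eq g_eq True)
          moreover have "norm (b t x - b t y) \<le> (g t x + g t y) * \<rho> (norm (x - y))"
            using that N'(2) by (intro N(2)[OF True]) auto
          ultimately show ?thesis by simp
        qed
        moreover have "?N \<in> null_sets lborel" using elim N'(1) by (intro null_sets.Un)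
        ultimately show ?thesis by blast
      next
        case False
        then have "b' t x = 0" "g' t x = 0" for x by (auto simp: b'_def g'_def)
        then show ?thesis by (intro bexI[of _ "{}"]) auto
      qed
    qed
    have "AE t in lebesgue. t \<in> {0..T} \<longrightarrow> has_distributional_divergence (b t) (div_b t)"
      using assms(6) unfolding has_spatial_divergence_def by (subst (asm) AE_restrict_space_iff) auto
    then have "AE t in lborel. t \<in> {0..T} \<longrightarrow> has_distributional_divergence (b t) (div_b t)"
      by (simp add: AE_completion_iff)
    then show "AE t in lborel. \<forall>\<epsilon>>0. \<forall>x. - m0 t \<le> (LINT y|lborel. mollifier_grad \<epsilon> (x - y) \<bullet> b' t y)"
      using b_slice m0(3)
    proof eventually_elim
      case (elim t)
      show ?case
      proof (intro allI impI)
        fix \<epsilon> :: real and x :: "real^'n" assume \<epsilon>: "0 < \<epsilon>"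
        show "- m0 t \<le> (LINT y|lborel. mollifier_grad \<epsilon> (x - y) \<bullet> b' t y)"
        proof (cases "t \<in> {0..T}")
          case True
          have "b' t \<in> borel_measurable borel" by measurable
          then show ?thesis using elim True \<epsilon> by (intro mollified_divergence_ge[of "b t" "div_b t"]) auto
        next
          case False
          then have "b' t y = 0" for y by (auto simp: b'_def)
          then show ?thesis using m0(2) by simp
        qed
      qed
    qed
  qed
  have loc: "(\<lambda>(t, x). b t x) locally_integrable_on ({0..T} \<times> UNIV)"
    unfolding locally_integrable_on_def set_integrable_def
  proof (intro allI impI)
    fix K :: "(real \<times> (real^'n)) set" assume K: "compact K \<and> K \<subseteq> {0..T} \<times> UNIV"
    let ?S = "{0..T} \<times> (UNIV :: (real^'n) set)"
    have "closed ?S" by (intro closed_Times) auto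
    then have S: "?S \<in> sets lebesgue" by simp
    have Km: "K \<in> sets borel" using K by (auto intro: borel_compact)
    have "(\<lambda>z. indicator ?S z *\<^sub>R (case z of (t, x) \<Rightarrow> b t x)) \<in> borel_measurable lebesgue"
      using assms(3) S unfolding measurable_on_strip_def by (subst (asm) borel_measurable_restrict_space_iff) auto
    moreover have "indicat_real K \<in> borel_measurable lebesgue"
      using Km by (intro borel_measurable_indicator) auto
    ultimately have "(\<lambda>z. indicat_real K z *\<^sub>R (indicat_real ?S z *\<^sub>R (case z of (t, x) \<Rightarrow> b t x))) \<in> borel_measurable lebesgue"
      by (rule borel_measurable_scaleR[rotated])
    moreover have "(\<lambda>z. indicat_real K z *\<^sub>R (indicat_real ?S z *\<^sub>R (case z of (t, x) \<Rightarrow> b t x))) = (\<lambda>z. indicat_real K z *\<^sub>R (case z of (t, x) \<Rightarrow> b t x))"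
      using K by (auto simp: indicator_def fun_eq_iff)
    ultimately have meas: "(\<lambda>z. indicat_real K z *\<^sub>R (case z of (t, x) \<Rightarrow> b t x)) \<in> borel_measurable lebesgue" by simp
    show "integrable lebesgue (\<lambda>z. indicat_real K z *\<^sub>R (case z of (t, x) \<Rightarrow> b t x))"
    proof (rule Bochner_Integration.integrable_bound[OF _ meas])
      show "integrable lebesgue (\<lambda>z. M * indicat_real K z)"
        using Km K emeasure_bounded_finite[of K] by (intro integrable_mult_right integrable_real_indicator) (auto dest: compact_imp_bounded)
      show "AE z in lebesgue. norm (indicat_real K z *\<^sub>R (case z of (t, x) \<Rightarrow> b t x)) \<le> norm (M * indicat_real K z)"
        using K M M0 by (intro AE_I2) (auto simp: indicator_def)
    qed
  qed
  obtain L Y where Y: "transport L Y (\<lambda>s x. b' s (Y s x))" using ex_transport by blast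
  have "regular_lagrangian_flow T b Y"
    by (rule transport_imp_flow[OF Z(1,2) _ Y loc]) (rule b_eq)
  moreover have "AE x in lebesgue. \<forall>t\<in>{0..T}. X t x = Y t x"
    if "regular_lagrangian_flow T b X" "regular_lagrangian_flow T b Y" for X Y
    by (rule flow_unique[OF Z(1,2) _ that]) (rule b_eq)
  ultimately show ?thesis by blast
qed

end
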